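(* Let $n\ge 3$, $\alpha\in(0,n)$, $s\in(0,1)$, $\lambda>0$, $\mu>0$, $\tau>0$ and $\frac{n+\alpha}{n}\le p\le\frac{2s+n+\alpha}{n}$. If $u\in H^1(\mathbb{R}^n)$ is a weak solution of $$-\Delta u+\lambda(-\Delta)^s u+u=\mu\,(I_\alpha*|u|^p)|u|^{p-2}u\ \text{ in }\mathbb{R}^n,\qquad \|u\|_2^2=\tau,$$ then $u\in L^q(\mathbb{R}^n)$ for every $q\in\left[2,\frac{n}{\alpha}\frac{2n}{n-2}\right)$.
   Context: $\|\cdot\|_2$ is the $L^2(\mathbb{R}^n)$ norm. The Riesz potential is $I_\alpha(x)=\frac{A_{n,\alpha}}{|x|^{n-\alpha}}$ for $x\in\mathbb{R}^n\setminus\{0\}$, with $A_{n,\alpha}=\frac{\Gamma(\frac{n-\alpha}{2})}{\pi^{n/2}2^{\alpha}\Gamma(\frac{\alpha}{2})}$. The fractional Laplacian is $(-\Delta)^su(x)=C(n,s)\,\mathrm{P.V.}\int_{\mathbb{R}^n}\frac{u(x)-u(y)}{|x-y|^{n+2s}}dy$, with $C(n,s)=\left(\int_{\mathbb{R}^n}\frac{1-\cos(x_1)}{|x|^{n+2s}}dx\right)^{-1}$. Put $\ll u,v\gg=\frac{C(n,s)}{2}\int_{\mathbb{R}^n}\int_{\mathbb{R}^n}\frac{(u(x)-u(y))(v(x)-v(y))}{|x-y|^{n+2s}}dxdy$. A function $u\in H^1(\mathbb{R}^n)$ is a weak solution of the problem if $\|u\|_2^2=\tau$ and, for every $v\in H^1(\mathbb{R}^n)$,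 $$\int_{\mathbb{R}^n}\nabla u\cdot\nabla v\,dx+\lambda\ll u,v\gg+\int_{\mathbb{R}^n}uv\,dx=\mu\int_{\mathbb{R}^n}(I_\alpha*|u|^p)|u|^{p-2}uv\,dx.$$ *)

theory Defs
  imports "HOL-Analysis.Analysis"
begin

text \<open>
  The space $R^n$ is \<open>real ^ 'n\<close> with \<open>n = CARD('n)\<close>. All integrals are Lebesgue (Bochner)
  integrals against \<^const>\<open>lebesgue\<close>. Elements of function spaces are represented by
  Lebesgue measurable functions rather than by almost-everywhere classes.
\<close>

definition Lp :: "real \<Rightarrow> ('a::euclidean_space \<Rightarrow> 'b::euclidean_space) set" where
  "Lp q = {f \<in> borel_measurable lebesgue. integrable lebesgue (\<lambda>x. norm (f x) powr q)}"

definition Lp_norm :: "real \<Rightarrow> ('a::euclidean_space \<Rightarrow> 'b::euclidean_space) \<Rightarrow> real" where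
  "Lp_norm q f = (LINT x|lebesgue. norm (f x) powr q) powr (1 / q)"

definition partial_deriv :: "'n \<Rightarrow> (real ^ 'n \<Rightarrow> real) \<Rightarrow> real ^ 'n \<Rightarrow> real" where
  "partial_deriv i f x = frechet_derivative f (at x) (axis i 1)"

text \<open>In the successor case, differentiability makes \<^const>\<open>frechet_derivative\<close> meaningful.\<close>

fun continuously_differentiable :: "nat \<Rightarrow> (real ^ 'n \<Rightarrow> real) \<Rightarrow> bool" where
  "continuously_differentiable 0 f \<longleftrightarrow> continuous_on UNIV f"
| "continuously_differentiable (Suc k) f \<longleftrightarrow>
     f differentiable_on UNIV \<and> (\<forall>i. continuously_differentiable k (partial_deriv i f))"

definition test_functions :: "(real ^ 'n \<Rightarrow> real) set" where
  "test_functions =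
     {\<phi>. (\<forall>k. continuously_differentiable k \<phi>) \<and> compact (closure {x. \<phi> x \<noteq> 0})}"

definition is_weak_gradient :: "(real ^ 'n \<Rightarrow> real) \<Rightarrow> (real ^ 'n \<Rightarrow> real ^ 'n) \<Rightarrow> bool" where
  "is_weak_gradient u g \<longleftrightarrow>
     (\<forall>\<phi>\<in>test_functions. \<forall>i.
        (LINT x|lebesgue. u x * partial_deriv i \<phi> x) = - (LINT x|lebesgue. g x $ i * \<phi> x))"

definition H1 :: "(real ^ 'n \<Rightarrow> real) set" where
  "H1 = {u \<in> Lp 2. \<exists>g \<in> Lp 2. is_weak_gradient u g}"

text \<open>
  For \<open>u \<in> H1\<close> the weak gradient is unique up to almost-everywhere equality; this picks a
  representative. The restriction to \<open>Lp 2\<close> matters: Bochner integrals of non-integrable functions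
  are \<open>0\<close>, so \<^const>\<open>is_weak_gradient\<close> alone would not determine \<open>g\<close>.
\<close>

definition weak_grad :: "(real ^ 'n \<Rightarrow> real) \<Rightarrow> real ^ 'n \<Rightarrow> real ^ 'n" where
  "weak_grad u = (SOME g. g \<in> Lp 2 \<and> is_weak_gradient u g)"

definition riesz_const :: "nat \<Rightarrow> real \<Rightarrow> real" where
  "riesz_const n \<alpha> =
     Gamma ((real n - \<alpha>) / 2) / (pi powr (real n / 2) * 2 powr \<alpha> * Gamma (\<alpha> / 2))"

text \<open>At the origin, where the potential is left undefined, this yields \<open>0\<close>.\<close>

definition riesz_potential :: "real \<Rightarrow> real ^ 'n \<Rightarrow> real" where
  "riesz_potential \<alpha> x = riesz_const CARD('n) \<alpha> / norm x powr (real CARD('n) - \<alpha>)"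

definition convolution :: "(real ^ 'n \<Rightarrow> real) \<Rightarrow> (real ^ 'n \<Rightarrow> real) \<Rightarrow> real ^ 'n \<Rightarrow> real" where
  "convolution f g x = (LINT y|lebesgue. f (x - y) * g y)"

text \<open>
  The constant $C(n,s)$. The index type has no distinguished first element, so the coordinate $x_1$
  is rendered by an arbitrary one; by symmetry the integral does not depend on it.
\<close>

definition frac_const :: "'n::finite itself \<Rightarrow> real \<Rightarrow> real" where
  "frac_const _ s =
     inverse (LINT x|lebesgue. (1 - cos ((x :: real ^ 'n) $ (SOME i. True)))
                                 / norm x powr (real CARD('n) + 2 * s))"

definition frac_form :: "real \<Rightarrow> (real ^ 'n \<Rightarrow> real) \<Rightarrow> (real ^ 'n \<Rightarrow> real) \<Rightarrow> real" where
  "frac_form s u v = frac_const TYPE('n) s / 2 *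
     (LINT y|lebesgue. LINT x|lebesgue.
        (u x - u y) * (v x - v y) / norm (x - y) powr (real CARD('n) + 2 * s))"

text \<open>
  In the right-hand side below, \<open>\<bar>u x\<bar> powr (p - 2) * u x\<close> is \<open>0\<close> where \<open>u x = 0\<close>, also for
  \<open>p < 2\<close>.
\<close>

definition weak_solution ::
  "real \<Rightarrow> real \<Rightarrow> real \<Rightarrow> real \<Rightarrow> real \<Rightarrow> real \<Rightarrow> (real ^ 'n \<Rightarrow> real) \<Rightarrow> bool" where
  "weak_solution \<alpha> s l \<mu> \<tau> p u \<longleftrightarrow>
     u \<in> H1 \<and> (Lp_norm 2 u)\<^sup>2 = \<tau> \<and>
     (\<forall>v\<in>H1.
        (LINT x|lebesgue. weak_grad u x \<bullet> weak_grad v x) + l * frac_form s u v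
          + (LINT x|lebesgue. u x * v x)
        = \<mu> * (LINT x|lebesgue.
                 convolution (riesz_potential \<alpha>) (\<lambda>y. \<bar>u y\<bar> powr p) x
                   * \<bar>u x\<bar> powr (p - 2) * u x * v x))"

end

theory Submission
  imports Defs
begin

text \<open>
  The integrability of a solution \<open>u\<close> is raised by testing the equation with powers of \<open>u\<close>.
  Let \<open>v = G(u)\<close> with \<open>G\<close> nondecreasing and \<open>G' = H'\<^sup>2\<close>. Then
  \<open>\<nabla>u \<cdot> \<nabla>v = \<bar>\<nabla>H(u)\<bar>\<^sup>2\<close>, the Cauchy-Schwarz inequality gives \<open>u v \<ge> H(u)\<^sup>2\<close>, and the
  fractional form of \<open>u\<close> and \<open>v\<close> is nonnegative because \<open>G\<close> is monotone. Hence
  \<open>\<parallel>H(u)\<parallel>\<^sup>2\<close> in \<open>H1\<close> is at most a multiple of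
  \<open>\<integral>\<integral> \<bar>u(y)\<bar>\<^sup>p \<bar>x - y\<bar>\<^bsup>\<alpha>-n\<^esup> \<bar>u(x)\<bar>\<^bsup>p-1\<^esup> \<bar>G(u(x))\<bar>\<close> (\<open>weak_solution_energy\<close>).
  With \<open>H(u)\<close> a truncation of \<open>\<bar>u\<bar>\<^sup>\<beta>\<close>, the right-hand side is bounded independently of the
  truncation as soon as \<open>u\<close> is in \<open>L\<^sup>q\<close> for a suitable \<open>q\<close>, and the embedding of \<open>H1\<close> into
  \<open>L\<^sup>r\<close> then puts \<open>u\<close> into \<open>L\<^bsup>\<beta>r\<^esup>\<close> (\<open>solution_integrability_gain\<close>).

  The bound \<open>p \<le> 1 + (\<alpha> + 2 s) / n\<close> with \<open>s < 1\<close> leaves room: with the embedding exponent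
  \<open>r = 2 + 2 (1 + s) / n\<close>, which is less than \<open>2 + 4 / n\<close>, every round raises the exponent of
  integrability by a fixed \<open>\<eta> > 0\<close>, so that any given \<open>q\<close> is reached after finitely many
  rounds, starting from \<open>q = r\<close>. The same room makes all exponent conditions strict, and two
  elementary estimates then carry the argument.

  \<^item> The embedding, a weak form of the Sobolev inequality: if \<open>\<parallel>w\<parallel>\<^sub>2 \<le> M\<close> and
    \<open>\<parallel>w(\<cdot> + z) - w\<parallel>\<^sub>2 \<le> \<bar>z\<bar> M\<close> for all \<open>z\<close>, then \<open>w\<close> is bounded in \<open>L\<^sup>r\<close> for
    \<open>2 \<le> r < 2 + 4 / n\<close>. At a point where \<open>\<bar>w\<bar>\<close> is large, one compares \<open>w(x)\<close> with the values
    of \<open>w\<close> in a cube at \<open>x\<close> that is just large enough for the mean of \<open>w\<^sup>2\<close> over it to be small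
    compared to \<open>w(x)\<^sup>2\<close> (\<open>higher_integrability\<close>).
  \<^item> A weak form of the Hardy-Littlewood-Sobolev inequality: the integrand \<open>f(y) K(x - y) g(x)\<close> is
    at most a sum of products of two powers, by the weighted inequality of arithmetic and
    geometric means, applied separately to \<open>K\<close> near the origin and away from it, so
    that the double integral is finite (\<open>riesz_energy_finite\<close>).

  Weak derivatives enter through a single identity. If \<open>D\<close> is the weak derivative of \<open>w\<close> in the
  direction \<open>z\<close>, then \<open>w(x + z) - w(x) = \<integral>\<^sub>0\<^sup>1 D(x + s z) ds\<close> for almost every \<open>x\<close>
  (\<open>weak_dir_deriv_translation_formula\<close>), by duality with test functions. It yields the
  translation estimate above, and the chain rule for \<open>H(w)\<close> by passing to the limit in difference
  quotients (\<open>weak_dir_deriv_chain\<close>).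
\<close>


section \<open>Smooth bumps on boxes\<close>

text \<open>
  For \<open>k = 0\<close> this is the standard function that is flat at the origin. The factor
  \<open>t\<^bsup>-k\<^esup>\<close> closes the family under differentiation, and \<open>c \<rightarrow> 0\<close> makes
  \<open>exp_flat 0 c\<close> increase to the indicator of the positive half-line.
\<close>

definition exp_flat :: "nat \<Rightarrow> real \<Rightarrow> real \<Rightarrow> real" where
  "exp_flat k c t = (if t > 0 then inverse t ^ k * exp (- (c / t)) else 0)"

lemma exp_flat_tendsto_0:
  assumes "c > 0"
  shows "(exp_flat k c \<longlongrightarrow> 0) (at 0)"
proof -
  have ct: "filterlim (\<lambda>y. c * y) at_top at_top"
    using assms by (intro filterlim_tendsto_pos_mult_at_top[OF tendsto_const]) (auto simp: filterlim_ident)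
  have "((\<lambda>y. (c * y) ^ k / exp (c * y) / c ^ k) \<longlongrightarrow> 0 / c ^ k) at_top"
    using assms by (intro tendsto_divide filterlim_compose[OF tendsto_power_div_exp_0 ct]) auto
  then have "((\<lambda>y. y ^ k * exp (- (c * y))) \<longlongrightarrow> 0) at_top"
    using assms by (simp add: power_mult_distrib exp_minus divide_inverse mult.assoc mult.left_commute[of "c^k"])
  then have "((\<lambda>t. inverse t ^ k * exp (- (c * inverse t))) \<longlongrightarrow> 0) (at_right 0)"
    by (rule filterlim_compose) (rule filterlim_inverse_at_top_right)
  then have right: "(exp_flat k c \<longlongrightarrow> 0) (at_right 0)"
    by (rule Lim_transform_eventually)
       (auto simp: exp_flat_def eventually_at_filter divide_inverse)
  have left: "(exp_flat k c \<longlongrightarrow> 0) (at_left 0)"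
    by (rule tendsto_eventually) (auto simp: exp_flat_def eventually_at_filter)
  from left right show ?thesis by (simp add: filterlim_at_split)
qed

lemma exp_flat_derivative:
  assumes "c > 0"
  shows "(exp_flat k c has_real_derivative
            (c * exp_flat (k + 2) c t - k * exp_flat (k + 1) c t)) (at t)"
proof -
  consider "t > 0" | "t < 0" | "t = 0" by linarith
  then show ?thesis
  proof cases
    case 1
    have pow: "n = 0 \<or> t ^ n = t * t ^ (n - Suc 0)" for n by (cases n) auto
    have "((\<lambda>t. inverse t ^ k * exp (- (c / t))) has_real_derivative
            (c * exp_flat (k + 2) c t - k * exp_flat (k + 1) c t)) (at t)"
      using 1 pow by (cases k) (auto intro!: derivative_eq_intros simp: exp_flat_def field_simps power2_eq_square)
    then show ?thesis
      by (rule has_field_derivative_transform_within_open[of _ _ _ "{0<..}"])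
         (use 1 in \<open>auto simp: exp_flat_def\<close>)
  next
    case 2
    have "((\<lambda>t. 0) has_real_derivative (c * exp_flat (k + 2) c t - k * exp_flat (k + 1) c t)) (at t)"
      using 2 by (simp add: exp_flat_def)
    then show ?thesis
      by (rule has_field_derivative_transform_within_open[of _ _ _ "{..<0}"])
         (use 2 in \<open>auto simp: exp_flat_def\<close>)
  next
    case 3
    \<comment> \<open>The difference quotient at the origin is the next member of the family.\<close>
    have "((\<lambda>h. (exp_flat k c h - exp_flat k c 0) / (h - 0)) \<longlongrightarrow> 0) (at 0)"
      by (rule Lim_transform_eventually[OF exp_flat_tendsto_0[OF assms, of "Suc k"]])
         (auto simp: exp_flat_def eventually_at_filter divide_inverse)
    then show ?thesis
      using 3 by (simp add: has_field_derivative_iff exp_flat_def)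
  qed
qed

text \<open>
  A class of functions that contains the bumps needed below and is closed under partial derivatives;
  differentiability together with this closure gives continuous differentiability of every order.
\<close>

inductive_set smooth_class :: "(real ^ 'n \<Rightarrow> real) set" where
  const: "(\<lambda>_. r) \<in> smooth_class"
| flat: "c > 0 \<Longrightarrow> (\<lambda>x. exp_flat k c (l * x $ i + d)) \<in> smooth_class"
| add: "f \<in> smooth_class \<Longrightarrow> g \<in> smooth_class \<Longrightarrow> (\<lambda>x. f x + g x) \<in> smooth_class"
| mult: "f \<in> smooth_class \<Longrightarrow> g \<in> smooth_class \<Longrightarrow> (\<lambda>x. f x * g x) \<in> smooth_class"

lemma partial_deriv_eq:
  "(f has_derivative f') (at x) \<Longrightarrow> partial_deriv i f x = f' (axis i 1)"
  by (metis partial_deriv_def frechet_derivative_at)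

lemma smooth_class_derivative:
  assumes "f \<in> smooth_class"
  shows "(\<forall>x. f differentiable (at x)) \<and> (\<forall>i. partial_deriv i f \<in> smooth_class)"
  using assms
proof induction
  case (const r)
  have "partial_deriv i (\<lambda>_. r) = (\<lambda>_. 0)" for i :: 'a
    by (rule ext) (rule partial_deriv_eq[THEN trans], rule has_derivative_const, simp)
  then show ?case by (auto intro: smooth_class.const)
next
  case (flat c k l i d)
  let ?D = "\<lambda>x::real^'a. c * exp_flat (k + 2) c (l * x $ i + d) - k * exp_flat (k + 1) c (l * x $ i + d)"
  have der: "((\<lambda>x. exp_flat k c (l * x $ i + d)) has_derivative (\<lambda>z. (l * z $ i) * ?D x)) (at x)" for x :: "real^'a"
  proof -
    have "((\<lambda>x. l * x $ i + d) has_derivative (\<lambda>z. l * z $ i)) (at x)"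
      by (auto intro!: derivative_eq_intros bounded_linear.has_derivative[OF bounded_linear_vec_nth])
    from has_derivative_compose[OF this exp_flat_derivative[OF flat, unfolded has_field_derivative_def]]
    show ?thesis by (simp add: mult.commute)
  qed
  have "partial_deriv j (\<lambda>x. exp_flat k c (l * x $ i + d)) =
      (\<lambda>x. (l * axis j 1 $ i) * (c * exp_flat (k + 2) c (l * x $ i + d) + (- real k) * exp_flat (k + 1) c (l * x $ i + d)))" for j
    by (rule ext, subst partial_deriv_eq[OF der]) simp
  moreover have "\<dots>j \<in> smooth_class" for j
    by (intro smooth_class.mult smooth_class.add smooth_class.const smooth_class.flat flat)
  ultimately show ?case using der unfolding differentiable_def by auto
next
  case (add f g)
  have "partial_deriv i (\<lambda>x. f x + g x) = (\<lambda>x. partial_deriv i f x + partial_deriv i g x)" for i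
    using add.IH
    by (intro ext partial_deriv_eq[THEN trans, OF has_derivative_add[OF frechet_derivative_works[THEN iffD1] frechet_derivative_works[THEN iffD1]]])
       (auto simp: partial_deriv_def)
  then show ?case using add.IH by (auto intro: smooth_class.add)
next
  case (mult f g)
  have "partial_deriv i (\<lambda>x. f x * g x) = (\<lambda>x. f x * partial_deriv i g x + partial_deriv i f x * g x)" for i
    using mult.IH
    by (intro ext partial_deriv_eq[THEN trans, OF has_derivative_mult[OF frechet_derivative_works[THEN iffD1] frechet_derivative_works[THEN iffD1]]])
       (auto simp: partial_deriv_def)
  then show ?case using mult by (auto intro!: smooth_class.add smooth_class.mult)
qed

lemma smooth_class_continuously_differentiable:
  "f \<in> smooth_class \<Longrightarrow> continuously_differentiable k f"
proof (induction k arbitrary: f)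
  case 0
  then show ?case using smooth_class_derivative[OF 0]
    by (auto intro!: continuous_at_imp_continuous_on differentiable_imp_continuous_within)
next
  case (Suc k)
  then show ?case using smooth_class_derivative[OF Suc.prems]
    by (auto simp: differentiable_on_def)
qed

text \<open>
  Smooth bumps that are positive exactly on a box: boxes, unlike balls, form an intersection-stable
  generator of the Borel sets.
\<close>

definition box_bump :: "real ^ 'n \<Rightarrow> real ^ 'n \<Rightarrow> real \<Rightarrow> real ^ 'n \<Rightarrow> real" where
  "box_bump a b c x = (\<Prod>i\<in>UNIV. exp_flat 0 c (x $ i - a $ i) * exp_flat 0 c (b $ i - x $ i))"

lemma box_bump_eq_0: "x \<notin> box a b \<Longrightarrow> box_bump a b c x = 0"
  by (auto simp: box_bump_def exp_flat_def mem_box_cart not_less) (metis leI not_less)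

lemma box_bump_bounds: "c > 0 \<Longrightarrow> 0 \<le> box_bump a b c x" "c > 0 \<Longrightarrow> box_bump a b c x \<le> 1"
  unfolding box_bump_def
  by (auto intro!: prod_nonneg prod_le_1 mult_le_one simp: exp_flat_def)

lemma box_bump_test_function:
  assumes "c > 0"
  shows "box_bump a b c \<in> test_functions"
proof -
  have "(\<lambda>x. \<Prod>i\<in>I. exp_flat 0 c (x $ i - a $ i) * exp_flat 0 c (b $ i - x $ i)) \<in> smooth_class"
    if "finite I" for I using that
  proof induction
    case empty
    then show ?case using smooth_class.const[of 1] by simp
  next
    case (insert i I)
    have "(\<lambda>x. exp_flat 0 c (1 * x $ i + (- a $ i)) * exp_flat 0 c ((-1) * x $ i + b $ i)
       * (\<Prod>i\<in>I. exp_flat 0 c (x $ i - a $ i) * exp_flat 0 c (b $ i - x $ i))) \<in> smooth_class"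
      by (intro smooth_class.mult insert smooth_class.flat assms)
    then show ?case using insert by (simp add: mult.assoc)
  qed
  from this[of UNIV] have "box_bump a b c \<in> smooth_class"
    unfolding box_bump_def[abs_def] by simp
  moreover have "closure {x. box_bump a b c x \<noteq> 0} \<subseteq> cbox a b"
    using box_bump_eq_0[of _ a b c] box_subset_cbox[of a b] by (intro closure_minimal closed_cbox) blast
  then have "compact (closure {x. box_bump a b c x \<noteq> 0})"
    by (metis bounded_cbox bounded_subset compact_closure closure_closure compact_eq_bounded_closed closed_closure)
  ultimately show ?thesis
    by (auto simp: test_functions_def smooth_class_continuously_differentiable)
qed

lemma box_bump_tendsto: "(\<lambda>j. box_bump a b (1 / Suc j) x) \<longlonglongrightarrow> indicator (box a b) x"
proof (cases "x \<in> box a b")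
  case False
  then show ?thesis by (simp add: box_bump_eq_0)
next
  case True
  have *: "(\<lambda>j. exp_flat 0 (1 / Suc j) t) \<longlonglongrightarrow> 1" if "t > 0" for t
  proof -
    have "(\<lambda>j. exp (- (1 / real (Suc j) / t))) \<longlonglongrightarrow> exp (- (0 / t))"
      using LIMSEQ_inverse_real_of_nat that by (intro tendsto_intros) (auto simp: inverse_eq_divide)
    then show ?thesis using that by (simp add: exp_flat_def)
  qed
  have "(\<lambda>j. box_bump a b (1 / Suc j) x) \<longlonglongrightarrow> (\<Prod>i\<in>(UNIV::'a set). 1 * 1)"
    unfolding box_bump_def using True
    by (intro tendsto_prod tendsto_mult *) (auto simp: mem_box_cart)
  then show ?thesis using True by simp
qed

section \<open>Test functions\<close>

lemma test_has_derivative: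
  assumes "\<phi> \<in> test_functions"
  shows "(\<phi> has_derivative frechet_derivative \<phi> (at x)) (at x)"
proof -
  have "continuously_differentiable 1 \<phi>" using assms unfolding test_functions_def by blast
  then have "\<phi> differentiable (at x)" by (simp add: differentiable_on_def)
  then show ?thesis by (simp add: frechet_derivative_works)
qed

lemma frechet_derivative_eq_sum:
  assumes "\<phi> \<in> test_functions"
  shows "frechet_derivative \<phi> (at x) z = (\<Sum>i\<in>UNIV. z $ i * partial_deriv i \<phi> x)"
proof -
  interpret linear "frechet_derivative \<phi> (at x)"
    by (rule has_derivative_linear[OF test_has_derivative[OF assms]])
  have "frechet_derivative \<phi> (at x) z = frechet_derivative \<phi> (at x) (\<Sum>i\<in>UNIV. z $ i *\<^sub>R axis i 1)"
    using basis_expansion[of z] by (simp add: scalar_mult_eq_scaleR)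
  also have "\<dots> = (\<Sum>i\<in>UNIV. z $ i * partial_deriv i \<phi> x)"
    by (simp add: sum scale partial_deriv_def)
  finally show ?thesis .
qed

lemma test_continuous:
  assumes "\<phi> \<in> test_functions"
  shows "continuous_on UNIV \<phi>" "continuous_on UNIV (\<lambda>x. frechet_derivative \<phi> (at x) z)"
proof -
  have "continuously_differentiable 0 \<phi>" "continuously_differentiable 1 \<phi>" 
    using assms unfolding test_functions_def by blast+
  then show "continuous_on UNIV \<phi>" "continuous_on UNIV (\<lambda>x. frechet_derivative \<phi> (at x) z)"
    by (auto simp: frechet_derivative_eq_sum[OF assms] intro!: continuous_intros)
qed

lemma test_borel [measurable (raw)]:
  assumes "\<phi> \<in> test_functions"
  shows "\<phi> \<in> borel_measurable borel" "(\<lambda>x. frechet_derivative \<phi> (at x) z) \<in> borel_measurable borel"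
  using test_continuous[OF assms] by (auto intro: borel_measurable_continuous_onI)

text \<open>
  A common bound for a test function and its directional derivative; the latter also vanishes off the
  support because the complement of the support is open.
\<close>

lemma test_bounded:
  assumes "\<phi> \<in> test_functions"
  obtains R B where "R > 0" "B > 0"
    "\<And>x. \<bar>\<phi> x\<bar> \<le> B * indicator (ball 0 R) x"
    "\<And>x. \<bar>frechet_derivative \<phi> (at x) z\<bar> \<le> B * indicator (ball 0 R) x"
proof -
  let ?K = "closure {x. \<phi> x \<noteq> 0}" and ?D = "\<lambda>x. frechet_derivative \<phi> (at x) z"
  have K: "compact ?K" using assms by (simp add: test_functions_def)
  then obtain R where R: "R > 0" "?K \<subseteq> ball 0 R"
    using compact_imp_bounded bounded_subset_ballD by metis
  have bd: "bounded (\<phi> ` ?K)" "bounded (?D ` ?K)"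
    by (rule compact_imp_bounded, rule compact_continuous_image[OF _ K],
        rule continuous_on_subset[OF test_continuous(1)[OF assms]], simp,
        rule compact_imp_bounded, rule compact_continuous_image[OF _ K],
        rule continuous_on_subset[OF test_continuous(2)[OF assms]], simp)
  obtain B1 where B1: "B1 > 0" "\<forall>y\<in>\<phi> ` ?K. norm y \<le> B1"
    using bd(1) unfolding bounded_pos by blast
  obtain B2 where B2: "B2 > 0" "\<forall>y\<in>?D ` ?K. norm y \<le> B2"
    using bd(2) unfolding bounded_pos by blast
  have B: "B1 > 0" "\<And>x. x \<in> ?K \<Longrightarrow> \<bar>\<phi> x\<bar> \<le> B1" "B2 > 0" "\<And>x. x \<in> ?K \<Longrightarrow> \<bar>?D x\<bar> \<le> B2"
    using B1 B2 by simp_all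
  have 0: "\<phi> x = 0" if "x \<notin> ?K" for x using that closure_subset[of "{x. \<phi> x \<noteq> 0}"] by auto
  have D0: "?D x = 0" if "x \<notin> ?K" for x
  proof -
    have "(\<phi> has_derivative (\<lambda>_. 0)) (at x)"
      by (rule has_derivative_transform_within_open[of "\<lambda>_. 0" _ _ _ "- ?K"])
         (simp_all only: has_derivative_const open_Compl closed_closure Compl_iff that 0 not_False_eq_True simp_thms)
    then show ?thesis by (metis frechet_derivative_at)
  qed
  have "\<bar>\<phi> x\<bar> \<le> (B1 + B2) * indicator (ball 0 R) x" "\<bar>?D x\<bar> \<le> (B1 + B2) * indicator (ball 0 R) x" for x
  proof (atomize (full), cases "x \<in> ?K")
    case True
    then have "x \<in> ball 0 R" using R(2) by blast
    then show "\<bar>\<phi> x\<bar> \<le> (B1 + B2) * indicator (ball 0 R) x \<and> \<bar>?D x\<bar> \<le> (B1 + B2) * indicator (ball 0 R) x"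
      using B(2,4)[OF True] B(1,3) by simp
  next
    case False
    then show "\<bar>\<phi> x\<bar> \<le> (B1 + B2) * indicator (ball 0 R) x \<and> \<bar>?D x\<bar> \<le> (B1 + B2) * indicator (ball 0 R) x"
      using 0[OF False] D0[OF False] B(1,3) by simp
  qed
  with R(1) B(1,3) show ?thesis by (intro that[of R "B1 + B2"]) auto
qed

lemma test_translate:
  assumes "\<phi> \<in> test_functions"
  shows "(\<lambda>x. \<phi> (x + a)) \<in> test_functions"
    and "frechet_derivative (\<lambda>x. \<phi> (x + a)) (at x) = frechet_derivative \<phi> (at (x + a))"
proof -
  have shift: "((\<lambda>x. f (x + a)) has_derivative f') (at x)"
    if "(f has_derivative f') (at (x + a))" for f :: "real ^ 'a \<Rightarrow> real" and f' x
    using has_derivative_compose[of "\<lambda>x. x + a" "\<lambda>x. x" x UNIV f f', OF has_derivative_add_const[OF has_derivative_ident]] that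
    by simp
  then show fd: "frechet_derivative (\<lambda>x. \<phi> (x + a)) (at x) = frechet_derivative \<phi> (at (x + a))"
    by (metis frechet_derivative_at test_has_derivative[OF assms])
  have "continuously_differentiable k (\<lambda>x. f (x + a))"
    if "continuously_differentiable k f" for k and f :: "real ^ 'a \<Rightarrow> real"
    using that
  proof (induction k arbitrary: f)
    case 0
    then show ?case by (auto intro!: continuous_on_compose2[of UNIV f] continuous_intros)
  next
    case (Suc k)
    then have d: "(f has_derivative frechet_derivative f (at x)) (at x)" for x
      by (auto simp: differentiable_on_def frechet_derivative_works)
    have "partial_deriv i (\<lambda>x. f (x + a)) = (\<lambda>x. partial_deriv i f (x + a))" for i
      by (rule ext, subst partial_deriv_eq[OF shift[OF d]]) (simp add: partial_deriv_def)
    moreover have "(\<lambda>x. f (x + a)) differentiable_on UNIV"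
      using shift[OF d] by (auto simp: differentiable_on_def differentiable_def)
    ultimately show ?case using Suc by simp
  qed
  moreover obtain R B where RB: "\<And>x. \<bar>\<phi> x\<bar> \<le> B * indicator (ball 0 R) x"
    using test_bounded[OF assms, of 0] by metis
  have "x \<in> cball (- a) R" if "\<phi> (x + a) \<noteq> 0" for x
  proof -
    have "x + a \<in> ball 0 R" using RB[of "x + a"] that by (cases "x + a \<in> ball 0 R") auto
    moreover have "norm (- a - x) = norm (x + a)"
      by (subst norm_minus_cancel[symmetric]) (simp only: minus_diff_eq diff_minus_eq_add)
    ultimately show ?thesis by (simp only: mem_cball mem_ball dist_norm diff_0 norm_minus_cancel less_imp_le)
  qed
  then have "{x. \<phi> (x + a) \<noteq> 0} \<subseteq> cball (- a) R" by blast
  then have "compact (closure {x. \<phi> (x + a) \<noteq> 0})"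
    using bounded_subset[OF bounded_cball] by (auto simp: compact_closure)
  ultimately show "(\<lambda>x. \<phi> (x + a)) \<in> test_functions"
    using assms by (simp add: test_functions_def)
qed

section \<open>Square-integrable functions\<close>

lemma nn_integral_translate:
  fixes f :: "'a::euclidean_space \<Rightarrow> ennreal"
  assumes [measurable]: "f \<in> borel_measurable borel"
  shows "(\<integral>\<^sup>+x. f (x + z) \<partial>lborel) = (\<integral>\<^sup>+x. f x \<partial>lborel)"
  by (subst (2) lborel_distr_plus[of z, symmetric]) (simp add: nn_integral_distr add.commute)

lemma lborel_integral_translate:
  fixes f :: "'a::euclidean_space \<Rightarrow> real"
  assumes [measurable]: "f \<in> borel_measurable borel"
  shows "(LINT x|lborel. f (x + z)) = (LINT x|lborel. f x)"
  by (subst (2) lborel_distr_plus[of z, symmetric]) (simp add: integral_distr add.commute)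

text \<open>
  The Borel measurable counterpart of \<open>Lp 2\<close>. Borel measurability gives access to Fubini's theorem
  on \<open>lborel \<Otimes>\<^sub>M lborel\<close> when a function is composed with a translation.
\<close>

definition square_integrable :: "('a::euclidean_space \<Rightarrow> real) \<Rightarrow> bool" where
  "square_integrable f \<longleftrightarrow> f \<in> borel_measurable borel \<and> integrable lborel (\<lambda>x. (f x)\<^sup>2)"

lemma square_integrable_iff:
  "square_integrable f \<longleftrightarrow> f \<in> borel_measurable borel \<and> (\<integral>\<^sup>+x. ennreal ((f x)\<^sup>2) \<partial>lborel) < \<infinity>"
  unfolding square_integrable_def by (auto simp: integrable_iff_bounded)

lemma square_integrable_measurable [measurable_dest]:
  "square_integrable f \<Longrightarrow> f \<in> borel_measurable borel"
  by (simp add: square_integrable_def)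

lemma square_integrable_bound:
  assumes "square_integrable f" "g \<in> borel_measurable borel" "\<And>x. \<bar>g x\<bar> \<le> C * \<bar>f x\<bar>"
  shows "square_integrable g"
  unfolding square_integrable_def
proof
  have le: "(g x)\<^sup>2 \<le> C\<^sup>2 * (f x)\<^sup>2" for x
    using power_mono[OF assms(3)[of x], of 2] by (simp add: power_mult_distrib)
  have "integrable lborel (\<lambda>x. C\<^sup>2 * (f x)\<^sup>2)" using assms(1) by (simp add: square_integrable_def)
  then show "integrable lborel (\<lambda>x. (g x)\<^sup>2)"
    by (rule Bochner_Integration.integrable_bound[of _ "\<lambda>x. C\<^sup>2 * (f x)\<^sup>2"]) (use assms(2) in \<open>simp_all add: le\<close>)
qed (rule assms(2))

lemma abs_mult_le_sum_squares: "\<bar>a * b\<bar> \<le> a\<^sup>2 + b\<^sup>2" for a b :: real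
  using sum_squares_bound[of "\<bar>a\<bar>" "\<bar>b\<bar>"] mult_nonneg_nonneg[of "\<bar>a\<bar>" "\<bar>b\<bar>"]
  by (simp add: abs_mult del: mult_nonneg_nonneg zero_le_mult_iff)

lemma square_integrable_mult:
  assumes "square_integrable f" "square_integrable g"
  shows "integrable lborel (\<lambda>x. f x * g x)"
proof -
  have [measurable]: "f \<in> borel_measurable borel" "g \<in> borel_measurable borel" using assms by measurable
  have "integrable lborel (\<lambda>x. (f x)\<^sup>2 + (g x)\<^sup>2)" using assms by (simp add: square_integrable_def)
  then show ?thesis
    by (rule Bochner_Integration.integrable_bound) (simp_all add: abs_mult_le_sum_squares order_trans[OF _ abs_ge_self])
qed

lemma square_integrable_add:
  assumes "square_integrable f" "square_integrable g"
  shows "square_integrable (\<lambda>x. f x + g x)"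
proof -
  have "(\<lambda>x. (f x + g x)\<^sup>2) = (\<lambda>x. (f x)\<^sup>2 + (g x)\<^sup>2 + 2 * (f x * g x))"
    by (auto simp: power2_sum)
  with assms square_integrable_mult[OF assms] show ?thesis by (auto simp: square_integrable_def)
qed

lemma square_integrable_cmult:
  "square_integrable f \<Longrightarrow> square_integrable (\<lambda>x. c * f x)"
  by (auto simp: square_integrable_def power_mult_distrib)

lemma square_integrable_translate:
  assumes "square_integrable f" shows "square_integrable (\<lambda>x. f (x + z))"
proof -
  have [measurable]: "f \<in> borel_measurable borel" using assms by measurable
  show ?thesis using assms nn_integral_translate[of "\<lambda>x. ennreal ((f x)\<^sup>2)" z]
    by (simp add: square_integrable_iff)
qed

lemma square_integrable_compact_support:
  fixes f :: "'a::euclidean_space \<Rightarrow> real"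
  assumes [measurable]: "f \<in> borel_measurable borel" and "\<And>x. \<bar>f x\<bar> \<le> B * indicator (ball c R) x"
  shows "square_integrable f"
  unfolding square_integrable_def
proof
  have le: "(f x)\<^sup>2 \<le> B\<^sup>2 * indicator (ball c R) x" for x
    using assms(2)[of x] power_mono[OF assms(2)[of x], of 2] by (cases "x \<in> ball c R") auto
  have "integrable lborel (\<lambda>x. B\<^sup>2 * indicator (ball c R) x)"
    using emeasure_bounded_finite[of "ball c R"] by simp
  then show "integrable lborel (\<lambda>x. (f x)\<^sup>2)"
  proof (rule Bochner_Integration.integrable_bound)
    show "AE x in lborel. norm ((f x)\<^sup>2) \<le> norm (B\<^sup>2 * indicator (ball c R) x)"
      using order_trans[OF le abs_ge_self] by simp
  qed simp
qed simp

lemma test_square_integrable: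
  assumes "\<phi> \<in> test_functions"
  shows "square_integrable \<phi>" "square_integrable (\<lambda>x. frechet_derivative \<phi> (at x) z)"
proof -
  obtain R B where "\<And>x. \<bar>\<phi> x\<bar> \<le> B * indicator (ball 0 R) x"
    "\<And>x. \<bar>frechet_derivative \<phi> (at x) z\<bar> \<le> B * indicator (ball 0 R) x"
    using test_bounded[OF assms, of z] by metis
  with test_borel[OF assms] show "square_integrable \<phi>" "square_integrable (\<lambda>x. frechet_derivative \<phi> (at x) z)"
    by (blast intro: square_integrable_compact_support)+
qed

section \<open>The fundamental lemma of the calculus of variations\<close>

text \<open>
  The positive and the negative part of \<open>f\<close> are densities of measures that agree on boxes, hence
  on all Borel sets.
\<close>

lemma AE_zero_of_boxes:
  fixes f :: "'a::euclidean_space \<Rightarrow> real"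
  assumes [measurable]: "f \<in> borel_measurable borel"
    and int: "\<And>a b. integrable lborel (\<lambda>x. f x * indicator (box a b) x)"
    and zero: "\<And>a b. (LINT x|lborel. f x * indicator (box a b) x) = 0"
  shows "AE x in lborel. f x = 0"
proof -
  let ?M = "density lborel (\<lambda>x. ennreal (f x))" and ?N = "density lborel (\<lambda>x. ennreal (- f x))"
  have em: "emeasure ?M (box a b) = (\<integral>\<^sup>+x. ennreal (f x * indicator (box a b) x) \<partial>lborel)"
     "emeasure ?N (box a b) = (\<integral>\<^sup>+x. ennreal (- (f x * indicator (box a b) x)) \<partial>lborel)" for a b
    by (auto simp: emeasure_density indicator_def intro!: nn_integral_cong)
  have fin: "emeasure ?M (box a b) \<noteq> \<infinity>" "emeasure ?N (box a b) \<noteq> \<infinity>" for a b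
    using int[of a b] unfolding em real_integrable_def by auto
  have "enn2real (emeasure ?M (box a b)) = enn2real (emeasure ?N (box a b))" for a b
    using zero[of a b] unfolding em real_lebesgue_integral_def[OF int] by simp
  then have eq: "emeasure ?M (box a b) = emeasure ?N (box a b)" for a b
    using fin[of a b] by (metis ennreal_enn2real_if infinity_ennreal_def)
  have "?M = ?N"
  proof (rule measure_eqI_generator_eq)
    let ?E = "range (\<lambda>(a, b). box a b::'a set)"
    show "Int_stable ?E" by (auto simp: Int_stable_def box_Int_box)
    show "?E \<subseteq> Pow UNIV" "sets ?M = sigma_sets UNIV ?E" "sets ?N = sigma_sets UNIV ?E"
      by (simp_all add: borel_eq_box)
    let ?A = "\<lambda>n::nat. box (- (real n *\<^sub>R One)) (real n *\<^sub>R One) :: 'a set"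
    show "range ?A \<subseteq> ?E" "(\<Union>i. ?A i) = UNIV"
      unfolding UN_box_eq_UNIV by auto
    show "emeasure ?M (?A i) \<noteq> \<infinity>" for i by (rule fin)
    show "emeasure ?M X = emeasure ?N X" if "X \<in> ?E" for X
      using that eq by auto
  qed
  then have "AE x in lborel. ennreal (f x) = ennreal (- f x)"
    by (intro sigma_finite_measure.density_unique[OF lborel.sigma_finite_measure_axioms]) auto
  then show ?thesis
    by eventually_elim (metis ennreal_eq_zero_iff ennreal_neg linear neg_0_le_iff_le neg_equal_0_iff_equal)
qed

text \<open>
  Bumps on a box tend to the indicator of the box as their parameter tends to \<open>0\<close>, so that the
  integral of \<open>f\<close> over every box vanishes.
\<close>

lemma fundamental_lemma:
  fixes f :: "real ^ 'n \<Rightarrow> real"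
  assumes f: "square_integrable f"
    and zero: "\<And>\<phi>. \<phi> \<in> test_functions \<Longrightarrow> (LINT x|lborel. f x * \<phi> x) = 0"
  shows "AE x in lborel. f x = 0"
proof (rule AE_zero_of_boxes)
  show [measurable]: "f \<in> borel_measurable borel" using f by measurable
  have sq: "(indicator A x)\<^sup>2 = (indicator A x :: real)" for A and x :: "real ^ 'n"
    by (simp add: indicator_def)
  have box: "square_integrable (indicator (box a b) :: real ^ 'n \<Rightarrow> real)" for a b :: "real ^ 'n"
    using emeasure_lborel_box_finite[of a b]
    by (simp add: square_integrable_iff ennreal_indicator sq)
  show int: "integrable lborel (\<lambda>x. f x * indicator (box a b) x)" for a b
    by (rule square_integrable_mult[OF f box])
  show "(LINT x|lborel. f x * indicator (box a b) x) = 0" for a b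
  proof -
    have [measurable]: "box_bump a b (1 / real (Suc j)) \<in> borel_measurable borel" for j
      by (intro test_borel box_bump_test_function) simp
    have "(\<lambda>j. LINT x|lborel. f x * box_bump a b (1 / Suc j) x) \<longlonglongrightarrow> (LINT x|lborel. f x * indicator (box a b) x)"
    proof (rule integral_dominated_convergence[where w="\<lambda>x. \<bar>f x * indicator (box a b) x\<bar>"])
      show "AE x in lborel. norm (f x * box_bump a b (1 / Suc j) x) \<le> \<bar>f x * indicator (box a b) x\<bar>" for j
        using box_bump_eq_0[of _ a b "1 / Suc j"] box_bump_bounds[of "1 / Suc j" a b]
        by (intro AE_I2) (auto simp: indicator_def abs_mult mult_left_le)
    qed (use int in \<open>auto intro!: tendsto_intros box_bump_tendsto simp del: of_nat_Suc\<close>)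
    moreover have "(LINT x|lborel. f x * box_bump a b (1 / Suc j) x) = 0" for j
      by (intro zero box_bump_test_function) simp
    ultimately show ?thesis by (simp add: LIMSEQ_const_iff)
  qed
qed

section \<open>Weak directional derivatives and translations\<close>

text \<open>
  Directional derivatives instead of gradients: translations by arbitrary vectors are needed for the
  integrability estimate, and the coordinate directions \<open>axis i 1\<close> recover the gradient.
  Square integrability is part of the notion, because the Bochner integral of a function that is not
  integrable is \<open>0\<close> and the identity alone would then say nothing.
\<close>

definition weak_dir_deriv :: "real ^ 'n \<Rightarrow> (real ^ 'n \<Rightarrow> real) \<Rightarrow> (real ^ 'n \<Rightarrow> real) \<Rightarrow> bool" where
  "weak_dir_deriv z w G \<longleftrightarrow> square_integrable w \<and> square_integrable G \<and>
     (\<forall>\<phi>\<in>test_functions.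
        (LINT x|lborel. w x * frechet_derivative \<phi> (at x) z) = - (LINT x|lborel. G x * \<phi> x))"

lemma weak_dir_derivD:
  assumes "weak_dir_deriv z w G"
  shows "square_integrable w" "square_integrable G"
    "\<phi> \<in> test_functions \<Longrightarrow>
      (LINT x|lborel. w x * frechet_derivative \<phi> (at x) z) = - (LINT x|lborel. G x * \<phi> x)"
  using assms by (auto simp: weak_dir_deriv_def)

lemma weak_dir_deriv_unique:
  assumes "weak_dir_deriv z w G" "weak_dir_deriv z w G'"
  shows "AE x in lborel. G x = G' x"
proof -
  note * = weak_dir_derivD[OF assms(1)] weak_dir_derivD[OF assms(2)]
  have sq: "square_integrable (\<lambda>x. G x + (-1) * G' x)"
    by (intro square_integrable_add square_integrable_cmult *)
  have "AE x in lborel. G x + (-1) * G' x = 0"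
  proof (rule fundamental_lemma[OF sq])
    fix \<phi> :: "real ^ 'a \<Rightarrow> real" assume \<phi>: "\<phi> \<in> test_functions"
    note sq = test_square_integrable(1)[OF \<phi>]
    show "(LINT x|lborel. (G x + (-1) * G' x) * \<phi> x) = 0"
      using *(3,6)[OF \<phi>] *(2,5)[THEN square_integrable_mult[OF _ sq]]
      by (simp add: left_diff_distrib)
  qed
  then show ?thesis by simp
qed

lemma weak_dir_deriv_scale:
  assumes "weak_dir_deriv z w G"
  shows "weak_dir_deriv (h *\<^sub>R z) w (\<lambda>x. h * G x)"
proof -
  have "frechet_derivative \<phi> (at x) (h *\<^sub>R z) = h * frechet_derivative \<phi> (at x) z"
    if "\<phi> \<in> test_functions" for \<phi> :: "real ^ 'a \<Rightarrow> real" and x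
    using linear_cmul[OF has_derivative_linear[OF test_has_derivative[OF that]]] by simp
  then show ?thesis using assms
    by (simp add: weak_dir_deriv_def square_integrable_cmult mult.left_commute mult.assoc)
qed

text \<open>
  Jensen's inequality on the unit interval, from the nonnegativity of the variance. If the right-hand
  side is infinite there is nothing to show, and otherwise \<open>f\<close> is integrable.
\<close>

lemma square_mean_le_mean_square:
  fixes f :: "real \<Rightarrow> real"
  assumes [measurable]: "f \<in> borel_measurable borel"
  shows "ennreal ((LINT s|lborel. indicator {0..1} s * f s)\<^sup>2) \<le> (\<integral>\<^sup>+s. indicator {0..1} s * ennreal ((f s)\<^sup>2) \<partial>lborel)"
proof (cases "(\<integral>\<^sup>+s. indicator {0..1} s * ennreal ((f s)\<^sup>2) \<partial>lborel) < \<infinity>")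
  case True
  let ?I = "indicator {0..1} :: real \<Rightarrow> real"
  have eq: "indicator {0..1} s * ennreal ((f s)\<^sup>2) = ennreal (?I s * (f s)\<^sup>2)" for s
    by (simp add: indicator_def)
  have i2: "integrable lborel (\<lambda>s. ?I s * (f s)\<^sup>2)"
    using True unfolding eq by (intro integrableI_nonneg) auto
  have i0: "integrable lborel ?I" by simp
  have bound: "\<bar>t\<bar> \<le> 1 + t\<^sup>2" for t :: real
    using sum_squares_bound[of 1 "\<bar>t\<bar>"] by simp
  have "integrable lborel (\<lambda>s. ?I s + ?I s * (f s)\<^sup>2)" using i0 i2 by simp
  then have i1: "integrable lborel (\<lambda>s. ?I s * f s)"
    by (rule Bochner_Integration.integrable_bound)
       (auto simp: indicator_def intro!: order_trans[OF bound] )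
  define m where "m = (LINT s|lborel. ?I s * f s)"
  have "0 \<le> (LINT s|lborel. ?I s * (f s - m)\<^sup>2)" by (intro integral_nonneg_AE AE_I2) simp
  also have "\<dots> = (LINT s|lborel. ?I s * (f s)\<^sup>2 - (2 * m) * (?I s * f s) + m\<^sup>2 * ?I s)"
    by (intro Bochner_Integration.integral_cong) (auto simp: power2_diff algebra_simps)
  also have "\<dots> = (LINT s|lborel. ?I s * (f s)\<^sup>2) - (2 * m) * m + m\<^sup>2"
    using i0 i1 i2 by (simp add: m_def[symmetric])
  finally have "m\<^sup>2 \<le> (LINT s|lborel. ?I s * (f s)\<^sup>2)" by (simp add: power2_eq_square)
  then have "ennreal (m\<^sup>2) \<le> ennreal (LINT s|lborel. ?I s * (f s)\<^sup>2)" by (rule ennreal_leI)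
  also have "\<dots> = (\<integral>\<^sup>+s. ennreal (?I s * (f s)\<^sup>2) \<partial>lborel)"
    by (intro nn_integral_eq_integral[symmetric] i2) auto
  finally show ?thesis unfolding eq m_def .
qed (simp add: not_less top_unique)

lemma line_average:
  fixes G :: "'a::euclidean_space \<Rightarrow> real" and z :: 'a
  assumes G: "square_integrable G"
  defines "A \<equiv> \<lambda>x. LINT s|lborel. indicator {0..1} s * G (x + s *\<^sub>R z)"
  shows "square_integrable A" "(\<integral>\<^sup>+x. ennreal ((A x)\<^sup>2) \<partial>lborel) \<le> (\<integral>\<^sup>+x. ennreal ((G x)\<^sup>2) \<partial>lborel)"
proof -
  have [measurable]: "G \<in> borel_measurable borel" using G by measurable
  have [measurable]: "A \<in> borel_measurable borel" unfolding A_def by measurable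
  have "(\<integral>\<^sup>+x. ennreal ((A x)\<^sup>2) \<partial>lborel)
      \<le> (\<integral>\<^sup>+x. \<integral>\<^sup>+s. indicator {0..1} s * ennreal ((G (x + s *\<^sub>R z))\<^sup>2) \<partial>lborel \<partial>lborel)"
    unfolding A_def by (intro nn_integral_mono square_mean_le_mean_square) simp
  also have "\<dots> = (\<integral>\<^sup>+s. \<integral>\<^sup>+x. indicator {0..1} s * ennreal ((G (x + s *\<^sub>R z))\<^sup>2) \<partial>lborel \<partial>lborel)"
    by (intro lborel_pair.Fubini') simp
  also have "\<dots> = (\<integral>\<^sup>+s. indicator {0..1} (s::real) * (\<integral>\<^sup>+x. ennreal ((G x)\<^sup>2) \<partial>lborel) \<partial>lborel)"
    using nn_integral_translate[of "\<lambda>x. ennreal ((G x)\<^sup>2)"] by (simp add: nn_integral_cmult)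
  also have "\<dots> = (\<integral>\<^sup>+x. ennreal ((G x)\<^sup>2) \<partial>lborel)"
    by (simp add: nn_integral_multc)
  finally show le: "(\<integral>\<^sup>+x. ennreal ((A x)\<^sup>2) \<partial>lborel) \<le> (\<integral>\<^sup>+x. ennreal ((G x)\<^sup>2) \<partial>lborel)" .
  then show "square_integrable A" using G by (auto simp: square_integrable_iff)
qed

lemma line_average_Fubini:
  fixes f g :: "'a::euclidean_space \<Rightarrow> real"
  assumes f: "square_integrable f" and g: "square_integrable g"
  shows "(LINT x|lborel. f x * (LINT s|lborel. indicator {0..1} s * g (x + s *\<^sub>R z)))
       = (LINT s|lborel. indicator {0..1} s * (LINT x|lborel. f x * g (x + s *\<^sub>R z)))"
proof -
  have [measurable]: "f \<in> borel_measurable borel" "g \<in> borel_measurable borel" using f g by measurable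
  let ?F = "\<lambda>x s. indicator {0..1} s * (f x * g (x + s *\<^sub>R z))"
  have int: "integrable (lborel \<Otimes>\<^sub>M lborel) (\<lambda>(x, s). ?F x s)"
  proof (rule integrableI_bounded)
    have "(\<integral>\<^sup>+p. ennreal (norm (case p of (x, s) \<Rightarrow> ?F x s)) \<partial>(lborel \<Otimes>\<^sub>M lborel))
        = (\<integral>\<^sup>+s. \<integral>\<^sup>+x. ennreal (norm (?F x s)) \<partial>lborel \<partial>lborel)"
      by (subst lborel_pair.nn_integral_snd[symmetric]) (auto simp: case_prod_beta)
    also have "\<dots> \<le> (\<integral>\<^sup>+s. \<integral>\<^sup>+x. indicator {0..1} s * (ennreal ((f x)\<^sup>2) + ennreal ((g (x + s *\<^sub>R z))\<^sup>2)) \<partial>lborel \<partial>lborel)"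
      by (intro nn_integral_mono)
         (auto simp: indicator_def abs_mult_le_sum_squares simp flip: ennreal_plus intro!: ennreal_leI)
    also have "\<dots> = (\<integral>\<^sup>+s. indicator {0..1} (s::real) * ((\<integral>\<^sup>+x. ennreal ((f x)\<^sup>2) \<partial>lborel) + (\<integral>\<^sup>+x. ennreal ((g x)\<^sup>2) \<partial>lborel)) \<partial>lborel)"
      using nn_integral_translate[of "\<lambda>x. ennreal ((g x)\<^sup>2)"] by (simp add: nn_integral_cmult nn_integral_add)
    also have "\<dots> = (\<integral>\<^sup>+x. ennreal ((f x)\<^sup>2) \<partial>lborel) + (\<integral>\<^sup>+x. ennreal ((g x)\<^sup>2) \<partial>lborel)"
      by (simp add: nn_integral_multc)
    also have "\<dots> < \<infinity>" using f g by (simp add: square_integrable_iff)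
    finally show "(\<integral>\<^sup>+p. ennreal (norm (case p of (x, s) \<Rightarrow> ?F x s)) \<partial>(lborel \<Otimes>\<^sub>M lborel)) < \<infinity>" .
  qed measurable
  have "(LINT x|lborel. f x * (LINT s|lborel. indicator {0..1} s * g (x + s *\<^sub>R z)))
      = (LINT x|lborel. LINT s|lborel. ?F x s)"
    by (intro Bochner_Integration.integral_cong refl) (simp add: mult.left_commute flip: integral_mult_right_zero)
  also have "\<dots> = (LINT s|lborel. LINT x|lborel. ?F x s)"
    by (rule lborel_pair.Fubini_integral[symmetric, OF int])
  finally show ?thesis by simp
qed

lemma test_line_derivative:
  assumes "\<phi> \<in> test_functions"
  shows "((\<lambda>s. \<phi> (x + s *\<^sub>R z)) has_real_derivative frechet_derivative \<phi> (at (x + s *\<^sub>R z)) z) (at s)"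
proof -
  have "((\<lambda>s. x + s *\<^sub>R z) has_derivative (\<lambda>h. h *\<^sub>R z)) (at s)"
    by (auto intro!: derivative_eq_intros)
  from has_derivative_compose[OF this test_has_derivative[OF assms]]
  show ?thesis
    using linear_cmul[OF has_derivative_linear[OF test_has_derivative[OF assms]]]
    by (simp add: has_field_derivative_def mult.commute[of _ "frechet_derivative \<phi> (at (x + s *\<^sub>R z)) z"])
qed

lemma test_FTC:
  assumes "\<phi> \<in> test_functions"
  shows "(LINT s|lborel. indicator {0..1} s * frechet_derivative \<phi> (at (x + s *\<^sub>R z)) z) = \<phi> (x + z) - \<phi> x"
proof -
  let ?f = "\<lambda>s. \<phi> (x + s *\<^sub>R z)" and ?f' = "\<lambda>s. frechet_derivative \<phi> (at (x + s *\<^sub>R z)) z"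
  have der: "DERIV ?f s :> ?f' s" for s by (rule test_line_derivative[OF assms])
  have "continuous_on UNIV ?f'"
    by (rule continuous_on_compose2[OF test_continuous(2)[OF assms]]) (auto intro!: continuous_intros)
  then have cont: "isCont ?f' s" for s by (simp add: continuous_on_eq_continuous_at)
  have "(LINT s|lborel. ?f' s * indicator {0..1} s) = ?f 1 - ?f 0"
    by (rule integral_FTC_Icc_real) (use der cont in auto)
  then show ?thesis by (simp add: mult.commute)
qed

text \<open>
  Both sides are square integrable, so by the fundamental lemma it is enough to integrate them
  against a test function. Translations are moved to the test function, where the fundamental theorem
  of calculus applies; the definition of the weak derivative, applied to each translate of the test
  function, and Fubini's theorem give the other side.
\<close>

lemma weak_dir_deriv_translation_formula:
  assumes "weak_dir_deriv z w G"
  shows "AE x in lborel. w (x + z) - w x = (LINT s|lborel. indicator {0..1} s * G (x + s *\<^sub>R z))"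
proof -
  note wG = weak_dir_derivD[OF assms]
  have [measurable]: "w \<in> borel_measurable borel" "G \<in> borel_measurable borel" using wG(1,2) by measurable
  define A where "A = (\<lambda>x. LINT s|lborel. indicator {0..1} s * G (x + s *\<^sub>R z))"
  have A: "square_integrable A" unfolding A_def by (rule line_average(1)[OF wG(2)])
  note wz = square_integrable_translate[OF wG(1), of z]
  have "AE x in lborel. (w (x + z) + (-1) * w x) + (-1) * A x = 0"
  proof (rule fundamental_lemma)
    show "square_integrable (\<lambda>x. (w (x + z) + (-1) * w x) + (-1) * A x)"
      by (intro square_integrable_add square_integrable_cmult A wz wG)
    fix \<phi> :: "real ^ 'a \<Rightarrow> real" assume \<phi>: "\<phi> \<in> test_functions"
    have [measurable]: "\<phi> \<in> borel_measurable borel" by (rule test_borel[OF \<phi>])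
    note s\<phi> = test_square_integrable(1)[OF \<phi>]
    note s\<phi>z = test_square_integrable(1)[OF test_translate(1)[OF \<phi>]]
    have D: "(LINT x|lborel. w x * frechet_derivative \<phi> (at (x + s *\<^sub>R (-z))) (- z))
        = (LINT x|lborel. \<phi> x * G (x + s *\<^sub>R z))" for s
    proof -
      have "(LINT x|lborel. w x * frechet_derivative \<phi> (at (x + s *\<^sub>R (-z))) (- z))
         = - (LINT x|lborel. w x * frechet_derivative (\<lambda>x. \<phi> (x + s *\<^sub>R (-z))) (at x) z)"
        unfolding test_translate(2)[OF \<phi>]
        using linear_neg[OF has_derivative_linear[OF test_has_derivative[OF \<phi>]]]
        by simp
      also have "\<dots> = (LINT x|lborel. G x * \<phi> (x + s *\<^sub>R (-z)))"
        by (subst wG(3)[OF test_translate(1)[OF \<phi>]]) simp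
      also have "\<dots> = (LINT x|lborel. G (x + s *\<^sub>R z) * \<phi> ((x + s *\<^sub>R z) + s *\<^sub>R (-z)))"
        by (rule lborel_integral_translate[symmetric]) measurable
      finally show ?thesis by (simp add: mult.commute)
    qed
    have "(LINT x|lborel. w (x + z) * \<phi> x) = (LINT x|lborel. w x * \<phi> (x + (- z)))"
      using lborel_integral_translate[of "\<lambda>x. w x * \<phi> (x + (- z))" z] by simp
    then have "(LINT x|lborel. (w (x + z) + (-1) * w x) * \<phi> x)
        = (LINT x|lborel. w x * \<phi> (x + (- z))) - (LINT x|lborel. w x * \<phi> x)"
      using square_integrable_mult[OF wz s\<phi>] square_integrable_mult[OF wG(1) s\<phi>]
      by (simp add: left_diff_distrib)
    also have "\<dots> = (LINT x|lborel. w x * (\<phi> (x + (- z)) - \<phi> x))"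
      using square_integrable_mult[OF wG(1) s\<phi>z[of "- z"]] square_integrable_mult[OF wG(1) s\<phi>]
      by (simp add: right_diff_distrib)
    also have "\<dots> = (LINT x|lborel. w x * (LINT s|lborel. indicator {0..1} s * frechet_derivative \<phi> (at (x + s *\<^sub>R (-z))) (- z)))"
      by (subst test_FTC[OF \<phi>]) simp
    also have "\<dots> = (LINT s|lborel. indicator {0..1} s * (LINT x|lborel. w x * frechet_derivative \<phi> (at (x + s *\<^sub>R (-z))) (- z)))"
      by (rule line_average_Fubini[OF wG(1) test_square_integrable(2)[OF \<phi>]])
    also have "\<dots> = (LINT x|lborel. \<phi> x * A x)"
      unfolding D A_def by (rule line_average_Fubini[OF s\<phi> wG(2), symmetric])
    finally have eq: "(LINT x|lborel. (w (x + z) + (-1) * w x) * \<phi> x) = (LINT x|lborel. \<phi> x * A x)" .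
    have "(LINT x|lborel. (w (x + z) + (-1) * w x + (-1) * A x) * \<phi> x)
        = (LINT x|lborel. (w (x + z) + (-1) * w x) * \<phi> x - \<phi> x * A x)"
      by (intro Bochner_Integration.integral_cong refl) (simp add: algebra_simps)
    also have "\<dots> = (LINT x|lborel. (w (x + z) + (-1) * w x) * \<phi> x) - (LINT x|lborel. \<phi> x * A x)"
      using square_integrable_mult[OF square_integrable_add[OF wz square_integrable_cmult[OF wG(1), of "-1"]] s\<phi>]
        square_integrable_mult[OF s\<phi> A]
      by (rule Bochner_Integration.integral_diff)
    finally show "(LINT x|lborel. (w (x + z) + (-1) * w x + (-1) * A x) * \<phi> x) = 0"
      using eq by simp
  qed
  then show ?thesis by (auto simp: A_def)
qed

text \<open>
  Jensen's inequality for the line average in the translation formula.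
\<close>

lemma weak_dir_deriv_translation_bound:
  assumes "weak_dir_deriv z w G"
  shows "(\<integral>\<^sup>+x. ennreal ((w (x + z) - w x)\<^sup>2) \<partial>lborel) \<le> (\<integral>\<^sup>+x. ennreal ((G x)\<^sup>2) \<partial>lborel)"
proof -
  have "(\<integral>\<^sup>+x. ennreal ((w (x + z) - w x)\<^sup>2) \<partial>lborel)
      = (\<integral>\<^sup>+x. ennreal ((LINT s|lborel. indicator {0..1} s * G (x + s *\<^sub>R z))\<^sup>2) \<partial>lborel)"
    using weak_dir_deriv_translation_formula[OF assms] by (intro nn_integral_cong_AE) auto
  also have "\<dots> \<le> (\<integral>\<^sup>+x. ennreal ((G x)\<^sup>2) \<partial>lborel)"
    by (rule line_average(2)[OF weak_dir_derivD(2)[OF assms]])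
  finally show ?thesis .
qed

section \<open>The chain rule\<close>

text \<open>
  On the diagonal the quotient is the derivative, so that the product with \<open>b - a\<close> is always
  \<open>H b - H a\<close> and the mean value theorem covers all cases.
\<close>

definition diff_quotient :: "(real \<Rightarrow> real) \<Rightarrow> (real \<Rightarrow> real) \<Rightarrow> real \<Rightarrow> real \<Rightarrow> real" where
  "diff_quotient H H' a b = (if a = b then H' a else (H b - H a) / (b - a))"

lemma diff_quotient_mult: "diff_quotient H H' a b * (b - a) = H b - H a"
  by (simp add: diff_quotient_def)

lemma diff_quotient_mvt:
  assumes "\<And>t. (H has_real_derivative H' t) (at t)"
  obtains \<xi> where "diff_quotient H H' a b = H' \<xi>" "min a b \<le> \<xi>" "\<xi> \<le> max a b"
proof (cases a b rule: linorder_cases)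
  case equal
  then show ?thesis using that[of a] by (simp add: diff_quotient_def)
next
  case less
  from MVT2[OF this, of H H'] assms obtain \<xi> where "a < \<xi>" "\<xi> < b" "H b - H a = (b - a) * H' \<xi>" by blast
  then show ?thesis using that[of \<xi>] less by (simp add: diff_quotient_def)
next
  case greater
  from MVT2[OF this, of H H'] assms obtain \<xi> where "b < \<xi>" "\<xi> < a" "H a - H b = (a - b) * H' \<xi>" by blast
  then show ?thesis using that[of \<xi>] greater by (simp add: diff_quotient_def field_simps)
qed

lemma diff_quotient_tendsto:
  assumes H: "\<And>t. (H has_real_derivative H' t) (at t)" and H': "continuous_on UNIV H'"
    and "a \<longlonglongrightarrow> c" "b \<longlonglongrightarrow> c"
  shows "(\<lambda>j. diff_quotient H H' (a j) (b j)) \<longlonglongrightarrow> H' c"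
proof -
  have "\<exists>\<xi>. diff_quotient H H' (a j) (b j) = H' \<xi> \<and> min (a j) (b j) \<le> \<xi> \<and> \<xi> \<le> max (a j) (b j)" for j
    using diff_quotient_mvt[OF H] by metis
  then obtain \<xi> where \<xi>: "\<And>j. diff_quotient H H' (a j) (b j) = H' (\<xi> j)"
      "\<And>j. min (a j) (b j) \<le> \<xi> j" "\<And>j. \<xi> j \<le> max (a j) (b j)"
    by metis
  have "\<xi> \<longlonglongrightarrow> c"
  proof (rule tendsto_sandwich)
    show "(\<lambda>j. min (a j) (b j)) \<longlonglongrightarrow> c" "(\<lambda>j. max (a j) (b j)) \<longlonglongrightarrow> c"
      using tendsto_min[OF assms(3,4)] tendsto_max[OF assms(3,4)] by simp_all
  qed (use \<xi> in auto)
  then show ?thesis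
    unfolding \<xi>(1) using H' by (intro isCont_tendsto_compose[of c H']) (auto simp: continuous_on_eq_continuous_at)
qed

lemma AE_tendsto_of_summable_square:
  fixes d :: "nat \<Rightarrow> 'a::euclidean_space \<Rightarrow> real"
  assumes [measurable]: "\<And>j. d j \<in> borel_measurable borel"
    and sum: "(\<Sum>j. \<integral>\<^sup>+x. ennreal ((d j x)\<^sup>2) \<partial>lborel) < \<infinity>"
  shows "AE x in lborel. (\<lambda>j. d j x) \<longlonglongrightarrow> 0"
proof -
  have "(\<integral>\<^sup>+x. (\<Sum>j. ennreal ((d j x)\<^sup>2)) \<partial>lborel) < \<infinity>"
    using sum by (simp add: nn_integral_suminf)
  then have "AE x in lborel. (\<Sum>j. ennreal ((d j x)\<^sup>2)) \<noteq> \<infinity>"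
    by (intro nn_integral_PInf_AE) auto
  then show ?thesis
  proof eventually_elim
    case (elim x)
    then have "summable (\<lambda>j. (d j x)\<^sup>2)" by (intro summable_suminf_not_top) auto
    then have "(\<lambda>j. (d j x)\<^sup>2) \<longlonglongrightarrow> 0" by (rule summable_LIMSEQ_zero)
    then have "(\<lambda>j. sqrt ((d j x)\<^sup>2)) \<longlonglongrightarrow> sqrt 0" by (rule tendsto_real_sqrt)
    then show ?case by (simp add: tendsto_rabs_zero_iff)
  qed
qed

text \<open>
  The squared \<open>L\<^sup>2\<close> norms of the differences are at most a constant times \<open>16\<^bsup>-j\<^esup>\<close>, hence
  summable, and so is the series of the squares at almost every point.
\<close>

lemma weak_dir_deriv_AE_translation_tendsto:
  assumes "weak_dir_deriv z w G"
  shows "AE x in lborel. (\<lambda>j. w (x + (c / 4 ^ j) *\<^sub>R z)) \<longlonglongrightarrow> w x"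
proof -
  note wG = weak_dir_derivD[OF assms]
  have [measurable]: "w \<in> borel_measurable borel" "G \<in> borel_measurable borel" using wG(1,2) by measurable
  define N where "N = (LINT x|lborel. (G x)\<^sup>2)"
  have N: "(\<integral>\<^sup>+x. ennreal ((G x)\<^sup>2) \<partial>lborel) = ennreal N" "0 \<le> N"
    unfolding N_def using wG(2) by (auto simp: square_integrable_def nn_integral_eq_integral)
  have "(\<integral>\<^sup>+x. ennreal ((w (x + (c / 4 ^ j) *\<^sub>R z) - w x)\<^sup>2) \<partial>lborel) \<le> ennreal (c\<^sup>2 * N * (1 / 16) ^ j)" for j
  proof -
    have "(\<integral>\<^sup>+x. ennreal ((w (x + (c / 4 ^ j) *\<^sub>R z) - w x)\<^sup>2) \<partial>lborel) \<le> (\<integral>\<^sup>+x. ennreal ((c / 4 ^ j * G x)\<^sup>2) \<partial>lborel)"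
      by (rule weak_dir_deriv_translation_bound[OF weak_dir_deriv_scale[OF assms]])
    also have "\<dots> = ennreal ((c / 4 ^ j)\<^sup>2) * ennreal N"
      unfolding N(1)[symmetric] power_mult_distrib ennreal_mult[OF zero_le_power2 zero_le_power2]
      by (rule nn_integral_cmult) simp
    also have "\<dots> = ennreal (c\<^sup>2 * N * (1 / 16) ^ j)"
      using N(2) by (simp add: ennreal_mult[symmetric] power_divide power2_eq_square power_mult_distrib[symmetric])
    finally show ?thesis .
  qed
  then have "(\<Sum>j. \<integral>\<^sup>+x. ennreal ((w (x + (c / 4 ^ j) *\<^sub>R z) - w x)\<^sup>2) \<partial>lborel) \<le> (\<Sum>j. ennreal (c\<^sup>2 * N * (1 / 16) ^ j))"
    by (intro suminf_le) auto
  also have "\<dots> < \<infinity>"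
    using N(2) by (subst suminf_ennreal2) (auto intro!: summable_mult summable_geometric)
  finally have "AE x in lborel. (\<lambda>j. w (x + (c / 4 ^ j) *\<^sub>R z) - w x) \<longlonglongrightarrow> 0"
    by (intro AE_tendsto_of_summable_square) auto
  then show ?thesis by (simp add: LIM_zero_iff)
qed

text \<open>
  With \<open>h = 4\<^bsup>-j\<^esup>\<close>, moving the translation to the test function turns the difference quotient of
  \<open>H \<circ> w\<close> into that of \<open>\<phi>\<close>, which converges boundedly. On the other side the increment of
  \<open>H \<circ> w\<close> is a bounded quotient times the increment of \<open>w\<close>, and the latter is \<open>h\<close> times a
  line average of \<open>G\<close>. Shifting the variable of integration leaves \<open>G\<close> untouched and puts the
  translations on the bounded factors \<open>\<theta>\<close> and \<open>\<phi>\<close>, which converge almost everywhere; dominated convergence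
  then applies twice, first in \<open>x\<close> and then in the parameter \<open>s\<close> of the line average.
\<close>

lemma weak_dir_deriv_chain:
  assumes wG: "weak_dir_deriv z w G"
    and H: "\<And>t. (H has_real_derivative H' t) (at t)" and H': "continuous_on UNIV H'"
    and L: "\<And>t. \<bar>H' t\<bar> \<le> L" and H0: "H 0 = 0"
  shows "weak_dir_deriv z (\<lambda>x. H (w x)) (\<lambda>x. H' (w x) * G x)"
  unfolding weak_dir_deriv_def
proof (intro conjI ballI)
  note sq = weak_dir_derivD(1,2)[OF wG]
  have [measurable]: "w \<in> borel_measurable borel" "G \<in> borel_measurable borel" using sq by measurable
  have [measurable]: "H' \<in> borel_measurable borel" by (rule borel_measurable_continuous_onI[OF H'])
  have [measurable]: "H \<in> borel_measurable borel"
    using H by (intro borel_measurable_continuous_onI) (auto simp: continuous_on_eq_continuous_at intro: DERIV_isCont)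
  have quot: "\<bar>diff_quotient H H' a b\<bar> \<le> L" for a b
    using diff_quotient_mvt[OF H, of a b] L by metis
  have Hle: "\<bar>H t\<bar> \<le> L * \<bar>t\<bar>" for t
    using quot[of 0 t] diff_quotient_mult[of H H' 0 t] H0 mult_right_mono[of _ L "\<bar>t\<bar>"]
    by (metis abs_ge_zero abs_mult diff_zero)
  show sqH: "square_integrable (\<lambda>x. H (w x))" by (rule square_integrable_bound[OF sq(1), of _ L]) (auto simp: Hle)
  show "square_integrable (\<lambda>x. H' (w x) * G x)"
    using L by (intro square_integrable_bound[OF sq(2), of _ L]) (auto simp: abs_mult intro!: mult_right_mono)
  fix \<phi> :: "real ^ 'a \<Rightarrow> real" assume \<phi>: "\<phi> \<in> test_functions"
  note s\<phi> = test_square_integrable[OF \<phi>]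
  have [measurable]: "\<phi> \<in> borel_measurable borel" by (rule test_borel[OF \<phi>])
  obtain R B where RB: "R > 0" "B > 0"
    "\<And>x. \<bar>\<phi> x\<bar> \<le> B * indicator (ball 0 R) x"
    "\<And>x. \<bar>frechet_derivative \<phi> (at x) z\<bar> \<le> B * indicator (ball 0 R) x"
    by (rule test_bounded[OF \<phi>, of z]) blast
  define h where "h = (\<lambda>j::nat. 1 / (4::real) ^ j)"
  have h: "h j > 0" "h j \<le> 1" for j by (auto simp: h_def)
  have h_lim: "h \<longlonglongrightarrow> 0" unfolding h_def by real_asymp
  \<comment> \<open>Step sizes are at most \<open>1\<close>, so this ball contains the supports of all translates.\<close>
  define R' where "R' = R + norm z"
  have shift: "\<bar>f (x + t *\<^sub>R z)\<bar> \<le> B * indicator (ball 0 R') x"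
    if f: "\<And>x. \<bar>f x\<bar> \<le> B * indicator (ball 0 R) x" and t: "\<bar>t\<bar> \<le> 1" for f :: "real ^ 'a \<Rightarrow> real" and t x
  proof (cases "x + t *\<^sub>R z \<in> ball 0 R")
    case True
    have "norm x \<le> norm (x + t *\<^sub>R z) + norm (t *\<^sub>R z)" by (metis add_diff_cancel norm_triangle_ineq4)
    also have "\<dots> < R + norm z" using True t mult_right_mono[of "\<bar>t\<bar>" 1 "norm z"] by simp
    finally show ?thesis using f[of "x + t *\<^sub>R z"] True by (simp add: R'_def)
  next
    case False
    then show ?thesis using f[of "x + t *\<^sub>R z"] RB(2) by simp
  qed
  have sqB: "square_integrable (\<lambda>x. B * indicator (ball 0 R') x)"
  proof (rule square_integrable_compact_support[of _ B 0 R'])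
    show "(\<lambda>x. B * indicator (ball 0 R') x) \<in> borel_measurable borel"
      by (intro borel_measurable_times borel_measurable_const borel_measurable_indicator) simp
  qed (use RB(2) in simp)

  define \<theta> where "\<theta> = (\<lambda>j x. diff_quotient H H' (w x) (w (x + h j *\<^sub>R z)))"
  have [measurable]: "\<theta> j \<in> borel_measurable borel" for j
    unfolding \<theta>_def diff_quotient_def by measurable
  have \<theta>: "\<bar>\<theta> j x\<bar> \<le> L" for j x unfolding \<theta>_def by (rule quot)

  have left: "(\<lambda>j. LINT x|lborel. H (w x) * ((\<phi> (x + (- h j) *\<^sub>R z) - \<phi> x) / h j)) \<longlonglongrightarrow>
    (LINT x|lborel. H (w x) * (- frechet_derivative \<phi> (at x) z))"
  proof (rule integral_dominated_convergence[where w="\<lambda>x. \<bar>H (w x) * (B * indicator (ball 0 R') x)\<bar>"])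
    show "AE x in lborel. (\<lambda>j. H (w x) * ((\<phi> (x + (- h j) *\<^sub>R z) - \<phi> x) / h j)) \<longlonglongrightarrow> H (w x) * (- frechet_derivative \<phi> (at x) z)"
    proof (intro AE_I2 tendsto_mult tendsto_const)
      fix x
      have "((\<lambda>s. (\<phi> (x + s *\<^sub>R z) - \<phi> x) / s) \<longlongrightarrow> frechet_derivative \<phi> (at x) z) (at 0)"
        using test_line_derivative[OF \<phi>, of x z 0] by (simp add: has_field_derivative_iff)
      moreover have "filterlim (\<lambda>j. - h j) (at 0) sequentially"
        using h_lim h(1) by (auto simp: filterlim_at less_imp_neq[symmetric] intro!: tendsto_eq_intros)
      ultimately have "(\<lambda>j. (\<phi> (x + (- h j) *\<^sub>R z) - \<phi> x) / (- h j)) \<longlonglongrightarrow> frechet_derivative \<phi> (at x) z"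
        by (rule filterlim_compose)
      from tendsto_minus[OF this]
      show "(\<lambda>j. (\<phi> (x + (- h j) *\<^sub>R z) - \<phi> x) / h j) \<longlonglongrightarrow> - frechet_derivative \<phi> (at x) z" by simp
    qed
    show "AE x in lborel. norm (H (w x) * ((\<phi> (x + (- h j) *\<^sub>R z) - \<phi> x) / h j)) \<le> \<bar>H (w x) * (B * indicator (ball 0 R') x)\<bar>" for j
    proof (rule AE_I2)
      fix x
      from MVT2[OF _ test_line_derivative[OF \<phi>, of x z], of "- h j" 0] h(1)[of j]
      obtain \<xi> where \<xi>: "- h j < \<xi>" "\<xi> < 0" "\<phi> x - \<phi> (x + (- h j) *\<^sub>R z) = h j * frechet_derivative \<phi> (at (x + \<xi> *\<^sub>R z)) z"
        by auto
      then have "(\<phi> (x + (- h j) *\<^sub>R z) - \<phi> x) / h j = - frechet_derivative \<phi> (at (x + \<xi> *\<^sub>R z)) z"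
        using h(1)[of j] by (simp add: field_simps)
      moreover have "\<bar>frechet_derivative \<phi> (at (x + \<xi> *\<^sub>R z)) z\<bar> \<le> B * indicator (ball 0 R') x"
        using \<xi> h(2)[of j] by (intro shift[OF RB(4)]) simp
      ultimately show "norm (H (w x) * ((\<phi> (x + (- h j) *\<^sub>R z) - \<phi> x) / h j)) \<le> \<bar>H (w x) * (B * indicator (ball 0 R') x)\<bar>"
        using RB(2) by (simp add: abs_mult mult_left_mono)
    qed
    show "integrable lborel (\<lambda>x. \<bar>H (w x) * (B * indicator (ball 0 R') x)\<bar>)"
      by (intro integrable_abs square_integrable_mult sqH sqB)
  qed (use test_borel[OF \<phi>] in measurable)

  have eq: "(LINT x|lborel. H (w x) * ((\<phi> (x + (- h j) *\<^sub>R z) - \<phi> x) / h j))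
     = (LINT s|lborel. indicator {0..1} s *
         (LINT x|lborel. \<theta> j (x + (- (s * h j)) *\<^sub>R z) * \<phi> (x + (- (s * h j)) *\<^sub>R z) * G x))" for j
  proof -
    have s1: "square_integrable (\<lambda>x. \<phi> (x + (- h j) *\<^sub>R z))"
      by (rule square_integrable_translate[OF s\<phi>(1)])
    have s2: "square_integrable (\<lambda>x. H (w (x + h j *\<^sub>R z)))"
      by (rule square_integrable_translate[OF sqH])
    have "(LINT x|lborel. H (w x) * ((\<phi> (x + (- h j) *\<^sub>R z) - \<phi> x) / h j))
      = (LINT x|lborel. H (w x) * \<phi> (x + (- h j) *\<^sub>R z)) / h j - (LINT x|lborel. H (w x) * \<phi> x) / h j"
      using square_integrable_mult[OF sqH s1] square_integrable_mult[OF sqH s\<phi>(1)]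
      by (simp add: diff_divide_distrib right_diff_distrib)
    also have "(LINT x|lborel. H (w x) * \<phi> (x + (- h j) *\<^sub>R z)) = (LINT x|lborel. H (w (x + h j *\<^sub>R z)) * \<phi> x)"
      using lborel_integral_translate[of "\<lambda>x. H (w x) * \<phi> (x + (- h j) *\<^sub>R z)" "h j *\<^sub>R z"] by simp
    also have "\<dots> / h j - (LINT x|lborel. H (w x) * \<phi> x) / h j = (LINT x|lborel. (H (w (x + h j *\<^sub>R z)) - H (w x)) * \<phi> x) / h j"
      using square_integrable_mult[OF s2 s\<phi>(1)] square_integrable_mult[OF sqH s\<phi>(1)]
      by (simp add: diff_divide_distrib left_diff_distrib)
    also have "(LINT x|lborel. (H (w (x + h j *\<^sub>R z)) - H (w x)) * \<phi> x)
       = (LINT x|lborel. h j * ((\<theta> j x * \<phi> x) * (LINT s|lborel. indicator {0..1} s * G (x + s *\<^sub>R (h j *\<^sub>R z)))))"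
    proof (rule integral_cong_AE)
      show "AE x in lborel. (H (w (x + h j *\<^sub>R z)) - H (w x)) * \<phi> x
        = h j * ((\<theta> j x * \<phi> x) * (LINT s|lborel. indicator {0..1} s * G (x + s *\<^sub>R (h j *\<^sub>R z))))"
        using weak_dir_deriv_translation_formula[OF weak_dir_deriv_scale[OF wG, of "h j"]]
      proof eventually_elim
        case (elim x)
        then have "w (x + h j *\<^sub>R z) - w x = h j * (LINT s|lborel. indicator {0..1} s * G (x + s *\<^sub>R (h j *\<^sub>R z)))"
          by (simp add: mult.left_commute[of _ "h j"])
        then show ?case
          using diff_quotient_mult[of H H' "w x" "w (x + h j *\<^sub>R z)"]
          by (simp add: \<theta>_def mult.assoc mult.left_commute mult.commute)
      qed
    qed measurable
    also have "\<dots> / h j = (LINT x|lborel. (\<theta> j x * \<phi> x) * (LINT s|lborel. indicator {0..1} s * G (x + s *\<^sub>R (h j *\<^sub>R z))))"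
      using h(1)[of j] by simp
    also have "\<dots> = (LINT s|lborel. indicator {0..1} s * (LINT x|lborel. (\<theta> j x * \<phi> x) * G (x + s *\<^sub>R (h j *\<^sub>R z))))"
      using \<theta> by (intro line_average_Fubini sq square_integrable_bound[OF s\<phi>(1), of _ L])
         (auto simp: abs_mult intro!: mult_right_mono)
    also have "\<dots> = (LINT s|lborel. indicator {0..1} s *
         (LINT x|lborel. \<theta> j (x + (- (s * h j)) *\<^sub>R z) * \<phi> (x + (- (s * h j)) *\<^sub>R z) * G x))"
      using lborel_integral_translate[of "\<lambda>x. \<theta> j (x + (- (s * h j)) *\<^sub>R z) * \<phi> (x + (- (s * h j)) *\<^sub>R z) * G x" "(s * h j) *\<^sub>R z" for s]
      by simp
    finally show ?thesis .
  qed

  have inner: "(\<lambda>j. LINT x|lborel. \<theta> j (x + (- (s * h j)) *\<^sub>R z) * \<phi> (x + (- (s * h j)) *\<^sub>R z) * G x)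
      \<longlonglongrightarrow> (LINT x|lborel. H' (w x) * \<phi> x * G x)"
    and inner_bound: "\<bar>LINT x|lborel. \<theta> j (x + (- (s * h j)) *\<^sub>R z) * \<phi> (x + (- (s * h j)) *\<^sub>R z) * G x\<bar>
      \<le> (LINT x|lborel. L * ((B * indicator (ball 0 R') x) * \<bar>G x\<bar>))"
    if s: "0 \<le> s" "s \<le> 1" for s j
  proof -
    have sh: "\<bar>- (s * h j)\<bar> \<le> 1" for j
      using s h[of j] by (simp add: mult_le_one less_imp_le)
    have bound: "norm (\<theta> j (x + (- (s * h j)) *\<^sub>R z) * \<phi> (x + (- (s * h j)) *\<^sub>R z) * G x)
        \<le> L * ((B * indicator (ball 0 R') x) * \<bar>G x\<bar>)" for j x
      using mult_mono[OF \<theta>[of j "x + (- (s * h j)) *\<^sub>R z"] mult_right_mono[OF shift[OF RB(3) sh[of j], of x], of "\<bar>G x\<bar>"]]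
         order_trans[OF abs_ge_zero L]
      by (simp add: abs_mult mult.assoc)
    have int: "integrable lborel (\<lambda>x. L * ((B * indicator (ball 0 R') x) * \<bar>G x\<bar>))"
    proof -
      have "square_integrable (\<lambda>x. \<bar>G x\<bar>)" by (rule square_integrable_bound[OF sq(2), of _ 1]) simp_all
      from square_integrable_mult[OF sqB this] show ?thesis by (rule integrable_mult_right)
    qed
    have lim: "AE x in lborel. (\<lambda>j. \<theta> j (x + (- (s * h j)) *\<^sub>R z) * \<phi> (x + (- (s * h j)) *\<^sub>R z) * G x)
       \<longlonglongrightarrow> H' (w x) * \<phi> x * G x"
      using weak_dir_deriv_AE_translation_tendsto[OF wG, of "- s"] weak_dir_deriv_AE_translation_tendsto[OF wG, of "1 - s"]
    proof eventually_elim
      case (elim x)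
      have "(\<lambda>j. \<theta> j (x + (- (s * h j)) *\<^sub>R z)) \<longlonglongrightarrow> H' (w x)"
      proof -
        \<comment> \<open>Both arguments of the quotient are translates of \<open>w\<close> by a fixed multiple of \<open>4\<^bsup>-j\<^esup> z\<close>.\<close>
        have e: "x + (- (s * h j)) *\<^sub>R z = x + (- s / 4 ^ j) *\<^sub>R z"
            "x + (- s / 4 ^ j) *\<^sub>R z + h j *\<^sub>R z = x + ((1 - s) / 4 ^ j) *\<^sub>R z" for j
          by (simp_all add: h_def algebra_simps diff_divide_distrib)
        show ?thesis unfolding \<theta>_def e by (rule diff_quotient_tendsto[OF H H' elim])
      qed
      moreover have "(\<lambda>j. \<phi> (x + (- (s * h j)) *\<^sub>R z)) \<longlonglongrightarrow> \<phi> x"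
      proof (rule isCont_tendsto_compose[where g=\<phi> and l=x])
        show "isCont \<phi> x" using test_continuous(1)[OF \<phi>] by (simp add: continuous_on_eq_continuous_at)
        show "(\<lambda>j. x + (- (s * h j)) *\<^sub>R z) \<longlonglongrightarrow> x"
          using tendsto_add[OF tendsto_const[of x] tendsto_scaleR[OF tendsto_minus[OF tendsto_mult[OF tendsto_const[of s] h_lim]] tendsto_const[of z]]]
          by simp
      qed
      ultimately show ?case by (intro tendsto_mult tendsto_const)
    qed
    show "(\<lambda>j. LINT x|lborel. \<theta> j (x + (- (s * h j)) *\<^sub>R z) * \<phi> (x + (- (s * h j)) *\<^sub>R z) * G x)
      \<longlonglongrightarrow> (LINT x|lborel. H' (w x) * \<phi> x * G x)"
      by (rule integral_dominated_convergence[OF _ _ int lim]) (use bound in \<open>auto intro!: AE_I2\<close>)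
    show "\<bar>LINT x|lborel. \<theta> j (x + (- (s * h j)) *\<^sub>R z) * \<phi> (x + (- (s * h j)) *\<^sub>R z) * G x\<bar>
      \<le> (LINT x|lborel. L * ((B * indicator (ball 0 R') x) * \<bar>G x\<bar>))"
    proof -
      have "integrable lborel (\<lambda>x. \<theta> j (x + (- (s * h j)) *\<^sub>R z) * \<phi> (x + (- (s * h j)) *\<^sub>R z) * G x)"
        by (rule Bochner_Integration.integrable_bound[OF int]) (use order_trans[OF bound abs_ge_self] in auto)
      then show ?thesis
        using int bound by (intro order_trans[OF integral_abs_bound] integral_mono integrable_abs) (auto simp: )
    qed
  qed

  let ?C = "LINT x|lborel. L * ((B * indicator (ball 0 R') x) * \<bar>G x\<bar>)"
  have right: "(\<lambda>j. LINT s|lborel. indicator {0..1} s *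
         (LINT x|lborel. \<theta> j (x + (- (s * h j)) *\<^sub>R z) * \<phi> (x + (- (s * h j)) *\<^sub>R z) * G x))
     \<longlonglongrightarrow> (LINT s|lborel. indicator {0..1} (s::real) * (LINT x|lborel. H' (w x) * \<phi> x * G x))"
  proof (rule integral_dominated_convergence[where w="\<lambda>s. ?C * indicator {0..1} s"])
    show "AE s in lborel. (\<lambda>j. indicator {0..1} (s::real) * (LINT x|lborel. \<theta> j (x + (- (s * h j)) *\<^sub>R z) * \<phi> (x + (- (s * h j)) *\<^sub>R z) * G x))
        \<longlonglongrightarrow> indicator {0..1} s * (LINT x|lborel. H' (w x) * \<phi> x * G x)"
      using inner by (intro AE_I2) (auto simp: indicator_def)
    show "AE s in lborel. norm (indicator {0..1} (s::real) * (LINT x|lborel. \<theta> j (x + (- (s * h j)) *\<^sub>R z) * \<phi> (x + (- (s * h j)) *\<^sub>R z) * G x))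
        \<le> ?C * indicator {0..1} s" for j
      using inner_bound[of _ j] by (intro AE_I2) (auto simp: indicator_def)
  qed auto
  have "(\<lambda>j. LINT x|lborel. H (w x) * ((\<phi> (x + (- h j) *\<^sub>R z) - \<phi> x) / h j))
      \<longlonglongrightarrow> (LINT s|lborel. indicator {0..1} (s::real) * (LINT x|lborel. H' (w x) * \<phi> x * G x))"
    unfolding eq by (rule right)
  from LIMSEQ_unique[OF left this]
  have "- (LINT x|lborel. H (w x) * frechet_derivative \<phi> (at x) z) = (LINT x|lborel. H' (w x) * \<phi> x * G x)"
    by simp
  then show "(LINT x|lborel. H (w x) * frechet_derivative \<phi> (at x) z) = - (LINT x|lborel. H' (w x) * G x * \<phi> x)"
    by (simp add: mult.commute mult.left_commute)
qed

section \<open>Higher integrability from translation estimates\<close>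

text \<open>
  Cubes have a volume free of dimensional constants.
\<close>

definition cube :: "real \<Rightarrow> 'a::euclidean_space set" where
  "cube \<epsilon> = box 0 (\<epsilon> *\<^sub>R One)"

lemma cube_measurable [measurable]: "cube \<epsilon> \<in> sets borel"
  by (simp add: cube_def)

lemma emeasure_cube: "\<epsilon> \<ge> 0 \<Longrightarrow> emeasure lborel (cube \<epsilon> :: 'a::euclidean_space set) = ennreal (\<epsilon> ^ DIM('a))"
  unfolding cube_def by (subst emeasure_lborel_box) (auto simp: inner_simps)

lemma norm_cube:
  fixes \<epsilon> :: real
  assumes "z \<in> (cube \<epsilon> :: 'a::euclidean_space set)" shows "norm z \<le> DIM('a) * \<epsilon>"
proof -
  have "norm z \<le> (\<Sum>b\<in>Basis. \<bar>z \<bullet> b\<bar>)" by (rule norm_le_l1)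
  also have "\<dots> \<le> (\<Sum>b\<in>(Basis::'a set). \<epsilon>)"
    using assms by (intro sum_mono) (auto simp: cube_def mem_box)
  finally show ?thesis by simp
qed

text \<open>
  The values are extended nonnegative reals, because the mean may be infinite at individual points.
\<close>

definition mean_oscillation :: "real \<Rightarrow> ('a::euclidean_space \<Rightarrow> real) \<Rightarrow> 'a \<Rightarrow> ennreal" where
  "mean_oscillation \<epsilon> w x =
     ennreal (1 / \<epsilon> ^ DIM('a)) * (\<integral>\<^sup>+z. indicator (cube \<epsilon>) z * ennreal ((w (x + z) - w x)\<^sup>2) \<partial>lborel)"

lemma mean_oscillation_measurable [measurable]:
  assumes [measurable]: "w \<in> borel_measurable borel"
  shows "mean_oscillation \<epsilon> w \<in> borel_measurable borel"
  unfolding mean_oscillation_def by measurable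

lemma nn_integral_mean_oscillation:
  fixes w :: "'a::euclidean_space \<Rightarrow> real" and \<epsilon> :: real
  assumes [measurable]: "w \<in> borel_measurable borel" and "\<epsilon> > 0"
    and shift: "\<And>z. (\<integral>\<^sup>+x. ennreal ((w (x + z) - w x)\<^sup>2) \<partial>lborel) \<le> ennreal ((norm z * M)\<^sup>2)"
  shows "(\<integral>\<^sup>+x. mean_oscillation \<epsilon> w x \<partial>lborel) \<le> ennreal ((DIM('a) * \<epsilon> * M)\<^sup>2)"
proof -
  let ?n = "DIM('a)"
  have "(\<integral>\<^sup>+x. mean_oscillation \<epsilon> w x \<partial>lborel)
     = ennreal (1 / \<epsilon> ^ ?n) * (\<integral>\<^sup>+x. \<integral>\<^sup>+z. indicator (cube \<epsilon>) z * ennreal ((w (x + z) - w x)\<^sup>2) \<partial>lborel \<partial>lborel)"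
    unfolding mean_oscillation_def by (rule nn_integral_cmult) measurable
  also have "(\<integral>\<^sup>+x. \<integral>\<^sup>+z. indicator (cube \<epsilon>) z * ennreal ((w (x + z) - w x)\<^sup>2) \<partial>lborel \<partial>lborel)
     = (\<integral>\<^sup>+z. \<integral>\<^sup>+x. indicator (cube \<epsilon>) z * ennreal ((w (x + z) - w x)\<^sup>2) \<partial>lborel \<partial>lborel)"
    by (rule lborel_pair.Fubini') measurable
  also have "\<dots> = (\<integral>\<^sup>+z. indicator (cube \<epsilon>) z * (\<integral>\<^sup>+x. ennreal ((w (x + z) - w x)\<^sup>2) \<partial>lborel) \<partial>lborel)"
    by (intro nn_integral_cong nn_integral_cmult) measurable
  also have "\<dots> \<le> (\<integral>\<^sup>+z. ennreal ((?n * \<epsilon> * M)\<^sup>2) * indicator (cube \<epsilon> :: 'a set) z \<partial>lborel)"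
  proof (rule nn_integral_mono)
    fix z :: 'a
    show "indicator (cube \<epsilon>) z * (\<integral>\<^sup>+x. ennreal ((w (x + z) - w x)\<^sup>2) \<partial>lborel) \<le> ennreal ((?n * \<epsilon> * M)\<^sup>2) * indicator (cube \<epsilon>) z"
    proof (cases "z \<in> cube \<epsilon>")
      case True
      have "(norm z * M)\<^sup>2 \<le> (?n * \<epsilon> * M)\<^sup>2"
        unfolding power_mult_distrib[of _ M] using norm_cube[OF True] by (intro mult_right_mono power_mono) auto
      then show ?thesis using shift[of z] True by (auto intro: order_trans ennreal_leI)
    qed simp
  qed
  also have "\<dots> = ennreal ((?n * \<epsilon> * M)\<^sup>2) * ennreal (\<epsilon> ^ ?n)"
    using \<open>\<epsilon> > 0\<close> by (simp add: nn_integral_cmult emeasure_cube)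
  finally have "(\<integral>\<^sup>+x. mean_oscillation \<epsilon> w x \<partial>lborel)
      \<le> ennreal (1 / \<epsilon> ^ ?n) * (ennreal ((?n * \<epsilon> * M)\<^sup>2) * ennreal (\<epsilon> ^ ?n))"
    by (simp add: mult_left_mono)
  also have "\<dots> = ennreal ((?n * \<epsilon> * M)\<^sup>2)"
    using \<open>\<epsilon> > 0\<close> by (simp flip: ennreal_mult add: field_simps)
  finally show ?thesis .
qed

text \<open>
  Average \<open>w(x)\<^sup>2 \<le> 2 (w(x + z) - w(x))\<^sup>2 + 2 w(x + z)\<^sup>2\<close> over the cube. The condition on
  \<open>\<epsilon>\<close> says that the last term contributes at most half of the left-hand side.
\<close>

lemma square_le_mean_oscillation:
  fixes w :: "'a::euclidean_space \<Rightarrow> real"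
  assumes [measurable]: "w \<in> borel_measurable borel" and "\<epsilon> > 0"
    and w2: "(\<integral>\<^sup>+x. ennreal ((w x)\<^sup>2) \<partial>lborel) \<le> ennreal (M\<^sup>2)"
    and large: "4 * M\<^sup>2 \<le> \<epsilon> ^ DIM('a) * (w x)\<^sup>2"
  shows "ennreal ((w x)\<^sup>2) \<le> 4 * mean_oscillation \<epsilon> w x"
proof -
  let ?n = "DIM('a)"
  define I where "I = (\<integral>\<^sup>+z. indicator (cube \<epsilon>) z * ennreal ((w (x + z) - w x)\<^sup>2) \<partial>lborel)"
  have e: "0 < 1 / \<epsilon> ^ ?n" using \<open>\<epsilon> > 0\<close> by simp
  have "ennreal (\<epsilon> ^ ?n * (w x)\<^sup>2) = (\<integral>\<^sup>+z. ennreal ((w x)\<^sup>2) * indicator (cube \<epsilon> :: 'a set) z \<partial>lborel)"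
    using \<open>\<epsilon> > 0\<close> by (subst nn_integral_cmult_indicator) (simp_all add: emeasure_cube ennreal_mult mult.commute)
  also have "\<dots> \<le> (\<integral>\<^sup>+z. 2 * (indicator (cube \<epsilon>) z * ennreal ((w (x + z) - w x)\<^sup>2)) + 2 * ennreal ((w (z + x))\<^sup>2) \<partial>lborel)"
  proof (rule nn_integral_mono)
    fix z
    have "(a - b)\<^sup>2 \<le> 2 * a\<^sup>2 + 2 * b\<^sup>2" for a b :: real
      using zero_le_power2[of "a + b"] by (simp add: power2_eq_square algebra_simps)
    from this[of "w (x + z)" "w (x + z) - w x"]
    have "ennreal ((w x)\<^sup>2) \<le> ennreal (2 * (w (x + z) - w x)\<^sup>2 + 2 * (w (x + z))\<^sup>2)"
      by (intro ennreal_leI) simp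
    also have "\<dots> = 2 * ennreal ((w (x + z) - w x)\<^sup>2) + 2 * ennreal ((w (x + z))\<^sup>2)"
      by (simp add: ennreal_mult)
    finally show "ennreal ((w x)\<^sup>2) * indicator (cube \<epsilon>) z
        \<le> 2 * (indicator (cube \<epsilon>) z * ennreal ((w (x + z) - w x)\<^sup>2)) + 2 * ennreal ((w (z + x))\<^sup>2)"
      by (auto simp: indicator_def add.commute)
  qed
  also have "\<dots> = 2 * I + 2 * (\<integral>\<^sup>+z. ennreal ((w (z + x))\<^sup>2) \<partial>lborel)"
    unfolding I_def by (subst nn_integral_add) (auto simp: nn_integral_cmult)
  also have "(\<integral>\<^sup>+z. ennreal ((w (z + x))\<^sup>2) \<partial>lborel) = (\<integral>\<^sup>+z. ennreal ((w z)\<^sup>2) \<partial>lborel)"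
    by (rule nn_integral_translate) measurable
  also have "2 * I + 2 * (\<integral>\<^sup>+z. ennreal ((w z)\<^sup>2) \<partial>lborel) \<le> 2 * I + 2 * ennreal (M\<^sup>2)"
    using w2 by (intro add_left_mono mult_left_mono) auto
  finally have main: "ennreal (\<epsilon> ^ ?n * (w x)\<^sup>2) \<le> 2 * I + 2 * ennreal (M\<^sup>2)" .
  show ?thesis
  proof (cases I)
    case (real i)
    have "2 * I + 2 * ennreal (M\<^sup>2) = ennreal (2 * i + 2 * M\<^sup>2)" using real by (simp add: ennreal_mult)
    with main have "ennreal (\<epsilon> ^ ?n * (w x)\<^sup>2) \<le> ennreal (2 * i + 2 * M\<^sup>2)" by (simp only:)
    then have "\<epsilon> ^ ?n * (w x)\<^sup>2 \<le> 2 * i + 2 * M\<^sup>2" using real by (subst (asm) ennreal_le_iff) auto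
    then have "(w x)\<^sup>2 \<le> 4 * (1 / \<epsilon> ^ ?n * i)"
      using large \<open>\<epsilon> > 0\<close> by (simp add: field_simps)
    then have "ennreal ((w x)\<^sup>2) \<le> ennreal (4 * (1 / \<epsilon> ^ ?n * i))" by (rule ennreal_leI)
    also have "\<dots> = ennreal 4 * ennreal (1 / \<epsilon> ^ ?n * i)"
      using e real by (intro ennreal_mult) auto
    also have "ennreal (1 / \<epsilon> ^ ?n * i) = ennreal (1 / \<epsilon> ^ ?n) * ennreal i"
      using e real by (intro ennreal_mult) auto
    also have "ennreal 4 * \<dots> = 4 * mean_oscillation \<epsilon> w x"
      unfolding mean_oscillation_def I_def[symmetric] real(2) by simp
    finally show ?thesis .
  next
    case top
    then show ?thesis using e \<open>\<epsilon> > 0\<close> unfolding mean_oscillation_def I_def[symmetric]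
      by (simp add: ennreal_mult_top)
  qed
qed

text \<open>
  Where \<open>\<bar>w\<bar> \<le> 1\<close> the power is at most \<open>w\<^sup>2\<close>. On the set where
  \<open>2\<^sup>j \<le> \<bar>w\<bar> < 2\<^bsup>j+1\<^esup>\<close>, for \<open>j \<ge> 0\<close>, the oscillation at the scale
  \<open>\<epsilon>\<^sub>j = (4 M\<^sup>2 / 4\<^sup>j)\<^bsup>1/n\<^esup>\<close> controls \<open>w\<^sup>2\<close>, and its integral is at most
  \<open>(n \<epsilon>\<^sub>j M)\<^sup>2\<close>. Together with the factor \<open>\<bar>w\<bar>\<^bsup>r-2\<^esup>\<close> the level \<open>j\<close> contributes a
  multiple of \<open>q\<^sup>j\<close> with \<open>q = 2\<^bsup>r-2-4/n\<^esup>\<close>, and \<open>q < 1\<close> is the condition on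
  \<open>r\<close>. The constant depends on \<open>w\<close> only through \<open>M\<close>, which makes the estimate usable for a
  family of truncations.
\<close>

lemma higher_integrability:
  fixes M r :: real
  defines "n \<equiv> real DIM('a::euclidean_space)"
  assumes M: "M > 0" and r: "2 \<le> r" "r < 2 + 4 / n"
  obtains C :: real where
    "\<And>w::'a \<Rightarrow> real. w \<in> borel_measurable borel \<Longrightarrow>
       (\<integral>\<^sup>+x. ennreal ((w x)\<^sup>2) \<partial>lborel) \<le> ennreal (M\<^sup>2) \<Longrightarrow>
       (\<And>z. (\<integral>\<^sup>+x. ennreal ((w (x + z) - w x)\<^sup>2) \<partial>lborel) \<le> ennreal ((norm z * M)\<^sup>2)) \<Longrightarrow>
       (\<integral>\<^sup>+x. ennreal (\<bar>w x\<bar> powr r) \<partial>lborel) \<le> ennreal C"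
proof -
  have n: "n > 0" by (simp add: n_def)
  define \<epsilon> where "\<epsilon> = (\<lambda>j::nat. (4 * M\<^sup>2 / 4 ^ j) powr (1 / n))"
  have \<epsilon>: "\<epsilon> j > 0" "\<epsilon> j ^ DIM('a) = 4 * M\<^sup>2 / 4 ^ j" for j
  proof -
    have pos: "4 * M\<^sup>2 / 4 ^ j > 0" using M by simp
    show "\<epsilon> j > 0" using M by (simp add: \<epsilon>_def)
    then have "\<epsilon> j ^ DIM('a) = \<epsilon> j powr n" by (simp add: n_def powr_realpow)
    also have "\<dots> = (4 * M\<^sup>2 / 4 ^ j) powr (1 / n * n)" unfolding \<epsilon>_def by (rule powr_powr)
    also have "\<dots> = 4 * M\<^sup>2 / 4 ^ j" using n M by simp
    finally show "\<epsilon> j ^ DIM('a) = 4 * M\<^sup>2 / 4 ^ j" .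
  qed
  define c where "c = (\<lambda>j::nat. 2 powr (real (Suc j) * (r - 2)))"
  define q where "q = 2 powr (r - 2 - 4 / n)"
  have q: "0 < q" "q < 1" using r by (auto simp: q_def intro: powr_less_one)
  define K where "K = 4 * 2 powr (r - 2) * (n * M)\<^sup>2 * (4 * M\<^sup>2) powr (2 / n)"
  have K: "K \<ge> 0" by (simp add: K_def)
  have term_eq: "4 * c j * (n * \<epsilon> j * M)\<^sup>2 = K * q ^ j" for j
  proof -
    have "(\<epsilon> j)\<^sup>2 = (4 * M\<^sup>2 / 4 ^ j) powr (2 / n)"
      unfolding \<epsilon>_def power2_eq_square powr_add[symmetric] by (simp add: add_divide_distrib[symmetric])
    also have "\<dots> = (4 * M\<^sup>2) powr (2 / n) * (4 powr (real j)) powr (- 2 / n)"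
      by (simp add: powr_divide powr_realpow powr_minus_divide)
    also have "(4::real) powr (real j) = 2 powr (2 * real j)"
      by (subst powr_powr[symmetric]) simp
    also have "(2 powr (2 * real j)) powr (- 2 / n) = 2 powr (real j * (- 4 / n))"
      by (simp add: powr_powr mult.commute)
    finally have "(\<epsilon> j)\<^sup>2 = (4 * M\<^sup>2) powr (2 / n) * 2 powr (real j * (- 4 / n))" .
    moreover have "c j = 2 powr (r - 2) * 2 powr (real j * (r - 2))"
      by (simp add: c_def powr_add[symmetric] algebra_simps)
    moreover have "q ^ j = 2 powr (real j * (r - 2)) * 2 powr (real j * (- 4 / n))"
      by (simp add: q_def powr_add[symmetric] powr_realpow[symmetric] powr_powr algebra_simps)
    ultimately show ?thesis by (simp add: K_def power_mult_distrib)
  qed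
  show ?thesis
  proof (rule that[of "M\<^sup>2 + K * (1 / (1 - q))"])
    fix w :: "'a \<Rightarrow> real"
    assume [measurable]: "w \<in> borel_measurable borel"
      and w2: "(\<integral>\<^sup>+x. ennreal ((w x)\<^sup>2) \<partial>lborel) \<le> ennreal (M\<^sup>2)"
      and shift: "\<And>z. (\<integral>\<^sup>+x. ennreal ((w (x + z) - w x)\<^sup>2) \<partial>lborel) \<le> ennreal ((norm z * M)\<^sup>2)"
    let ?T = "\<lambda>j x. ennreal (4 * c j) * mean_oscillation (\<epsilon> j) w x"
    have pw: "ennreal (\<bar>w x\<bar> powr r) \<le> ennreal ((w x)\<^sup>2) + (\<Sum>j. ?T j x)" for x
    proof (cases "\<bar>w x\<bar> \<le> 1")
      case True
      have "\<bar>w x\<bar> powr r \<le> (w x)\<^sup>2"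
        using powr_mono'[of 2 r "\<bar>w x\<bar>"] True r(1) by simp
      then show ?thesis by (intro add_increasing2 ennreal_leI) auto
    next
      case False
      define j where "j = nat \<lfloor>log 2 \<bar>w x\<bar>\<rfloor>"
      have "0 \<le> log 2 \<bar>w x\<bar>" using False by simp
      then have j: "real j \<le> log 2 \<bar>w x\<bar>" "log 2 \<bar>w x\<bar> < real (Suc j)" unfolding j_def by linarith+
      have lo: "2 ^ j \<le> \<bar>w x\<bar>"
        using j(1) False by (subst (asm) le_log_iff) (auto simp: powr_realpow)
      have hi: "\<bar>w x\<bar> \<le> 2 powr real (Suc j)"
        using j(2) False by (subst (asm) log_less_iff) auto
      have "4 ^ j \<le> (w x)\<^sup>2"
        using power_mono[OF lo, of 2] power_mult[of "2::real" 2 j] power_mult[of "2::real" j 2] by (simp add: mult.commute)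
      then have "4 * M\<^sup>2 \<le> \<epsilon> j ^ DIM('a) * (w x)\<^sup>2"
        unfolding \<epsilon> using M by (simp add: field_simps)
      from square_le_mean_oscillation[OF _ \<epsilon>(1) w2 this]
      have le: "ennreal ((w x)\<^sup>2) \<le> 4 * mean_oscillation (\<epsilon> j) w x" by simp
      have "\<bar>w x\<bar> powr r = \<bar>w x\<bar> powr (r - 2) * (w x)\<^sup>2"
        using False powr_add[of "\<bar>w x\<bar>" "r - 2" 2] by simp
      also have "\<dots> \<le> c j * (w x)\<^sup>2"
        unfolding c_def powr_powr[symmetric] using r hi by (intro mult_right_mono powr_mono2) auto
      finally have "ennreal (\<bar>w x\<bar> powr r) \<le> ennreal (c j) * ennreal ((w x)\<^sup>2)"
        by (simp add: ennreal_mult'[symmetric] c_def ennreal_leI)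
      also have "\<dots> \<le> ennreal (c j) * (4 * mean_oscillation (\<epsilon> j) w x)"
        by (intro mult_left_mono le) auto
      also have "\<dots> = ?T j x" by (simp add: ennreal_mult' c_def mult_ac)
      also have "\<dots> \<le> (\<Sum>j. ?T j x)"
        using sum_le_suminf[of "\<lambda>j. ?T j x" "{j}"] by (auto intro: summableI)
      finally show ?thesis by (intro add_increasing) auto
    qed
    have "(\<integral>\<^sup>+x. ennreal (\<bar>w x\<bar> powr r) \<partial>lborel) \<le> (\<integral>\<^sup>+x. ennreal ((w x)\<^sup>2) + (\<Sum>j. ?T j x) \<partial>lborel)"
      by (intro nn_integral_mono pw)
    also have "\<dots> = (\<integral>\<^sup>+x. ennreal ((w x)\<^sup>2) \<partial>lborel) + (\<Sum>j. ennreal (4 * c j) * (\<integral>\<^sup>+x. mean_oscillation (\<epsilon> j) w x \<partial>lborel))"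
      by (simp add: nn_integral_add nn_integral_suminf nn_integral_cmult)
    also have "\<dots> \<le> ennreal (M\<^sup>2) + (\<Sum>j. ennreal (K * q ^ j))"
    proof (intro add_mono w2 suminf_le summableI)
      fix j
      have "ennreal (4 * c j) * (\<integral>\<^sup>+x. mean_oscillation (\<epsilon> j) w x \<partial>lborel) \<le> ennreal (4 * c j) * ennreal ((n * \<epsilon> j * M)\<^sup>2)"
        unfolding n_def by (intro mult_left_mono nn_integral_mean_oscillation \<epsilon> shift) auto
      also have "\<dots> = ennreal (K * q ^ j)"
        unfolding term_eq[symmetric] by (simp add: ennreal_mult c_def)
      finally show "ennreal (4 * c j) * (\<integral>\<^sup>+x. mean_oscillation (\<epsilon> j) w x \<partial>lborel) \<le> ennreal (K * q ^ j)" .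
    qed
    also have "(\<Sum>j. ennreal (K * q ^ j)) = ennreal (\<Sum>j. K * q ^ j)"
      using K q by (intro suminf_ennreal2 summable_mult summable_geometric) auto
    also have "(\<Sum>j. K * q ^ j) = K * (1 / (1 - q))"
      using q by (subst suminf_mult) (auto simp: suminf_geometric intro: summable_geometric)
    also have "ennreal (M\<^sup>2) + \<dots> = ennreal (M\<^sup>2 + K * (1 / (1 - q)))"
      using K q by (subst ennreal_plus) auto
    finally show "(\<integral>\<^sup>+x. ennreal (\<bar>w x\<bar> powr r) \<partial>lborel) \<le> ennreal (M\<^sup>2 + K * (1 / (1 - q)))" .
  qed
qed

section \<open>Double integrals with a Riesz kernel\<close>

lemma ennreal_term_le_suminf: "f j \<le> (\<Sum>j. f j)" for f :: "nat \<Rightarrow> ennreal"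
  using sum_le_suminf[of f "{j}"] by (simp add: summableI)

lemma nn_integral_le_suminf:
  assumes "\<And>x. f x \<le> (\<Sum>j. T j x)" "\<And>j. T j \<in> borel_measurable M"
  shows "(\<integral>\<^sup>+x. f x \<partial>M) \<le> (\<Sum>j. \<integral>\<^sup>+x. T j x \<partial>M)"
  unfolding nn_integral_suminf[OF assms(2), symmetric] by (intro nn_integral_mono assms(1))

lemma nn_integral_ball_const:
  fixes r c :: real
  assumes "0 \<le> r" "0 \<le> c"
  shows "(\<integral>\<^sup>+x. ennreal c * indicator (ball 0 r :: 'a::euclidean_space set) x \<partial>lborel)
    = ennreal (c * (unit_ball_vol DIM('a) * r ^ DIM('a)))"
  using assms by (subst nn_integral_cmult_indicator) (auto simp: emeasure_ball ennreal_mult unit_ball_vol_nonneg)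

lemma geometric_ennreal_finite:
  fixes C q :: real
  assumes "0 \<le> C" "0 < q" "q < 1"
  shows "(\<Sum>j. ennreal (C * q ^ j)) < \<infinity>"
  using assms by (subst suminf_ennreal2) (auto intro!: summable_mult summable_geometric)

text \<open>
  The value \<open>0\<close> of the integrand at the origin is harmless. On the shell
  \<open>2\<^bsup>-j-1\<^esup> \<le> \<bar>x\<bar> < 2\<^bsup>-j\<^esup>\<close> the integrand is comparable to a constant, and the shells
  contribute the terms of a geometric series.
\<close>

lemma nn_integral_norm_powr_near:
  assumes "0 \<le> \<kappa>" "\<kappa> < real DIM('a)"
  shows "(\<integral>\<^sup>+x. indicator (ball 0 1) x * ennreal (1 / norm (x::'a::euclidean_space) powr \<kappa>) \<partial>lborel) < \<infinity>"
proof -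
  let ?n = "DIM('a)" and ?V = "unit_ball_vol (real DIM('a))"
  let ?T = "\<lambda>j x. ennreal (2 powr (real (Suc j) * \<kappa>)) * indicator (ball 0 ((1 / 2) ^ j)) (x::'a)"
  have pw: "indicator (ball 0 1) x * ennreal (1 / norm x powr \<kappa>) \<le> (\<Sum>j. ?T j x)" for x :: 'a
  proof (cases "x \<in> ball 0 1 \<and> x \<noteq> 0")
    case True
    then have x: "0 < norm x" "norm x < 1" by auto
    define j where "j = nat (\<lceil>- log 2 (norm x)\<rceil> - 1)"
    have "0 < - log 2 (norm x)" using x by (simp add: log_less_zero_cancel_iff)
    then have j: "real j < - log 2 (norm x)" "- log 2 (norm x) \<le> real (Suc j)"
      unfolding j_def by linarith+
    have lo: "2 powr (- real (Suc j)) \<le> norm x"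
      using j(2) x by (subst le_log_iff[symmetric]) auto
    have "norm x < 2 powr (- real j)"
      using j(1) x by (subst log_less_iff[symmetric]) auto
    then have hi: "norm x < (1 / 2) ^ j"
      by (simp add: powr_minus powr_realpow power_one_over inverse_eq_divide)
    have "1 / norm x powr \<kappa> \<le> 1 / (2 powr (- real (Suc j))) powr \<kappa>"
      using lo x assms by (intro divide_left_mono powr_mono2) auto
    also have "\<dots> = 2 powr (real (Suc j) * \<kappa>)"
      by (simp add: powr_powr powr_minus_divide[symmetric] algebra_simps)
    finally have "indicator (ball 0 1) x * ennreal (1 / norm x powr \<kappa>) \<le> ?T j x"
      using x hi by (simp add: ennreal_leI)
    also have "\<dots> \<le> (\<Sum>j. ?T j x)"
      by (rule ennreal_term_le_suminf)
    finally show ?thesis .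
  qed auto
  have "(\<integral>\<^sup>+x. indicator (ball 0 1) x * ennreal (1 / norm (x::'a) powr \<kappa>) \<partial>lborel) \<le> (\<Sum>j. \<integral>\<^sup>+x. ?T j x \<partial>lborel)"
    by (rule nn_integral_le_suminf[OF pw]) (simp add: borel_measurable_times_ennreal borel_measurable_indicator)
  also have "\<dots> = (\<Sum>j. ennreal ((2 powr \<kappa> * ?V) * (2 powr (\<kappa> - ?n)) ^ j))"
  proof (rule suminf_cong)
    fix j
    have "2 powr (real (Suc j) * \<kappa>) * (((1 / 2) ^ j) ^ ?n) = 2 powr \<kappa> * (2 powr (\<kappa> - ?n)) ^ j"
    proof -
      have "((1 / 2 :: real) ^ j) ^ ?n = 2 powr (- (real j * ?n))"
        by (simp add: power_one_over powr_minus_divide powr_realpow flip: power_mult of_nat_mult)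
      moreover have "(2 powr (\<kappa> - ?n)) ^ j = 2 powr (real j * \<kappa>) * 2 powr (- (real j * ?n))"
        by (simp add: powr_realpow[symmetric] powr_powr powr_add[symmetric] algebra_simps)
      ultimately show ?thesis by (simp add: powr_add distrib_right)
    qed
    then have e: "2 powr (real (Suc j) * \<kappa>) * (?V * ((1 / 2) ^ j) ^ ?n) = (2 powr \<kappa> * ?V) * (2 powr (\<kappa> - ?n)) ^ j"
      by (simp add: mult_ac)
    show "(\<integral>\<^sup>+x. ?T j x \<partial>lborel) = ennreal ((2 powr \<kappa> * ?V) * (2 powr (\<kappa> - ?n)) ^ j)"
      by (subst nn_integral_ball_const) (simp_all only: e zero_le_power zero_le_divide_1_iff zero_le_numeral powr_ge_zero)
  qed
  also have "\<dots> < \<infinity>"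
    using assms by (intro geometric_ennreal_finite) (auto intro: powr_less_one simp: unit_ball_vol_nonneg)
  finally show ?thesis .
qed

lemma nn_integral_norm_powr_far:
  assumes "real DIM('a) < \<kappa>"
  shows "(\<integral>\<^sup>+x. indicator (- ball 0 1) x * ennreal (1 / norm (x::'a::euclidean_space) powr \<kappa>) \<partial>lborel) < \<infinity>"
proof -
  let ?n = "DIM('a)" and ?V = "unit_ball_vol (real DIM('a))"
  let ?T = "\<lambda>j x. ennreal (2 powr (- (real j * \<kappa>))) * indicator (ball 0 (2 ^ Suc j)) (x::'a)"
  have pw: "indicator (- ball 0 1) x * ennreal (1 / norm x powr \<kappa>) \<le> (\<Sum>j. ?T j x)" for x :: 'a
  proof (cases "norm x \<ge> 1")
    case True
    define j where "j = nat \<lfloor>log 2 (norm x)\<rfloor>"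
    have "0 \<le> log 2 (norm x)" using True by (subst zero_le_log_cancel_iff) linarith+
    then have j: "real j \<le> log 2 (norm x)" "log 2 (norm x) < real (Suc j)" unfolding j_def by linarith+
    have x: "norm x > 0" using True by linarith
    have lo: "2 powr real j \<le> norm x"
      using j(1) x by (subst le_log_iff[symmetric]) auto
    have hi: "norm x < 2 ^ Suc j"
      using j(2) x by (subst (asm) log_less_iff) (auto simp: powr_realpow simp del: of_nat_Suc power_Suc)
    have "1 / norm x powr \<kappa> \<le> 1 / (2 powr real j) powr \<kappa>"
      using lo x assms by (intro divide_left_mono powr_mono2) auto
    also have "\<dots> = 2 powr (- (real j * \<kappa>))"
      by (simp add: powr_powr powr_minus_divide)
    finally have "indicator (- ball 0 1) x * ennreal (1 / norm x powr \<kappa>) \<le> ?T j x"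
      using True hi by (simp add: ennreal_leI del: power_Suc)
    also have "\<dots> \<le> (\<Sum>j. ?T j x)"
      by (rule ennreal_term_le_suminf)
    finally show ?thesis .
  qed auto
  have "(\<integral>\<^sup>+x. indicator (- ball 0 1) x * ennreal (1 / norm (x::'a) powr \<kappa>) \<partial>lborel) \<le> (\<Sum>j. \<integral>\<^sup>+x. ?T j x \<partial>lborel)"
    by (rule nn_integral_le_suminf[OF pw]) (simp add: borel_measurable_times_ennreal borel_measurable_indicator)
  also have "\<dots> = (\<Sum>j. ennreal ((2 ^ ?n * ?V) * (2 powr (?n - \<kappa>)) ^ j))"
  proof (rule suminf_cong)
    fix j
    have "2 powr (- (real j * \<kappa>)) * ((2 ^ Suc j) ^ ?n) = 2 ^ ?n * (2 powr (?n - \<kappa>)) ^ j"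
    proof -
      have "((2 :: real) ^ Suc j) ^ ?n = 2 ^ ?n * 2 powr (real j * ?n)"
        by (simp add: powr_realpow power_mult_distrib flip: power_mult of_nat_mult)
      moreover have "(2 powr (?n - \<kappa>)) ^ j = 2 powr (real j * ?n) * 2 powr (- (real j * \<kappa>))"
        by (simp add: powr_realpow[symmetric] powr_powr powr_add[symmetric] algebra_simps)
      ultimately show ?thesis by simp
    qed
    then have e: "2 powr (- (real j * \<kappa>)) * (?V * (2 ^ Suc j) ^ ?n) = (2 ^ ?n * ?V) * (2 powr (?n - \<kappa>)) ^ j"
      by (simp add: mult_ac del: power_Suc)
    show "(\<integral>\<^sup>+x. ?T j x \<partial>lborel) = ennreal ((2 ^ ?n * ?V) * (2 powr (?n - \<kappa>)) ^ j)"
      by (subst nn_integral_ball_const) (simp_all only: e zero_le_power zero_le_numeral powr_ge_zero)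
  qed
  also have "\<dots> < \<infinity>"
    using assms by (intro geometric_ennreal_finite) (auto intro: powr_less_one simp: unit_ball_vol_nonneg)
  finally show ?thesis .
qed

text \<open>
  The left-hand side is \<open>(X Y)\<^bsup>\<theta>1\<^esup> (Y Z)\<^bsup>\<theta>2\<^esup> (X Z)\<^bsup>\<theta>3\<^esup>\<close>, a geometric mean of the three
  pairwise products.
\<close>

lemma weighted_product_le_pairwise:
  fixes X Y Z :: real
  assumes "0 \<le> X" "0 \<le> Y" "0 \<le> Z" and "0 < \<theta>1" "0 < \<theta>2" "0 < \<theta>3" "\<theta>1 + \<theta>2 + \<theta>3 = 1"
  shows "X powr (\<theta>1 + \<theta>3) * Y powr (\<theta>1 + \<theta>2) * Z powr (\<theta>2 + \<theta>3) \<le> X * Y + Y * Z + X * Z"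
proof -
  define m where "m = X * Y + Y * Z + X * Z"
  have m: "X * Y \<le> m" "Y * Z \<le> m" "X * Z \<le> m" "0 \<le> m" using assms by (auto simp: m_def)
  have "X powr (\<theta>1 + \<theta>3) * Y powr (\<theta>1 + \<theta>2) * Z powr (\<theta>2 + \<theta>3) = (X * Y) powr \<theta>1 * (Y * Z) powr \<theta>2 * (X * Z) powr \<theta>3"
    using assms by (simp add: powr_add powr_mult)
  also have "\<dots> \<le> m powr \<theta>1 * m powr \<theta>2 * m powr \<theta>3"
    using assms m by (intro mult_mono powr_mono2) auto
  also have "\<dots> = m" using m assms by (simp add: powr_add[symmetric])
  finally show ?thesis by (simp add: m_def)
qed

lemma weighted_product_le_sum:
  fixes X Y :: real
  assumes "0 \<le> X" "0 \<le> Y" and "0 < \<theta>" "\<theta> < 1"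
  shows "X powr \<theta> * Y powr (1 - \<theta>) \<le> X + Y"
proof -
  have "X powr \<theta> * Y powr (1 - \<theta>) \<le> (X + Y) powr \<theta> * (X + Y) powr (1 - \<theta>)"
    using assms by (intro mult_mono powr_mono2) auto
  also have "\<dots> = X + Y" using assms by (simp add: powr_add[symmetric])
  finally show ?thesis .
qed

lemma nn_integral_pair_shift:
  fixes F H :: "'a::euclidean_space \<Rightarrow> ennreal"
  assumes [measurable]: "F \<in> borel_measurable borel" "H \<in> borel_measurable borel"
  shows "(\<integral>\<^sup>+x. \<integral>\<^sup>+y. F y * H (x - y) \<partial>lborel \<partial>lborel) = (\<integral>\<^sup>+y. F y \<partial>lborel) * (\<integral>\<^sup>+x. H x \<partial>lborel)"
proof -
  have "(\<integral>\<^sup>+x. \<integral>\<^sup>+y. F y * H (x - y) \<partial>lborel \<partial>lborel) = (\<integral>\<^sup>+y. \<integral>\<^sup>+x. F y * H (x + (- y)) \<partial>lborel \<partial>lborel)"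
    by (subst lborel_pair.Fubini') simp_all
  also have "\<dots> = (\<integral>\<^sup>+y. F y * (\<integral>\<^sup>+x. H x \<partial>lborel) \<partial>lborel)"
    by (simp add: nn_integral_cmult nn_integral_translate del: add_uminus_conv_diff)
  finally show ?thesis by (simp add: nn_integral_multc)
qed

text \<open>
  A non-sharp Young inequality. With \<open>a = 1 / (\<theta>1 + \<theta>3)\<close>, \<open>b = 1 / (\<theta>2 + \<theta>3)\<close> and
  \<open>m = 1 / (\<theta>1 + \<theta>2)\<close>, so that \<open>1 / a + 1 / b + 1 / m = 2\<close>, the integrand is at most
  \<open>f\<^sup>a K\<^sup>m + K\<^sup>m g\<^sup>b + f\<^sup>a g\<^sup>b\<close>. Each term has a finite double integral, because each
  of the three pairs of arguments among \<open>y\<close>, \<open>x - y\<close>, \<open>x\<close> forms coordinates of the product space.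
\<close>

lemma riesz_energy_near_finite:
  fixes f g :: "'a::euclidean_space \<Rightarrow> real"
  assumes [measurable]: "f \<in> borel_measurable borel" "g \<in> borel_measurable borel"
    and nonneg: "\<And>x. 0 \<le> f x" "\<And>x. 0 \<le> g x"
    and \<theta>: "0 < \<theta>1" "0 < \<theta>2" "0 < \<theta>3" "\<theta>1 + \<theta>2 + \<theta>3 = 1"
    and \<kappa>: "0 < \<kappa>" "\<kappa> / (\<theta>1 + \<theta>2) < real DIM('a)"
    and f: "(\<integral>\<^sup>+x. ennreal (f x powr (1 / (\<theta>1 + \<theta>3))) \<partial>lborel) < \<infinity>"
    and g: "(\<integral>\<^sup>+x. ennreal (g x powr (1 / (\<theta>2 + \<theta>3))) \<partial>lborel) < \<infinity>"
  shows "(\<integral>\<^sup>+x. \<integral>\<^sup>+y. ennreal (f y * (indicator (ball 0 1) (x - y) / norm (x - y) powr \<kappa>) * g x) \<partial>lborel \<partial>lborel) < \<infinity>"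
proof -
  define X where "X = (\<lambda>y. f y powr (1 / (\<theta>1 + \<theta>3)))"
  define Z where "Z = (\<lambda>x. g x powr (1 / (\<theta>2 + \<theta>3)))"
  define Y where "Y = (\<lambda>z::'a. indicator (ball 0 1) z * (1 / norm z powr (\<kappa> / (\<theta>1 + \<theta>2))))"
  have [measurable]: "ball (0::'a) 1 \<in> sets borel" by simp
  have [measurable]: "X \<in> borel_measurable borel" unfolding X_def by measurable
  have [measurable]: "Y \<in> borel_measurable borel" unfolding Y_def by measurable
  have [measurable]: "Z \<in> borel_measurable borel" unfolding Z_def by measurable
  have pos: "0 \<le> X y" "0 \<le> Y y" "0 \<le> Z y" for y by (auto simp: X_def Y_def Z_def)
  have pw: "f y * (indicator (ball 0 1) (x - y) / norm (x - y) powr \<kappa>) * g x \<le> X y * Y (x - y) + Y (x - y) * Z x + X y * Z x" for x y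
  proof -
    have "f y = X y powr (\<theta>1 + \<theta>3)" "g x = Z x powr (\<theta>2 + \<theta>3)"
      using nonneg \<theta> by (auto simp: X_def Z_def powr_powr)
    moreover have "indicator (ball 0 1) (x - y) / norm (x - y) powr \<kappa> = Y (x - y) powr (\<theta>1 + \<theta>2)"
      using \<theta> by (auto simp: Y_def indicator_def powr_divide powr_powr)
    ultimately show ?thesis using weighted_product_le_pairwise[OF pos(1,2,3) \<theta>, of y "x - y" x] by simp
  qed
  let ?X = "\<integral>\<^sup>+y. ennreal (X y) \<partial>lborel" and ?Y = "\<integral>\<^sup>+y. ennreal (Y y) \<partial>lborel" and ?Z = "\<integral>\<^sup>+y. ennreal (Z y) \<partial>lborel"
  have Y: "?Y < \<infinity>"
  proof -
    have "ennreal (Y z) = indicator (ball 0 1) z * ennreal (1 / norm z powr (\<kappa> / (\<theta>1 + \<theta>2)))" for z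
      by (simp add: Y_def indicator_def)
    then show ?thesis
      using nn_integral_norm_powr_near[of "\<kappa> / (\<theta>1 + \<theta>2)", where 'a='a] \<kappa> \<theta> by simp
  qed
  have XZ: "?X < \<infinity>" "?Z < \<infinity>" using f g by (simp_all add: X_def Z_def)
  have "(\<integral>\<^sup>+x. \<integral>\<^sup>+y. ennreal (f y * (indicator (ball 0 1) (x - y) / norm (x - y) powr \<kappa>) * g x) \<partial>lborel \<partial>lborel)
    \<le> (\<integral>\<^sup>+x. \<integral>\<^sup>+y. ennreal (X y) * ennreal (Y (x - y)) + (ennreal (Y (x - y)) * ennreal (Z x) + ennreal (X y) * ennreal (Z x)) \<partial>lborel \<partial>lborel)"
  proof (intro nn_integral_mono)
    fix x y
    show "ennreal (f y * (indicator (ball 0 1) (x - y) / norm (x - y) powr \<kappa>) * g x)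
      \<le> ennreal (X y) * ennreal (Y (x - y)) + (ennreal (Y (x - y)) * ennreal (Z x) + ennreal (X y) * ennreal (Z x))"
      using pw[of y x] pos by (simp add: ennreal_mult[symmetric] ennreal_plus[symmetric] add.assoc ennreal_leI del: ennreal_plus)
  qed
  also have "\<dots> = (\<integral>\<^sup>+x. \<integral>\<^sup>+y. ennreal (X y) * ennreal (Y (x - y)) \<partial>lborel \<partial>lborel) +
     ((\<integral>\<^sup>+x. \<integral>\<^sup>+y. ennreal (Y (x - y)) * ennreal (Z x) \<partial>lborel \<partial>lborel) + (\<integral>\<^sup>+x. \<integral>\<^sup>+y. ennreal (X y) * ennreal (Z x) \<partial>lborel \<partial>lborel))"
    by (simp add: nn_integral_add)
  also have "(\<integral>\<^sup>+x. \<integral>\<^sup>+y. ennreal (X y) * ennreal (Y (x - y)) \<partial>lborel \<partial>lborel) = ?X * ?Y"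
    by (rule nn_integral_pair_shift) measurable
  also have "(\<integral>\<^sup>+x. \<integral>\<^sup>+y. ennreal (Y (x - y)) * ennreal (Z x) \<partial>lborel \<partial>lborel) = ?Z * ?Y"
  proof -
    have sym: "Y (x - y) = Y (y - x)" for x y by (simp add: Y_def norm_minus_commute indicator_def)
    have "(\<integral>\<^sup>+y. ennreal (Y (x - y)) \<partial>lborel) = ?Y" for x
      unfolding sym[of x] using nn_integral_translate[of "\<lambda>y. ennreal (Y y)" "- x"] by simp
    then show ?thesis by (simp add: nn_integral_multc nn_integral_cmult mult.commute)
  qed
  also have "(\<integral>\<^sup>+x. \<integral>\<^sup>+y. ennreal (X y) * ennreal (Z x) \<partial>lborel \<partial>lborel) = ?X * ?Z"
    by (simp add: nn_integral_multc nn_integral_cmult)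
  also have "?X * ?Y + (?Z * ?Y + ?X * ?Z) < \<infinity>"
    using XZ Y by (simp add: ennreal_mult_less_top)
  finally show ?thesis .
qed

text \<open>
  Away from the origin the kernel has integrable powers for large exponents, so that its convolution
  with \<open>f\<close> is bounded.
\<close>

lemma riesz_energy_far_finite:
  fixes f g :: "'a::euclidean_space \<Rightarrow> real"
  assumes [measurable]: "f \<in> borel_measurable borel" "g \<in> borel_measurable borel"
    and nonneg: "\<And>x. 0 \<le> f x" "\<And>x. 0 \<le> g x"
    and \<theta>: "0 < \<theta>" "\<theta> < 1"
    and \<kappa>: "real DIM('a) < \<kappa> / (1 - \<theta>)"
    and f: "(\<integral>\<^sup>+x. ennreal (f x powr (1 / \<theta>)) \<partial>lborel) < \<infinity>"
    and g: "(\<integral>\<^sup>+x. ennreal (g x) \<partial>lborel) < \<infinity>"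
  shows "(\<integral>\<^sup>+x. \<integral>\<^sup>+y. ennreal (f y * (indicator (- ball 0 1) (x - y) / norm (x - y) powr \<kappa>) * g x) \<partial>lborel \<partial>lborel) < \<infinity>"
proof -
  define X where "X = (\<lambda>y. f y powr (1 / \<theta>))"
  define Y where "Y = (\<lambda>z::'a. indicator (- ball 0 1) z * (1 / norm z powr (\<kappa> / (1 - \<theta>))))"
  have [measurable]: "- ball (0::'a) 1 \<in> sets borel" by simp
  have [measurable]: "X \<in> borel_measurable borel" unfolding X_def by measurable
  have [measurable]: "Y \<in> borel_measurable borel" unfolding Y_def by measurable
  have pos: "0 \<le> X y" "0 \<le> Y y" for y by (auto simp: X_def Y_def)
  have pw: "f y * (indicator (- ball 0 1) (x - y) / norm (x - y) powr \<kappa>) \<le> X y + Y (x - y)" for x y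
  proof -
    have "f y = X y powr \<theta>" using nonneg \<theta> by (auto simp: X_def powr_powr)
    moreover have "indicator (- ball 0 1) (x - y) / norm (x - y) powr \<kappa> = Y (x - y) powr (1 - \<theta>)"
      using \<theta> by (auto simp: Y_def indicator_def powr_divide powr_powr)
    ultimately show ?thesis using weighted_product_le_sum[OF pos(1,2) \<theta>, of y "x - y"] by simp
  qed
  let ?X = "\<integral>\<^sup>+y. ennreal (X y) \<partial>lborel" and ?Y = "\<integral>\<^sup>+y. ennreal (Y y) \<partial>lborel"
  have Y: "?Y < \<infinity>"
  proof -
    have "ennreal (Y z) = indicator (- ball 0 1) z * ennreal (1 / norm z powr (\<kappa> / (1 - \<theta>)))" for z
      by (simp add: Y_def indicator_def)
    then show ?thesis
      using nn_integral_norm_powr_far[of "\<kappa> / (1 - \<theta>)", where 'a='a] \<kappa> by simp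
  qed
  have X: "?X < \<infinity>" using f by (simp add: X_def)
  have sym: "Y (x - y) = Y (y - x)" for x y by (simp add: Y_def norm_minus_commute indicator_def)
  have shift: "(\<integral>\<^sup>+y. ennreal (Y (x - y)) \<partial>lborel) = ?Y" for x
    unfolding sym[of x] using nn_integral_translate[of "\<lambda>y. ennreal (Y y)" "- x"] by simp
  have "(\<integral>\<^sup>+x. \<integral>\<^sup>+y. ennreal (f y * (indicator (- ball 0 1) (x - y) / norm (x - y) powr \<kappa>) * g x) \<partial>lborel \<partial>lborel)
    \<le> (\<integral>\<^sup>+x. \<integral>\<^sup>+y. (ennreal (X y) + ennreal (Y (x - y))) * ennreal (g x) \<partial>lborel \<partial>lborel)"
  proof (intro nn_integral_mono)
    fix x y
    show "ennreal (f y * (indicator (- ball 0 1) (x - y) / norm (x - y) powr \<kappa>) * g x)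
      \<le> (ennreal (X y) + ennreal (Y (x - y))) * ennreal (g x)"
      using mult_right_mono[OF pw[of y x] nonneg(2)[of x]] pos nonneg
      by (simp add: ennreal_mult[symmetric] ennreal_plus[symmetric] ennreal_leI del: ennreal_plus)
  qed
  also have "\<dots> = (\<integral>\<^sup>+x. (?X + ?Y) * ennreal (g x) \<partial>lborel)"
    by (simp add: nn_integral_multc nn_integral_add shift)
  also have "\<dots> = (?X + ?Y) * (\<integral>\<^sup>+x. ennreal (g x) \<partial>lborel)" by (rule nn_integral_cmult) measurable
  also have "\<dots> < \<infinity>" using X Y g by (simp add: ennreal_mult_less_top)
  finally show ?thesis .
qed

lemma riesz_energy_finite:
  fixes f g :: "'a::euclidean_space \<Rightarrow> real"
  assumes [measurable]: "f \<in> borel_measurable borel" "g \<in> borel_measurable borel"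
    and "\<And>x. 0 \<le> f x" "\<And>x. 0 \<le> g x"
    and "0 < \<theta>1" "0 < \<theta>2" "0 < \<theta>3" "\<theta>1 + \<theta>2 + \<theta>3 = 1"
    and "0 < \<kappa>" "\<kappa> / (\<theta>1 + \<theta>2) < real DIM('a)"
    and "(\<integral>\<^sup>+x. ennreal (f x powr (1 / (\<theta>1 + \<theta>3))) \<partial>lborel) < \<infinity>"
    and "(\<integral>\<^sup>+x. ennreal (g x powr (1 / (\<theta>2 + \<theta>3))) \<partial>lborel) < \<infinity>"
    and "0 < \<theta>" "\<theta> < 1" "real DIM('a) < \<kappa> / (1 - \<theta>)"
    and "(\<integral>\<^sup>+x. ennreal (f x powr (1 / \<theta>)) \<partial>lborel) < \<infinity>"
    and "(\<integral>\<^sup>+x. ennreal (g x) \<partial>lborel) < \<infinity>"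
  shows "(\<integral>\<^sup>+x. \<integral>\<^sup>+y. ennreal (f y * (1 / norm (x - y) powr \<kappa>) * g x) \<partial>lborel \<partial>lborel) < \<infinity>"
proof -
  have [measurable]: "ball (0::'a) 1 \<in> sets borel" "- ball (0::'a) 1 \<in> sets borel" by simp_all
  let ?N = "\<lambda>x y. f y * (indicator (ball 0 1) (x - y) / norm (x - y) powr \<kappa>) * g x"
  let ?F = "\<lambda>x y. f y * (indicator (- ball 0 1) (x - y) / norm (x - y) powr \<kappa>) * g x"
  have eq: "ennreal (f y * (1 / norm (x - y) powr \<kappa>) * g x) = ennreal (?N x y) + ennreal (?F x y)" for x y
    by (cases "x - y \<in> ball 0 1") auto
  have "(\<integral>\<^sup>+x. \<integral>\<^sup>+y. ennreal (f y * (1 / norm (x - y) powr \<kappa>) * g x) \<partial>lborel \<partial>lborel)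
    = (\<integral>\<^sup>+x. \<integral>\<^sup>+y. ennreal (?N x y) \<partial>lborel \<partial>lborel) + (\<integral>\<^sup>+x. \<integral>\<^sup>+y. ennreal (?F x y) \<partial>lborel \<partial>lborel)"
    unfolding eq by (subst nn_integral_add[symmetric]) (measurable, intro nn_integral_cong nn_integral_add, measurable)
  also have "\<dots> < \<infinity>"
    using riesz_energy_near_finite[of f g \<theta>1 \<theta>2 \<theta>3 \<kappa>] riesz_energy_far_finite[of f g \<theta> \<kappa>] assms
    by simp
  finally show ?thesis .
qed

section \<open>Truncated powers\<close>

lemma continuous_antiderivative:
  fixes f :: "real \<Rightarrow> real"
  assumes "continuous_on UNIV f"
  obtains F where "\<And>t. (F has_real_derivative f t) (at t)" "F 0 = 0"
proof -
  have "isCont f t" for t using assms by (simp add: continuous_on_eq_continuous_at)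
  then obtain F where F: "\<And>t. (F has_vector_derivative f t) (at t)"
    using einterval_antiderivative[of "-\<infinity>" "\<infinity>" f] by auto
  show ?thesis
    by (rule that[of "\<lambda>t. F t - F 0"])
       (auto intro!: derivative_eq_intros F[unfolded has_real_derivative_iff_has_vector_derivative[symmetric]])
qed

text \<open>
  The derivative of a function that behaves like \<open>\<bar>t\<bar>\<^sup>\<beta>\<close>. The cut at \<open>k\<close> makes it bounded, as
  the chain rule requires. It vanishes for \<open>\<bar>t\<bar> \<le> 1\<close>, so that lower powers of \<open>\<bar>u\<bar>\<close> can be
  estimated by higher ones wherever the test function is nonzero.
\<close>

definition trunc_weight :: "real \<Rightarrow> real \<Rightarrow> real \<Rightarrow> real" where
  "trunc_weight \<beta> k t = min k (max 0 (\<bar>t\<bar> - 1)) powr (\<beta> - 1)"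

lemma trunc_weight_continuous:
  assumes "\<beta> > 1" "k > 0"
  shows "continuous_on UNIV (trunc_weight \<beta> k)"
  unfolding trunc_weight_def[abs_def] using assms
  by (intro continuous_on_powr' continuous_intros) auto

lemma trunc_weight_bounds:
  assumes "\<beta> > 1" "k > 0"
  shows "0 \<le> trunc_weight \<beta> k t" "trunc_weight \<beta> k t \<le> k powr (\<beta> - 1)"
    "trunc_weight \<beta> k t \<le> max 0 (\<bar>t\<bar> - 1) powr (\<beta> - 1)"
  unfolding trunc_weight_def using assms by (auto intro!: powr_mono2)

text \<open>
  The Cauchy-Schwarz inequality on the interval between \<open>0\<close> and \<open>t\<close>: the function
  \<open>D s = \<integral>\<^sub>0\<^sup>s (h - c)\<^sup>2\<close> with \<open>c = H t / t\<close> is nondecreasing.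
\<close>

lemma primitive_square_le:
  fixes H G h :: "real \<Rightarrow> real"
  assumes H: "\<And>t. (H has_real_derivative h t) (at t)" "H 0 = 0"
    and G: "\<And>t. (G has_real_derivative (h t)\<^sup>2) (at t)" "G 0 = 0"
  shows "(H t)\<^sup>2 \<le> t * G t"
proof (cases "t = 0")
  case False
  define c where "c = H t / t"
  define D where "D = (\<lambda>s. G s - 2 * c * H s + c\<^sup>2 * s)"
  have der: "(D has_real_derivative (h s - c)\<^sup>2) (at s)" for s
    unfolding D_def by (auto intro!: derivative_eq_intros H G simp: power2_diff)
  have mono: "D a \<le> D b" if "a \<le> b" for a b
    using der by (intro DERIV_nonneg_imp_nondecreasing[OF that]) (metis zero_le_power2)
  have D0: "D 0 = 0" by (simp add: D_def H G)
  have Dt: "D t = G t - (H t)\<^sup>2 / t"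
    using False by (simp add: D_def c_def power2_eq_square field_simps)
  show ?thesis
  proof (cases "t > 0")
    case True
    then have "(H t)\<^sup>2 / t \<le> G t" using mono[of 0 t] D0 Dt by simp
    with True show ?thesis by (simp add: field_simps)
  next
    case f: False
    with False have "t < 0" by simp
    then have "G t \<le> (H t)\<^sup>2 / t" using mono[of t 0] D0 Dt by simp
    with \<open>t < 0\<close> show ?thesis by (simp add: field_simps)
  qed
qed (simp add: H)

text \<open>
  The mean value theorem on the upper half \<open>[(1 + t) / 2, t]\<close>, where the weight is at least its
  value at the left end.
\<close>

lemma trunc_weight_primitive_lower:
  assumes "\<beta> > 1" "k > 0" and H: "\<And>t. (H has_real_derivative trunc_weight \<beta> k t) (at t)" "H 0 = 0"
    and t: "3 \<le> t" "t \<le> k"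
  shows "(t / 3) powr \<beta> \<le> H t"
proof -
  have "H 0 \<le> H ((1 + t) / 2)"
    by (rule DERIV_nonneg_imp_nondecreasing) (use t H(1) trunc_weight_bounds(1)[OF assms(1,2)] in \<open>auto intro!: exI\<close>)
  moreover obtain \<xi> where \<xi>: "(1 + t) / 2 < \<xi>" "\<xi> < t" "H t - H ((1 + t) / 2) = (t - (1 + t) / 2) * trunc_weight \<beta> k \<xi>"
    using MVT2[of "(1 + t) / 2" t H "trunc_weight \<beta> k"] H(1) t by auto
  moreover have "trunc_weight \<beta> k \<xi> \<ge> (t / 3) powr (\<beta> - 1)"
    unfolding trunc_weight_def using \<xi> t assms(1) by (intro powr_mono2) auto
  then have "(t / 3) * (t / 3) powr (\<beta> - 1) \<le> (t - (1 + t) / 2) * trunc_weight \<beta> k \<xi>"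
    using t by (intro mult_mono) auto
  moreover have "(t / 3) * (t / 3) powr (\<beta> - 1) = (t / 3) powr \<beta>"
    using t powr_add[of "t / 3" 1 "\<beta> - 1"] by simp
  ultimately show ?thesis using H(2) by linarith
qed

text \<open>
  The test function \<open>G u\<close> and the function \<open>H u\<close> whose \<open>H1\<close> norm it controls. The bound on
  \<open>G\<close> does not involve \<open>k\<close>, and the lower bound on \<open>H\<close> covers every \<open>t\<close> once \<open>k\<close> is large.
\<close>

lemma truncated_power_functions:
  fixes \<beta> k :: real
  assumes \<beta>: "\<beta> > 1" and k: "k > 0"
  obtains H H' G :: "real \<Rightarrow> real" where
    "\<And>t. (H has_real_derivative H' t) (at t)" "\<And>t. (G has_real_derivative (H' t)\<^sup>2) (at t)"
    "continuous_on UNIV H'" "\<And>t. \<bar>H' t\<bar> \<le> k powr (\<beta> - 1)" "H 0 = 0" "G 0 = 0"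
    "\<And>t. (H t)\<^sup>2 \<le> t * G t"
    "\<And>t. \<bar>G t\<bar> \<le> (if \<bar>t\<bar> > 1 then \<bar>t\<bar> powr (2 * \<beta> - 1) else 0)"
    "\<And>t. 3 \<le> \<bar>t\<bar> \<Longrightarrow> \<bar>t\<bar> \<le> k \<Longrightarrow> (\<bar>t\<bar> / 3) powr \<beta> \<le> \<bar>H t\<bar>"
proof -
  let ?h = "trunc_weight \<beta> k"
  note cont = trunc_weight_continuous[OF assms]
  obtain H where H: "\<And>t. (H has_real_derivative ?h t) (at t)" "H 0 = 0"
    using continuous_antiderivative[OF cont] by metis
  have "continuous_on UNIV (\<lambda>t. (?h t)\<^sup>2)" using cont by (intro continuous_intros)
  from continuous_antiderivative[OF this] obtain G
    where G: "\<And>t. (G has_real_derivative (?h t)\<^sup>2) (at t)" "G 0 = 0" by metis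
  show ?thesis
  proof (rule that[OF H(1) G(1) cont _ H(2) G(2) primitive_square_le[OF H G]])
    show "\<bar>?h t\<bar> \<le> k powr (\<beta> - 1)" for t using trunc_weight_bounds[OF assms, of t] by simp
    show "\<bar>G t\<bar> \<le> (if \<bar>t\<bar> > 1 then \<bar>t\<bar> powr (2 * \<beta> - 1) else 0)" for t
    proof -
      obtain \<xi> where \<xi>: "\<bar>\<xi>\<bar> \<le> \<bar>t\<bar>" "G t = t * (?h \<xi>)\<^sup>2"
      proof (cases t "0 :: real" rule: linorder_cases)
        case less
        from MVT2[OF this G(1)] obtain \<xi> where "t < \<xi>" "\<xi> < 0" "G 0 - G t = (0 - t) * (?h \<xi>)\<^sup>2" by blast
        then show ?thesis using that[of \<xi>] G(2) by simp
      next
        case equal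
        then show ?thesis using that[of 0] G(2) by simp
      next
        case greater
        from MVT2[OF this G(1)] obtain \<xi> where "0 < \<xi>" "\<xi> < t" "G t - G 0 = (t - 0) * (?h \<xi>)\<^sup>2" by blast
        then show ?thesis using that[of \<xi>] G(2) by simp
      qed
      have "?h \<xi> \<le> max 0 (\<bar>t\<bar> - 1) powr (\<beta> - 1)"
        using trunc_weight_bounds(3)[OF assms, of \<xi>] \<xi>(1) \<beta> by (elim order_trans) (auto intro!: powr_mono2)
      then have le: "\<bar>G t\<bar> \<le> \<bar>t\<bar> * (max 0 (\<bar>t\<bar> - 1) powr (\<beta> - 1))\<^sup>2"
        unfolding \<xi>(2) abs_mult using trunc_weight_bounds(1)[OF assms, of \<xi>]
        by (intro mult_left_mono) (auto intro!: power_mono)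
      show ?thesis
      proof (cases "\<bar>t\<bar> > 1")
        case True
        have "max 0 (\<bar>t\<bar> - 1) powr (\<beta> - 1) \<le> \<bar>t\<bar> powr (\<beta> - 1)"
          using \<beta> by (intro powr_mono2) auto
        then have "\<bar>t\<bar> * (max 0 (\<bar>t\<bar> - 1) powr (\<beta> - 1))\<^sup>2 \<le> \<bar>t\<bar> * (\<bar>t\<bar> powr (\<beta> - 1))\<^sup>2"
          by (intro mult_left_mono power_mono) auto
        also have "\<dots> = \<bar>t\<bar> powr 1 * (\<bar>t\<bar> powr (\<beta> - 1) * \<bar>t\<bar> powr (\<beta> - 1))"
          by (simp add: power2_eq_square)
        also have "\<dots> = \<bar>t\<bar> powr (2 * \<beta> - 1)" unfolding powr_add[symmetric] by simp
        finally show ?thesis using le True by simp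
      next
        case False
        then show ?thesis using le by simp
      qed
    qed
    show "(\<bar>t\<bar> / 3) powr \<beta> \<le> \<bar>H t\<bar>" if "3 \<le> \<bar>t\<bar>" "\<bar>t\<bar> \<le> k" for t
    proof (cases "t > 0")
      case True
      then show ?thesis using trunc_weight_primitive_lower[OF assms H, of t] that by simp
    next
      case False
      have even: "?h (- s) = ?h s" for s by (simp add: trunc_weight_def)
      \<comment> \<open>The weight is even, so the reflected primitive is covered by the case of positive arguments.\<close>
      have "((\<lambda>s. - H (- s)) has_real_derivative ?h s) (at s)" for s
        using DERIV_minus[OF DERIV_mirror[THEN iffD1, OF H(1)[of "- s"]]] by (simp add: even)
      from trunc_weight_primitive_lower[OF assms this, of "- t"] False that H(2) show ?thesis by simp
    qed
  qed
qed

section \<open>Borel representatives\<close>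

text \<open>
  Preimages under the two functions differ by null sets, and \<open>lebesgue\<close> is complete.
\<close>

lemma lebesgue_measurable_of_AE_borel:
  fixes f f' :: "'a::euclidean_space \<Rightarrow> real"
  assumes [measurable]: "f' \<in> borel_measurable borel" and ae: "AE x in lborel. f x = f' x"
  shows "f \<in> borel_measurable lebesgue"
proof (rule measurableI)
  fix A :: "real set" assume [measurable]: "A \<in> sets borel"
  have "f' -` A \<in> sets borel" using measurable_sets[OF assms(1), of A] by simp
  then have 1: "f' -` A \<in> sets lebesgue" by (metis sets_completionI_sets sets_lborel)
  have "AE x in lebesgue. f x = f' x" by (rule AE_completion[OF ae])
  then have "AE x in lebesgue. x \<in> f' -` A \<longleftrightarrow> x \<in> f -` A" by eventually_elim simp
  from completion.in_sets_AE[OF this 1] show "f -` A \<inter> space lebesgue \<in> sets lebesgue" by simp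
qed simp

lemma
  fixes f f' :: "'a::euclidean_space \<Rightarrow> real"
  assumes [measurable]: "f' \<in> borel_measurable borel" and ae: "AE x in lborel. f x = f' x"
  shows lebesgue_integral_eq_lborel: "(LINT x|lebesgue. f x) = (LINT x|lborel. f' x)"
    and lebesgue_integrable_iff_lborel: "integrable lebesgue f \<longleftrightarrow> integrable lborel f'"
proof -
  have f': "f' \<in> borel_measurable lborel" by simp
  have [measurable]: "f \<in> borel_measurable lebesgue" by (rule lebesgue_measurable_of_AE_borel[OF assms])
  have [measurable]: "f' \<in> borel_measurable lebesgue" by (rule measurable_completion[OF f'])
  have AE: "AE x in lebesgue. f x = f' x" by (rule AE_completion[OF ae])
  show "(LINT x|lebesgue. f x) = (LINT x|lborel. f' x)"
    unfolding integral_completion[OF f', symmetric] by (rule integral_cong_AE[OF _ _ AE]) measurable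
  show "integrable lebesgue f \<longleftrightarrow> integrable lborel f'"
    unfolding integrable_completion[OF f', symmetric] by (rule integrable_cong_AE[OF _ _ AE]) measurable
qed

lemma nn_integral_lebesgue_eq_lborel:
  fixes f f' :: "'a::euclidean_space \<Rightarrow> ennreal"
  assumes "AE x in lborel. f x = f' x"
  shows "(\<integral>\<^sup>+x. f x \<partial>lebesgue) = (\<integral>\<^sup>+x. f' x \<partial>lborel)"
  unfolding nn_integral_completion by (rule nn_integral_cong_AE[OF assms])

lemma Lp_real_iff:
  fixes f f' :: "'a::euclidean_space \<Rightarrow> real"
  assumes [measurable]: "f' \<in> borel_measurable borel" and ae: "AE x in lborel. f x = f' x"
  shows "f \<in> Lp q \<longleftrightarrow> (\<integral>\<^sup>+x. ennreal (\<bar>f' x\<bar> powr q) \<partial>lborel) < \<infinity>"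
proof -
  have "integrable lebesgue (\<lambda>x. norm (f x) powr q) \<longleftrightarrow> integrable lborel (\<lambda>x. \<bar>f' x\<bar> powr q)"
    using ae by (intro lebesgue_integrable_iff_lborel) auto
  then show ?thesis
    using lebesgue_measurable_of_AE_borel[OF assms] by (simp add: Lp_def integrable_iff_bounded)
qed

lemma Lp_2_iff_square_integrable:
  fixes f f' :: "'a::euclidean_space \<Rightarrow> real"
  assumes "f' \<in> borel_measurable borel" "AE x in lborel. f x = f' x"
  shows "f \<in> Lp 2 \<longleftrightarrow> square_integrable f'"
  using Lp_real_iff[OF assms, of 2] assms(1) by (simp add: square_integrable_iff)

lemma borel_representative:
  fixes f :: "'a::euclidean_space \<Rightarrow> real"
  assumes "f \<in> borel_measurable lebesgue"
  obtains f' where "f' \<in> borel_measurable borel" "AE x in lborel. f x = f' x"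
  using completion_ex_borel_measurable_real[OF assms] by (auto simp: measurable_lborel2)

lemma Lp_2_component:
  fixes g :: "'a::euclidean_space \<Rightarrow> real ^ 'n"
  assumes "g \<in> Lp 2"
  shows "(\<lambda>x. g x $ i) \<in> Lp 2"
proof -
  have g: "g \<in> borel_measurable lebesgue" "integrable lebesgue (\<lambda>x. (norm (g x))\<^sup>2)"
    using assms by (auto simp: Lp_def)
  have m: "(\<lambda>x. g x $ i) \<in> borel_measurable lebesgue"
    using g(1) by (rule measurable_compose) (intro borel_measurable_continuous_onI continuous_intros)
  have "integrable lebesgue (\<lambda>x. (g x $ i)\<^sup>2)"
  proof (rule Bochner_Integration.integrable_bound[OF g(2)])
    show "AE x in lebesgue. norm ((g x $ i)\<^sup>2) \<le> norm ((norm (g x))\<^sup>2)"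
      using power_mono[OF component_le_norm_cart abs_ge_zero, of _ _ 2] by (intro AE_I2) simp
  qed (use m in measurable)
  with m show ?thesis by (simp add: Lp_def)
qed

text \<open>
  The representative \<open>u'\<close> is prescribed, so that the derivatives of one function obtained from
  different sources can be compared by uniqueness.
\<close>

lemma weak_gradient_representative:
  fixes u :: "real ^ 'n \<Rightarrow> real"
  assumes u: "u \<in> Lp 2" "u' \<in> borel_measurable borel" "AE x in lborel. u x = u' x"
    and g: "g \<in> Lp 2" "is_weak_gradient u g"
  obtains g' where "\<And>i. weak_dir_deriv (axis i 1) u' (g' i)" "\<And>i. AE x in lborel. g x $ i = g' i x"
proof -
  have "\<exists>h. h \<in> borel_measurable borel \<and> (AE x in lborel. g x $ i = h x)" for i
    using borel_representative[of "\<lambda>x. g x $ i"] Lp_2_component[OF g(1), of i] by (auto simp: Lp_def)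
  then obtain g' where g': "\<And>i. g' i \<in> borel_measurable borel" "\<And>i. AE x in lborel. g x $ i = g' i x"
    by metis
  note [measurable] = u(2) g'(1)
  have "weak_dir_deriv (axis i 1) u' (g' i)" for i
    unfolding weak_dir_deriv_def
  proof (intro conjI ballI)
    show "square_integrable u'" using Lp_2_iff_square_integrable[OF u(2,3)] u(1) by simp
    show "square_integrable (g' i)"
      using Lp_2_iff_square_integrable[OF g'(1,2)] Lp_2_component[OF g(1)] by simp
    fix \<phi> :: "real ^ 'n \<Rightarrow> real" assume \<phi>: "\<phi> \<in> test_functions"
    note [measurable] = test_borel[OF \<phi>]
    have "(LINT x|lebesgue. u x * partial_deriv i \<phi> x) = (LINT x|lborel. u' x * frechet_derivative \<phi> (at x) (axis i 1))"
      using u(3) by (intro lebesgue_integral_eq_lborel) (auto simp: partial_deriv_def)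
    moreover have "(LINT x|lebesgue. g x $ i * \<phi> x) = (LINT x|lborel. g' i x * \<phi> x)"
      using g'(2)[of i] by (intro lebesgue_integral_eq_lborel) auto
    ultimately show "(LINT x|lborel. u' x * frechet_derivative \<phi> (at x) (axis i 1)) = - (LINT x|lborel. g' i x * \<phi> x)"
      using g(2) \<phi> by (auto simp: is_weak_gradient_def)
  qed
  with g'(2) show ?thesis by (intro that)
qed

lemma is_weak_gradientI:
  fixes v :: "real ^ 'n \<Rightarrow> real"
  assumes v: "AE x in lborel. v x = v' x"
    and h: "\<And>i. weak_dir_deriv (axis i 1) v' (h' i)" "\<And>i. AE x in lborel. h x $ i = h' i x"
  shows "is_weak_gradient v h"
  unfolding is_weak_gradient_def
proof (intro ballI allI)
  fix \<phi> :: "real ^ 'n \<Rightarrow> real" and i assume \<phi>: "\<phi> \<in> test_functions"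
  note [measurable] = test_borel[OF \<phi>]
  note wd = weak_dir_derivD[OF h(1)]
  have [measurable]: "v' \<in> borel_measurable borel" "h' i \<in> borel_measurable borel" for i
    using wd(1,2) by measurable
  have "(LINT x|lebesgue. v x * partial_deriv i \<phi> x) = (LINT x|lborel. v' x * frechet_derivative \<phi> (at x) (axis i 1))"
    using v by (intro lebesgue_integral_eq_lborel) (auto simp: partial_deriv_def)
  also have "\<dots> = - (LINT x|lborel. h' i x * \<phi> x)" by (rule wd(3)[OF \<phi>])
  also have "(LINT x|lborel. h' i x * \<phi> x) = (LINT x|lebesgue. h x $ i * \<phi> x)"
    using h(2)[of i] by (intro lebesgue_integral_eq_lborel[symmetric]) auto
  finally show "(LINT x|lebesgue. v x * partial_deriv i \<phi> x) = - (LINT x|lebesgue. h x $ i * \<phi> x)" .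
qed

lemma weak_grad_in:
  assumes "v \<in> H1"
  shows "weak_grad v \<in> Lp 2" "is_weak_gradient v (weak_grad v)"
proof -
  have "\<exists>g. g \<in> Lp 2 \<and> is_weak_gradient v g" using assms by (auto simp: H1_def)
  from someI_ex[OF this] show "weak_grad v \<in> Lp 2" "is_weak_gradient v (weak_grad v)"
    by (auto simp: weak_grad_def)
qed

text \<open>
  \<open>weak_grad\<close> is an arbitrary choice, so its value on the composition is known only through the
  uniqueness of weak derivatives.
\<close>

lemma H1_composition:
  fixes u :: "real ^ 'n \<Rightarrow> real"
  assumes u: "u \<in> H1" "u' \<in> borel_measurable borel" "AE x in lborel. u x = u' x"
    and g': "\<And>i. weak_dir_deriv (axis i 1) u' (g' i)" "\<And>i. AE x in lborel. weak_grad u x $ i = g' i x"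
    and G: "\<And>t. (G has_real_derivative G' t) (at t)" "continuous_on UNIV G'" "\<And>t. \<bar>G' t\<bar> \<le> L" "G 0 = 0"
  shows "(\<lambda>x. G (u x)) \<in> H1"
    and "AE x in lborel. weak_grad (\<lambda>x. G (u x)) x $ i = G' (u' x) * g' i x"
proof -
  let ?v = "\<lambda>x. G (u x)" and ?v' = "\<lambda>x. G (u' x)"
  have chain: "weak_dir_deriv (axis i 1) ?v' (\<lambda>x. G' (u' x) * g' i x)" for i
    by (rule weak_dir_deriv_chain[OF g'(1) G])
  have sq: "square_integrable ?v'" using weak_dir_derivD(1)[OF chain] .
  then have v': "?v' \<in> borel_measurable borel" by measurable
  have ae: "AE x in lborel. ?v x = ?v' x" using u(3) by eventually_elim simp
  have v: "?v \<in> Lp 2" using Lp_2_iff_square_integrable[OF v' ae] sq by simp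
  let ?h = "\<lambda>x. G' (u x) *\<^sub>R weak_grad u x"
  have "is_weak_gradient ?v ?h"
  proof (rule is_weak_gradientI[OF ae chain])
    show "AE x in lborel. ?h x $ i = G' (u' x) * g' i x" for i
      using u(3) g'(2)[of i] by eventually_elim simp
  qed
  moreover have "?h \<in> Lp 2"
  proof -
    have w: "weak_grad u \<in> borel_measurable lebesgue" "integrable lebesgue (\<lambda>x. (norm (weak_grad u x))\<^sup>2)"
      using weak_grad_in(1)[OF u(1)] by (auto simp: Lp_def)
    have "u \<in> borel_measurable lebesgue" by (rule lebesgue_measurable_of_AE_borel[OF u(2,3)])
    then have G'u: "(\<lambda>x. G' (u x)) \<in> borel_measurable lebesgue"
      by (rule measurable_compose[OF _ borel_measurable_continuous_onI[OF G(2)]])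
    have m: "?h \<in> borel_measurable lebesgue" by (intro borel_measurable_scaleR G'u w)
    have "integrable lebesgue (\<lambda>x. L\<^sup>2 * (norm (weak_grad u x))\<^sup>2)" using w(2) by simp
    then have "integrable lebesgue (\<lambda>x. (norm (?h x))\<^sup>2)"
    proof (rule Bochner_Integration.integrable_bound)
      have "(norm (?h x))\<^sup>2 \<le> L\<^sup>2 * (norm (weak_grad u x))\<^sup>2" for x
        using power_mono[OF G(3)[of "u x"], of 2]
        by (simp add: power_mult_distrib mult_right_mono)
      then show "AE x in lebesgue. norm ((norm (?h x))\<^sup>2) \<le> norm (L\<^sup>2 * (norm (weak_grad u x))\<^sup>2)"
        by (intro AE_I2) simp
    qed (use m in measurable)
    with m show ?thesis by (simp add: Lp_def)
  qed
  ultimately show H1: "?v \<in> H1" using v by (auto simp: H1_def)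
  obtain h' where h': "\<And>i. weak_dir_deriv (axis i 1) ?v' (h' i)" "\<And>i. AE x in lborel. weak_grad ?v x $ i = h' i x"
    by (rule weak_gradient_representative[OF v v' ae weak_grad_in[OF H1]]) blast
  show "AE x in lborel. weak_grad ?v x $ i = G' (u' x) * g' i x"
    using weak_dir_deriv_unique[OF h'(1) chain, of i] h'(2)[of i] by eventually_elim simp
qed

section \<open>Testing the equation\<close>

text \<open>
  A Bochner integral that does not exist is \<open>0\<close>, so that the bound holds in this case as well. It
  applies to the convolution and to the right-hand side of the equation.
\<close>

lemma ennreal_integral_le_nn_integral:
  fixes f :: "'a \<Rightarrow> real"
  assumes "\<And>x. 0 \<le> f x"
  shows "ennreal (integral\<^sup>L M f) \<le> (\<integral>\<^sup>+x. ennreal (f x) \<partial>M)"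
proof (cases "integrable M f")
  case True
  then show ?thesis using assms by (simp add: nn_integral_eq_integral)
next
  case False
  then show ?thesis by (simp add: not_integrable_integral_eq)
qed

lemma frac_form_nonneg:
  fixes u v :: "real ^ 'n \<Rightarrow> real"
  assumes "\<And>x y. 0 \<le> (u x - u y) * (v x - v y)"
  shows "0 \<le> frac_form s u v"
proof -
  have "0 \<le> frac_const TYPE('n) s"
    unfolding frac_const_def by (auto intro!: integral_nonneg_AE divide_nonneg_nonneg simp: cos_le_one)
  then show ?thesis
    unfolding frac_form_def using assms
    by (auto intro!: mult_nonneg_nonneg integral_nonneg_AE AE_I2 divide_nonneg_nonneg)
qed

lemma riesz_const_pos: "0 < \<alpha> \<Longrightarrow> \<alpha> < real n \<Longrightarrow> 0 < riesz_const n \<alpha>"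
  unfolding riesz_const_def by (auto intro!: divide_pos_pos mult_pos_pos Gamma_real_pos)

text \<open>
  Since \<open>t\<close> and \<open>G t\<close> have the same sign, the nonlinearity times the test function is
  \<open>\<bar>u\<bar>\<^bsup>p-1\<^esup> \<bar>G(u)\<bar>\<close>, so that all integrands are nonnegative.
\<close>

lemma riesz_term_bound:
  fixes u :: "real ^ 'n \<Rightarrow> real" and \<alpha> :: real
  defines "\<kappa> \<equiv> real CARD('n) - \<alpha>" and "c \<equiv> riesz_const CARD('n) \<alpha>"
  assumes \<alpha>: "0 < \<alpha>" "\<alpha> < real CARD('n)"
    and u': "u' \<in> borel_measurable borel" "AE x in lborel. u x = u' x"
    and G: "G \<in> borel_measurable borel" "\<And>t. 0 \<le> t * G t"
    and e: "0 \<le> e" "(\<integral>\<^sup>+x. \<integral>\<^sup>+y. ennreal (\<bar>u' y\<bar> powr p * (1 / norm (x - y) powr \<kappa>) * (\<bar>u' x\<bar> powr (p - 1) * \<bar>G (u' x)\<bar>)) \<partial>lborel \<partial>lborel) \<le> ennreal e"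
  shows "(LINT x|lebesgue. convolution (riesz_potential \<alpha>) (\<lambda>y. \<bar>u y\<bar> powr p) x * \<bar>u x\<bar> powr (p - 2) * u x * G (u x)) \<le> c * e"
proof -
  note [measurable] = u'(1) G(1)
  have c: "c > 0" unfolding c_def by (rule riesz_const_pos[OF \<alpha>])
  let ?C = "convolution (riesz_potential \<alpha>) (\<lambda>y. \<bar>u y\<bar> powr p)"
  let ?R = "\<lambda>x. ?C x * \<bar>u x\<bar> powr (p - 2) * u x * G (u x)"
  let ?K = "\<lambda>x. \<integral>\<^sup>+y. ennreal (\<bar>u' y\<bar> powr p * (1 / norm (x - y) powr \<kappa>)) \<partial>lborel"
  have C: "0 \<le> ?C x" "ennreal (?C x) \<le> ennreal c * ?K x" for x
  proof -
    have pos: "0 \<le> riesz_potential \<alpha> (x - y) * \<bar>u y\<bar> powr p" for y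
      using c by (auto simp: riesz_potential_def c_def)
    then show "0 \<le> ?C x" unfolding convolution_def by (intro integral_nonneg_AE AE_I2)
    have "ennreal (?C x) \<le> (\<integral>\<^sup>+y. ennreal (riesz_potential \<alpha> (x - y) * \<bar>u y\<bar> powr p) \<partial>lebesgue)"
      unfolding convolution_def by (rule ennreal_integral_le_nn_integral[OF pos])
    also have "\<dots> = (\<integral>\<^sup>+y. ennreal c * ennreal (\<bar>u' y\<bar> powr p * (1 / norm (x - y) powr \<kappa>)) \<partial>lborel)"
    proof (rule nn_integral_lebesgue_eq_lborel)
      show "AE y in lborel. ennreal (riesz_potential \<alpha> (x - y) * \<bar>u y\<bar> powr p)
          = ennreal c * ennreal (\<bar>u' y\<bar> powr p * (1 / norm (x - y) powr \<kappa>))"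
        using u'(2) by eventually_elim
          (use c in \<open>simp add: riesz_potential_def c_def \<kappa>_def ennreal_mult[symmetric] mult_ac\<close>)
    qed
    also have "\<dots> = ennreal c * ?K x" by (rule nn_integral_cmult) measurable
    finally show "ennreal (?C x) \<le> ennreal c * ?K x" .
  qed
  have factor: "\<bar>t\<bar> powr (p - 2) * t * G t = \<bar>t\<bar> powr (p - 1) * \<bar>G t\<bar>" for t
  proof (cases "t = 0")
    case False
    have "t * G t = \<bar>t\<bar> * \<bar>G t\<bar>" using G(2)[of t] by (metis abs_mult abs_of_nonneg)
    moreover have "\<bar>t\<bar> powr (p - 1) = \<bar>t\<bar> powr (p - 2) * \<bar>t\<bar>"
      using False powr_add[of "\<bar>t\<bar>" "p - 2" 1] by simp
    ultimately show ?thesis by (simp add: mult.assoc)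
  qed simp
  have R: "?R x = ?C x * (\<bar>u x\<bar> powr (p - 1) * \<bar>G (u x)\<bar>)" for x
    using factor[of "u x"] by (simp add: mult.assoc)
  have "ennreal (LINT x|lebesgue. ?R x) \<le> (\<integral>\<^sup>+x. ennreal (?R x) \<partial>lebesgue)"
    using C(1) by (intro ennreal_integral_le_nn_integral) (simp add: R)
  also have "\<dots> \<le> (\<integral>\<^sup>+x. ennreal c * (?K x * ennreal (\<bar>u x\<bar> powr (p - 1) * \<bar>G (u x)\<bar>)) \<partial>lebesgue)"
  proof (rule nn_integral_mono)
    fix x
    have "ennreal (?R x) = ennreal (?C x) * ennreal (\<bar>u x\<bar> powr (p - 1) * \<bar>G (u x)\<bar>)"
      unfolding R by (rule ennreal_mult) (simp_all add: C(1))
    also have "\<dots> \<le> (ennreal c * ?K x) * ennreal (\<bar>u x\<bar> powr (p - 1) * \<bar>G (u x)\<bar>)"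
      by (intro mult_right_mono C(2)) simp
    finally show "ennreal (?R x) \<le> ennreal c * (?K x * ennreal (\<bar>u x\<bar> powr (p - 1) * \<bar>G (u x)\<bar>))"
      by (simp only: mult.assoc)
  qed
  also have "\<dots> = (\<integral>\<^sup>+x. ennreal c * (?K x * ennreal (\<bar>u' x\<bar> powr (p - 1) * \<bar>G (u' x)\<bar>)) \<partial>lborel)"
  proof (rule nn_integral_lebesgue_eq_lborel)
    show "AE x in lborel. ennreal c * (?K x * ennreal (\<bar>u x\<bar> powr (p - 1) * \<bar>G (u x)\<bar>))
      = ennreal c * (?K x * ennreal (\<bar>u' x\<bar> powr (p - 1) * \<bar>G (u' x)\<bar>))"
      using u'(2) by eventually_elim simp
  qed
  also have "\<dots> = ennreal c * (\<integral>\<^sup>+x. ?K x * ennreal (\<bar>u' x\<bar> powr (p - 1) * \<bar>G (u' x)\<bar>) \<partial>lborel)"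
    by (rule nn_integral_cmult) measurable
  also have "(\<integral>\<^sup>+x. ?K x * ennreal (\<bar>u' x\<bar> powr (p - 1) * \<bar>G (u' x)\<bar>) \<partial>lborel)
    = (\<integral>\<^sup>+x. \<integral>\<^sup>+y. ennreal (\<bar>u' y\<bar> powr p * (1 / norm (x - y) powr \<kappa>) * (\<bar>u' x\<bar> powr (p - 1) * \<bar>G (u' x)\<bar>)) \<partial>lborel \<partial>lborel)"
  proof (rule nn_integral_cong)
    fix x
    have "?K x * ennreal (\<bar>u' x\<bar> powr (p - 1) * \<bar>G (u' x)\<bar>)
      = (\<integral>\<^sup>+y. ennreal (\<bar>u' y\<bar> powr p * (1 / norm (x - y) powr \<kappa>)) * ennreal (\<bar>u' x\<bar> powr (p - 1) * \<bar>G (u' x)\<bar>) \<partial>lborel)"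
      by (rule nn_integral_multc[symmetric]) measurable
    also have "\<dots> = (\<integral>\<^sup>+y. ennreal (\<bar>u' y\<bar> powr p * (1 / norm (x - y) powr \<kappa>) * (\<bar>u' x\<bar> powr (p - 1) * \<bar>G (u' x)\<bar>)) \<partial>lborel)"
      by (intro nn_integral_cong ennreal_mult[symmetric]) auto
    finally show "?K x * ennreal (\<bar>u' x\<bar> powr (p - 1) * \<bar>G (u' x)\<bar>)
      = (\<integral>\<^sup>+y. ennreal (\<bar>u' y\<bar> powr p * (1 / norm (x - y) powr \<kappa>) * (\<bar>u' x\<bar> powr (p - 1) * \<bar>G (u' x)\<bar>)) \<partial>lborel)" .
  qed
  also have "ennreal c * \<dots> \<le> ennreal c * ennreal e"
    by (intro mult_left_mono e) simp
  also have "\<dots> = ennreal (c * e)" using c e by (simp add: ennreal_mult)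
  finally show ?thesis using c e by (simp add: ennreal_le_iff)
qed

text \<open>
  The equation tested with \<open>G(u)\<close>: since \<open>G' = H'\<^sup>2\<close>, the gradient term is the square of the
  gradient of \<open>H(u)\<close>, the term of order zero dominates \<open>H(u)\<^sup>2\<close> by
  \<open>primitive_square_le\<close>, and the fractional form is nonnegative because \<open>G\<close> is monotone.
\<close>

lemma weak_solution_energy:
  fixes u :: "real ^ 'n \<Rightarrow> real" and \<alpha> :: real
  defines "\<kappa> \<equiv> real CARD('n) - \<alpha>" and "c \<equiv> riesz_const CARD('n) \<alpha>"
  assumes ws: "weak_solution \<alpha> s l \<mu> \<tau> p u" and par: "0 \<le> l" "0 \<le> \<mu>"
    and \<alpha>: "0 < \<alpha>" "\<alpha> < real CARD('n)"
    and u': "u' \<in> borel_measurable borel" "AE x in lborel. u x = u' x"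
    and g': "\<And>i. weak_dir_deriv (axis i 1) u' (g' i)" "\<And>i. AE x in lborel. weak_grad u x $ i = g' i x"
    and H: "\<And>t. (H has_real_derivative H' t) (at t)" "continuous_on UNIV H'" "\<And>t. \<bar>H' t\<bar> \<le> L" "H 0 = 0"
    and G: "\<And>t. (G has_real_derivative (H' t)\<^sup>2) (at t)" "G 0 = 0"
    and e: "0 \<le> e" "(\<integral>\<^sup>+x. \<integral>\<^sup>+y. ennreal (\<bar>u' y\<bar> powr p * (1 / norm (x - y) powr \<kappa>) * (\<bar>u' x\<bar> powr (p - 1) * \<bar>G (u' x)\<bar>)) \<partial>lborel \<partial>lborel) \<le> ennreal e"
  shows "(LINT x|lborel. (\<Sum>i\<in>UNIV. (H' (u' x) * g' i x)\<^sup>2)) + (LINT x|lborel. (H (u' x))\<^sup>2) \<le> \<mu> * (c * e)"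
proof -
  have uH: "u \<in> H1" using ws by (simp add: weak_solution_def)
  have G'b: "continuous_on UNIV (\<lambda>t. (H' t)\<^sup>2)" "\<bar>(H' t)\<^sup>2\<bar> \<le> L\<^sup>2" for t
    using H(2) power_mono[OF H(3)[of t], of 2] by (auto intro!: continuous_intros)
  note v = H1_composition[OF uH u' g' G(1) G'b G(2)]
  let ?v = "\<lambda>x. G (u x)"
  have mono: "G a \<le> G b" if "a \<le> b" for a b
    by (rule DERIV_nonneg_imp_nondecreasing[OF that]) (use G(1) in \<open>auto intro!: exI\<close>)
  have frac: "0 \<le> l * frac_form s u ?v"
  proof (rule mult_nonneg_nonneg[OF par(1) frac_form_nonneg])
    show "0 \<le> (u x - u y) * (G (u x) - G (u y))" for x y
      using mono[of "u x" "u y"] mono[of "u y" "u x"] by (cases "u x \<le> u y") (auto simp: zero_le_mult_iff)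
  qed
  have HG: "(H t)\<^sup>2 \<le> t * G t" for t by (rule primitive_square_le[OF H(1,4) G])
  have GH1: "weak_dir_deriv (axis i 1) (\<lambda>x. G (u' x)) (\<lambda>x. (H' (u' x))\<^sup>2 * g' i x)"
    and HH1: "weak_dir_deriv (axis i 1) (\<lambda>x. H (u' x)) (\<lambda>x. H' (u' x) * g' i x)" for i
    by (rule weak_dir_deriv_chain[OF g'(1) G(1) G'b G(2)], rule weak_dir_deriv_chain[OF g'(1) H])
  note sq = weak_dir_derivD(1,2)[OF g'(1)] weak_dir_derivD(1,2)[OF GH1] weak_dir_derivD(1,2)[OF HH1]
  have [measurable]: "u' \<in> borel_measurable borel" "\<And>i. g' i \<in> borel_measurable borel" using sq(1,2) by measurable
  have [measurable]: "H' \<in> borel_measurable borel" by (rule borel_measurable_continuous_onI[OF H(2)])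
  have [measurable]: "G \<in> borel_measurable borel"
    using G(1) by (intro borel_measurable_continuous_onI) (auto simp: continuous_on_eq_continuous_at intro: DERIV_isCont)
  have grad: "(LINT x|lebesgue. weak_grad u x \<bullet> weak_grad ?v x) = (LINT x|lborel. (\<Sum>i\<in>UNIV. (H' (u' x) * g' i x)\<^sup>2))"
  proof (rule lebesgue_integral_eq_lborel)
    have "AE x in lborel. \<forall>i. weak_grad u x $ i = g' i x" "AE x in lborel. \<forall>i. weak_grad ?v x $ i = (H' (u' x))\<^sup>2 * g' i x"
      using g'(2) v(2) by (simp_all add: AE_all_countable)
    then show "AE x in lborel. weak_grad u x \<bullet> weak_grad ?v x = (\<Sum>i\<in>UNIV. (H' (u' x) * g' i x)\<^sup>2)"
      by eventually_elim (simp add: inner_vec_def power_mult_distrib power2_eq_square mult_ac)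
  qed measurable
  have "(LINT x|lborel. (H (u' x))\<^sup>2) \<le> (LINT x|lborel. u' x * G (u' x))"
    using sq(5) square_integrable_mult[OF sq(1,3)] by (intro integral_mono HG) (auto simp: square_integrable_def)
  also have "\<dots> = (LINT x|lebesgue. u x * G (u x))"
    using u'(2) by (intro lebesgue_integral_eq_lborel[symmetric]) auto
  finally have L2: "(LINT x|lborel. (H (u' x))\<^sup>2) \<le> (LINT x|lebesgue. u x * G (u x))" .
  have pos: "0 \<le> t * G t" for t using HG[of t] by (rule order_trans[OF zero_le_power2])
  have "(LINT x|lebesgue. weak_grad u x \<bullet> weak_grad ?v x) + l * frac_form s u ?v + (LINT x|lebesgue. u x * G (u x))
    = \<mu> * (LINT x|lebesgue. convolution (riesz_potential \<alpha>) (\<lambda>y. \<bar>u y\<bar> powr p) x * \<bar>u x\<bar> powr (p - 2) * u x * G (u x))"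
    using ws v(1) by (auto simp: weak_solution_def)
  also have "\<dots> \<le> \<mu> * (c * e)"
    unfolding c_def using e by (intro mult_left_mono par riesz_term_bound[OF \<alpha> u' _ pos]) (auto simp: \<kappa>_def)
  finally show ?thesis using frac L2 unfolding grad by linarith
qed

section \<open>The integrability gain\<close>

lemma square_integrable_sum:
  assumes "finite I" "\<And>i. i \<in> I \<Longrightarrow> square_integrable (f i)"
  shows "square_integrable (\<lambda>x. \<Sum>i\<in>I. f i x)"
  using assms
proof (induction I)
  case empty
  then show ?case by (simp add: square_integrable_def)
next
  case (insert i I)
  then show ?case by (simp add: square_integrable_add)
qed

lemma weak_dir_deriv_sum:
  assumes h: "\<And>i. weak_dir_deriv (axis i 1) w (h i)"
  shows "weak_dir_deriv z w (\<lambda>x. \<Sum>i\<in>UNIV. z $ i * h i x)"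
  unfolding weak_dir_deriv_def
proof (intro conjI ballI)
  note wd = weak_dir_derivD[OF h]
  show "square_integrable w" by (rule wd(1))
  show "square_integrable (\<lambda>x. \<Sum>i\<in>UNIV. z $ i * h i x)"
    by (intro square_integrable_sum square_integrable_cmult wd) simp
  fix \<phi> :: "real ^ 'a \<Rightarrow> real" assume \<phi>: "\<phi> \<in> test_functions"
  note s\<phi> = test_square_integrable[OF \<phi>]
  have "(LINT x|lborel. w x * frechet_derivative \<phi> (at x) z)
     = (LINT x|lborel. (\<Sum>i\<in>UNIV. z $ i * (w x * frechet_derivative \<phi> (at x) (axis i 1))))"
    by (simp add: frechet_derivative_eq_sum[OF \<phi>, of _ z] partial_deriv_def sum_distrib_left mult_ac)
  also have "\<dots> = (\<Sum>i\<in>UNIV. z $ i * (LINT x|lborel. w x * frechet_derivative \<phi> (at x) (axis i 1)))"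
    by (subst Bochner_Integration.integral_sum)
       (auto intro!: integrable_mult_right square_integrable_mult wd s\<phi>)
  also have "\<dots> = (\<Sum>i\<in>UNIV. - (LINT x|lborel. z $ i * (h i x * \<phi> x)))"
    by (simp add: wd(3)[OF \<phi>])
  also have "\<dots> = - (LINT x|lborel. (\<Sum>i\<in>UNIV. z $ i * (h i x * \<phi> x)))"
    unfolding sum_negf
    by (subst Bochner_Integration.integral_sum) (auto intro!: integrable_mult_right square_integrable_mult wd s\<phi>)
  finally show "(LINT x|lborel. w x * frechet_derivative \<phi> (at x) z) = - (LINT x|lborel. (\<Sum>i\<in>UNIV. z $ i * h i x) * \<phi> x)"
    by (simp add: sum_distrib_right mult.assoc)
qed

lemma gradient_translation_bound:
  fixes w :: "real ^ 'n \<Rightarrow> real"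
  assumes h: "\<And>i. weak_dir_deriv (axis i 1) w (h i)"
    and M: "(LINT x|lborel. (\<Sum>i\<in>UNIV. (h i x)\<^sup>2)) \<le> M\<^sup>2"
  shows "(\<integral>\<^sup>+x. ennreal ((w (x + z) - w x)\<^sup>2) \<partial>lborel) \<le> ennreal ((norm z * M)\<^sup>2)"
proof -
  note wd = weak_dir_derivD[OF h]
  have [measurable]: "h i \<in> borel_measurable borel" for i using wd(2) by measurable
  have int: "integrable lborel (\<lambda>x. \<Sum>i\<in>UNIV. (h i x)\<^sup>2)"
    using wd(2) by (intro Bochner_Integration.integrable_sum) (auto simp: square_integrable_def)
  have "(\<integral>\<^sup>+x. ennreal ((w (x + z) - w x)\<^sup>2) \<partial>lborel) \<le> (\<integral>\<^sup>+x. ennreal ((\<Sum>i\<in>UNIV. z $ i * h i x)\<^sup>2) \<partial>lborel)"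
    by (rule weak_dir_deriv_translation_bound[OF weak_dir_deriv_sum[OF h]])
  also have "\<dots> \<le> (\<integral>\<^sup>+x. ennreal ((norm z)\<^sup>2) * ennreal (\<Sum>i\<in>UNIV. (h i x)\<^sup>2) \<partial>lborel)"
  proof (rule nn_integral_mono)
    fix x
    have "(norm z)\<^sup>2 = (\<Sum>i\<in>UNIV. (z $ i)\<^sup>2)"
      unfolding power2_norm_eq_inner inner_vec_def by (simp add: power2_eq_square)
    then have "(\<Sum>i\<in>UNIV. z $ i * h i x)\<^sup>2 \<le> (norm z)\<^sup>2 * (\<Sum>i\<in>UNIV. (h i x)\<^sup>2)"
      using Cauchy_Schwarz_ineq_sum[of "\<lambda>i. z $ i" "\<lambda>i. h i x" UNIV] by simp
    then show "ennreal ((\<Sum>i\<in>UNIV. z $ i * h i x)\<^sup>2) \<le> ennreal ((norm z)\<^sup>2) * ennreal (\<Sum>i\<in>UNIV. (h i x)\<^sup>2)"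
      by (simp add: ennreal_mult[symmetric] sum_nonneg ennreal_leI)
  qed
  also have "\<dots> = ennreal ((norm z)\<^sup>2) * ennreal (LINT x|lborel. (\<Sum>i\<in>UNIV. (h i x)\<^sup>2))"
    using int by (simp add: nn_integral_cmult nn_integral_eq_integral sum_nonneg)
  also have "\<dots> \<le> ennreal ((norm z)\<^sup>2) * ennreal (M\<^sup>2)"
    by (intro mult_left_mono ennreal_leI M) simp
  also have "\<dots> = ennreal ((norm z * M)\<^sup>2)" by (simp add: ennreal_mult power_mult_distrib)
  finally show ?thesis .
qed

lemma higher_integrability_weak_gradient:
  fixes M r :: real
  assumes M: "M > 0" and r: "2 \<le> r" "r < 2 + 4 / real CARD('n)"
  obtains C :: real where
    "\<And>(w :: real ^ 'n \<Rightarrow> real) h. (\<And>i. weak_dir_deriv (axis i 1) w (h i)) \<Longrightarrow>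
       (LINT x|lborel. (w x)\<^sup>2) \<le> M\<^sup>2 \<Longrightarrow> (LINT x|lborel. (\<Sum>i\<in>UNIV. (h i x)\<^sup>2)) \<le> M\<^sup>2 \<Longrightarrow>
       (\<integral>\<^sup>+x. ennreal (\<bar>w x\<bar> powr r) \<partial>lborel) \<le> ennreal C"
proof -
  have "r < 2 + 4 / real DIM(real ^ 'n)" using r(2) by simp
  from higher_integrability[OF M r(1) this] obtain C where
    C: "\<And>w::real ^ 'n \<Rightarrow> real. w \<in> borel_measurable borel \<Longrightarrow>
       (\<integral>\<^sup>+x. ennreal ((w x)\<^sup>2) \<partial>lborel) \<le> ennreal (M\<^sup>2) \<Longrightarrow>
       (\<And>z. (\<integral>\<^sup>+x. ennreal ((w (x + z) - w x)\<^sup>2) \<partial>lborel) \<le> ennreal ((norm z * M)\<^sup>2)) \<Longrightarrow>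
       (\<integral>\<^sup>+x. ennreal (\<bar>w x\<bar> powr r) \<partial>lborel) \<le> ennreal C"
    by blast
  show ?thesis
  proof (rule that[of C])
    fix w :: "real ^ 'n \<Rightarrow> real" and h
    assume h: "\<And>i. weak_dir_deriv (axis i 1) w (h i)"
      and w2: "(LINT x|lborel. (w x)\<^sup>2) \<le> M\<^sup>2"
      and h2: "(LINT x|lborel. (\<Sum>i\<in>UNIV. (h i x)\<^sup>2)) \<le> M\<^sup>2"
    have sq: "square_integrable w" using weak_dir_derivD(1)[OF h] .
    show "(\<integral>\<^sup>+x. ennreal (\<bar>w x\<bar> powr r) \<partial>lborel) \<le> ennreal C"
    proof (rule C)
      show "w \<in> borel_measurable borel" using sq by measurable
      show "(\<integral>\<^sup>+x. ennreal ((w x)\<^sup>2) \<partial>lborel) \<le> ennreal (M\<^sup>2)"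
        using sq w2 by (subst nn_integral_eq_integral) (auto simp: square_integrable_def intro!: ennreal_leI)
      show "(\<integral>\<^sup>+x. ennreal ((w (x + z) - w x)\<^sup>2) \<partial>lborel) \<le> ennreal ((norm z * M)\<^sup>2)" for z
        by (rule gradient_translation_bound[OF h h2])
    qed
  qed
qed

text \<open>
  The energy estimate bounds \<open>H\<^sub>k(u)\<close> in \<open>H1\<close> independently of the truncation level \<open>k\<close>, hence
  also in \<open>L\<^sup>r\<close>. On \<open>{3 \<le> \<bar>u\<bar> \<le> k}\<close> this controls \<open>\<bar>u\<bar>\<^bsup>\<beta>r\<^esup>\<close>, and the sets exhaust
  \<open>{3 \<le> \<bar>u\<bar>}\<close>; where \<open>\<bar>u\<bar> < 3\<close> the power is dominated by \<open>u\<^sup>2\<close>.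
\<close>

lemma solution_integrability_gain:
  fixes u :: "real ^ 'n \<Rightarrow> real" and \<alpha> :: real
  defines "\<kappa> \<equiv> real CARD('n) - \<alpha>"
  assumes ws: "weak_solution \<alpha> s l \<mu> \<tau> p u" and par: "0 \<le> l" "0 \<le> \<mu>"
    and \<alpha>: "0 < \<alpha>" "\<alpha> < real CARD('n)"
    and u': "u' \<in> borel_measurable borel" "AE x in lborel. u x = u' x"
    and g': "\<And>i. weak_dir_deriv (axis i 1) u' (g' i)" "\<And>i. AE x in lborel. weak_grad u x $ i = g' i x"
    and r: "2 \<le> r" "r < 2 + 4 / real CARD('n)" and \<beta>: "1 < \<beta>"
    and fin: "(\<integral>\<^sup>+x. \<integral>\<^sup>+y. ennreal (\<bar>u' y\<bar> powr p * (1 / norm (x - y) powr \<kappa>) *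
        (if \<bar>u' x\<bar> > 1 then \<bar>u' x\<bar> powr (p + 2 * \<beta> - 2) else 0)) \<partial>lborel \<partial>lborel) < \<infinity>"
  shows "(\<integral>\<^sup>+x. ennreal (\<bar>u' x\<bar> powr (\<beta> * r)) \<partial>lborel) < \<infinity>"
proof -
  define c where "c = riesz_const CARD('n) \<alpha>"
  have c: "c > 0" unfolding c_def by (rule riesz_const_pos[OF \<alpha>])
  note [measurable] = u'(1)
  obtain e where e: "0 \<le> e" "(\<integral>\<^sup>+x. \<integral>\<^sup>+y. ennreal (\<bar>u' y\<bar> powr p * (1 / norm (x - y) powr \<kappa>) *
        (if \<bar>u' x\<bar> > 1 then \<bar>u' x\<bar> powr (p + 2 * \<beta> - 2) else 0)) \<partial>lborel \<partial>lborel) = ennreal e"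
    using fin by (cases "(\<integral>\<^sup>+x. \<integral>\<^sup>+y. ennreal (\<bar>u' y\<bar> powr p * (1 / norm (x - y) powr \<kappa>) *
        (if \<bar>u' x\<bar> > 1 then \<bar>u' x\<bar> powr (p + 2 * \<beta> - 2) else 0)) \<partial>lborel \<partial>lborel)") auto
  \<comment> \<open>The summand \<open>1\<close> only keeps \<open>M\<close> positive.\<close>
  define M where "M = sqrt (\<mu> * (c * e) + 1)"
  have M: "M > 0" "\<mu> * (c * e) \<le> M\<^sup>2" using par c e(1) by (auto simp: M_def add_nonneg_pos)
  obtain C where C: "\<And>(w :: real ^ 'n \<Rightarrow> real) h. (\<And>i. weak_dir_deriv (axis i 1) w (h i)) \<Longrightarrow>
      (LINT x|lborel. (w x)\<^sup>2) \<le> M\<^sup>2 \<Longrightarrow> (LINT x|lborel. (\<Sum>i\<in>UNIV. (h i x)\<^sup>2)) \<le> M\<^sup>2 \<Longrightarrow>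
      (\<integral>\<^sup>+x. ennreal (\<bar>w x\<bar> powr r) \<partial>lborel) \<le> ennreal C"
    using higher_integrability_weak_gradient[OF M(1) r] by blast
  let ?f = "\<lambda>(k::nat) x. if 3 \<le> \<bar>u' x\<bar> \<and> \<bar>u' x\<bar> \<le> real (Suc k) then ennreal ((\<bar>u' x\<bar> / 3) powr (\<beta> * r)) else 0"
  have level: "(\<integral>\<^sup>+x. ?f k x \<partial>lborel) \<le> ennreal C" for k
  proof -
    have k: "0 < real (Suc k)" by simp
    obtain H H' G where H: "\<And>t. (H has_real_derivative H' t) (at t)" "\<And>t. (G has_real_derivative (H' t)\<^sup>2) (at t)"
      "continuous_on UNIV H'" "\<And>t. \<bar>H' t\<bar> \<le> real (Suc k) powr (\<beta> - 1)" "H 0 = 0" "G 0 = 0"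
      "\<And>t. (H t)\<^sup>2 \<le> t * G t"
      "\<And>t. \<bar>G t\<bar> \<le> (if \<bar>t\<bar> > 1 then \<bar>t\<bar> powr (2 * \<beta> - 1) else 0)"
      "\<And>t. 3 \<le> \<bar>t\<bar> \<Longrightarrow> \<bar>t\<bar> \<le> real (Suc k) \<Longrightarrow> (\<bar>t\<bar> / 3) powr \<beta> \<le> \<bar>H t\<bar>"
      by (rule truncated_power_functions[OF \<beta> k]) (rule that)
    have le: "\<bar>t\<bar> powr (p - 1) * \<bar>G t\<bar> \<le> (if \<bar>t\<bar> > 1 then \<bar>t\<bar> powr (p + 2 * \<beta> - 2) else 0)" for t
    proof (cases "\<bar>t\<bar> > 1")
      case True
      have "\<bar>t\<bar> powr (p - 1) * \<bar>G t\<bar> \<le> \<bar>t\<bar> powr (p - 1) * \<bar>t\<bar> powr (2 * \<beta> - 1)"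
        using H(8)[of t] True by (intro mult_left_mono) auto
      also have "\<dots> = \<bar>t\<bar> powr (p + 2 * \<beta> - 2)" by (simp add: powr_add[symmetric])
      finally show ?thesis using True by simp
    next
      case False
      then show ?thesis using H(8)[of t] by simp
    qed
    have "(\<integral>\<^sup>+x. \<integral>\<^sup>+y. ennreal (\<bar>u' y\<bar> powr p * (1 / norm (x - y) powr \<kappa>) * (\<bar>u' x\<bar> powr (p - 1) * \<bar>G (u' x)\<bar>)) \<partial>lborel \<partial>lborel) \<le> ennreal e"
      unfolding e(2)[symmetric] by (intro nn_integral_mono ennreal_leI mult_left_mono le) auto
    then have energy: "(LINT x|lborel. (\<Sum>i\<in>UNIV. (H' (u' x) * g' i x)\<^sup>2)) + (LINT x|lborel. (H (u' x))\<^sup>2) \<le> \<mu> * (c * e)"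
      unfolding c_def by (intro weak_solution_energy[OF ws par \<alpha> u' g' H(1,3,4,5,2,6) e(1)]) (simp add: \<kappa>_def)
    have chain: "weak_dir_deriv (axis i 1) (\<lambda>x. H (u' x)) (\<lambda>x. H' (u' x) * g' i x)" for i
      by (rule weak_dir_deriv_chain[OF g'(1) H(1,3,4,5)])
    have pos: "0 \<le> (LINT x|lborel. (\<Sum>i\<in>UNIV. (H' (u' x) * g' i x)\<^sup>2))" "0 \<le> (LINT x|lborel. (H (u' x))\<^sup>2)"
      by (auto intro!: integral_nonneg_AE sum_nonneg)
    have "(\<integral>\<^sup>+x. ennreal (\<bar>H (u' x)\<bar> powr r) \<partial>lborel) \<le> ennreal C"
      using energy pos M(2) by (intro C[OF chain]) linarith+
    moreover have "?f k x \<le> ennreal (\<bar>H (u' x)\<bar> powr r)" for x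
    proof (cases "3 \<le> \<bar>u' x\<bar> \<and> \<bar>u' x\<bar> \<le> real (Suc k)")
      case True
      then have "((\<bar>u' x\<bar> / 3) powr \<beta>) powr r \<le> \<bar>H (u' x)\<bar> powr r"
        using r(1) by (intro powr_mono2 H(9)) auto
      then show ?thesis using True by (simp add: powr_powr ennreal_leI)
    qed auto
    then have "(\<integral>\<^sup>+x. ?f k x \<partial>lborel) \<le> (\<integral>\<^sup>+x. ennreal (\<bar>H (u' x)\<bar> powr r) \<partial>lborel)"
      by (rule nn_integral_mono)
    ultimately show ?thesis by (rule order_trans[rotated])
  qed
  have "(\<integral>\<^sup>+x. (SUP k. ?f k x) \<partial>lborel) = (SUP k. \<integral>\<^sup>+x. ?f k x \<partial>lborel)"
    by (rule nn_integral_monotone_convergence_SUP) (auto simp: incseq_def le_fun_def)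
  also have "\<dots> \<le> ennreal C" by (intro SUP_least level)
  finally have sup: "(\<integral>\<^sup>+x. (SUP k. ?f k x) \<partial>lborel) \<le> ennreal C" .
  have \<beta>r: "2 \<le> \<beta> * r" using \<beta> r(1) mult_mono[of 1 \<beta> 2 r] by simp
  have sq: "square_integrable u'" using weak_dir_derivD(1)[OF g'(1)] .
  have pw: "ennreal (\<bar>u' x\<bar> powr (\<beta> * r)) \<le> ennreal (3 powr (\<beta> * r)) * ((SUP k. ?f k x) + ennreal ((u' x)\<^sup>2))" for x
  proof -
    have "ennreal ((\<bar>u' x\<bar> / 3) powr (\<beta> * r)) \<le> (SUP k. ?f k x) + ennreal ((u' x)\<^sup>2)"
    proof (cases "3 \<le> \<bar>u' x\<bar>")
      case True
      obtain k where "\<bar>u' x\<bar> \<le> real k" using real_arch_simple by blast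
      then have "ennreal ((\<bar>u' x\<bar> / 3) powr (\<beta> * r)) = ?f k x" using True by simp
      also have "\<dots> \<le> (SUP k. ?f k x)" by (rule SUP_upper) simp
      finally show ?thesis by (intro add_increasing2) auto
    next
      case False
      then have "(\<bar>u' x\<bar> / 3) powr (\<beta> * r) \<le> (\<bar>u' x\<bar> / 3)\<^sup>2"
        using powr_mono'[OF \<beta>r, of "\<bar>u' x\<bar> / 3"] by simp
      also have "\<dots> \<le> (u' x)\<^sup>2" by (simp add: power_divide)
      finally show ?thesis by (intro add_increasing ennreal_leI) auto
    qed
    then have "ennreal (3 powr (\<beta> * r)) * ennreal ((\<bar>u' x\<bar> / 3) powr (\<beta> * r)) \<le> ennreal (3 powr (\<beta> * r)) * ((SUP k. ?f k x) + ennreal ((u' x)\<^sup>2))"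
      by (rule mult_left_mono) simp
    moreover have "3 powr (\<beta> * r) * (\<bar>u' x\<bar> / 3) powr (\<beta> * r) = \<bar>u' x\<bar> powr (\<beta> * r)"
      by (simp add: powr_mult[symmetric])
    ultimately show ?thesis by (simp add: ennreal_mult[symmetric])
  qed
  have "(\<integral>\<^sup>+x. ennreal (\<bar>u' x\<bar> powr (\<beta> * r)) \<partial>lborel)
     \<le> (\<integral>\<^sup>+x. ennreal (3 powr (\<beta> * r)) * ((SUP k. ?f k x) + ennreal ((u' x)\<^sup>2)) \<partial>lborel)"
    by (intro nn_integral_mono pw)
  also have "\<dots> = ennreal (3 powr (\<beta> * r)) * ((\<integral>\<^sup>+x. (SUP k. ?f k x) \<partial>lborel) + (\<integral>\<^sup>+x. ennreal ((u' x)\<^sup>2) \<partial>lborel))"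
    by (subst nn_integral_cmult, measurable, subst nn_integral_add, measurable)
  also have "\<dots> < \<infinity>"
    using sup sq by (simp add: ennreal_mult_less_top square_integrable_iff le_less_trans)
  finally show ?thesis .
qed

section \<open>The bootstrap\<close>

lemma nn_integral_powr_interpolate:
  fixes u :: "'a \<Rightarrow> real"
  assumes [measurable]: "u \<in> borel_measurable M"
    and 2: "(\<integral>\<^sup>+x. ennreal ((u x)\<^sup>2) \<partial>M) < \<infinity>" and q: "(\<integral>\<^sup>+x. ennreal (\<bar>u x\<bar> powr q) \<partial>M) < \<infinity>"
    and a: "2 \<le> a" "a \<le> q"
  shows "(\<integral>\<^sup>+x. ennreal (\<bar>u x\<bar> powr a) \<partial>M) < \<infinity>"
proof -
  have "\<bar>t\<bar> powr a \<le> t\<^sup>2 + \<bar>t\<bar> powr q" for t :: real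
  proof (cases "\<bar>t\<bar> \<le> 1")
    case True
    then have "\<bar>t\<bar> powr a \<le> t\<^sup>2" using powr_mono'[OF a(1), of "\<bar>t\<bar>"] by simp
    then show ?thesis by (simp add: add_increasing2)
  next
    case False
    then have "\<bar>t\<bar> powr a \<le> \<bar>t\<bar> powr q" using a(2) by (intro powr_mono) auto
    then show ?thesis by (simp add: add_increasing)
  qed
  then have "(\<integral>\<^sup>+x. ennreal (\<bar>u x\<bar> powr a) \<partial>M) \<le> (\<integral>\<^sup>+x. ennreal ((u x)\<^sup>2) + ennreal (\<bar>u x\<bar> powr q) \<partial>M)"
    by (intro nn_integral_mono) (simp flip: ennreal_plus add: ennreal_leI)
  also have "\<dots> = (\<integral>\<^sup>+x. ennreal ((u x)\<^sup>2) \<partial>M) + (\<integral>\<^sup>+x. ennreal (\<bar>u x\<bar> powr q) \<partial>M)"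
    by (rule nn_integral_add) measurable
  also have "\<dots> < \<infinity>" using 2 q by simp
  finally show ?thesis .
qed

lemma nn_integral_superlevel_powr_finite:
  fixes u :: "'a \<Rightarrow> real"
  assumes "(\<integral>\<^sup>+x. ennreal (\<bar>u x\<bar> powr q) \<partial>M) < \<infinity>" "a \<le> q"
  shows "(\<integral>\<^sup>+x. ennreal (if \<bar>u x\<bar> > 1 then \<bar>u x\<bar> powr a else 0) \<partial>M) < \<infinity>"
proof -
  have "(\<integral>\<^sup>+x. ennreal (if \<bar>u x\<bar> > 1 then \<bar>u x\<bar> powr a else 0) \<partial>M) \<le> (\<integral>\<^sup>+x. ennreal (\<bar>u x\<bar> powr q) \<partial>M)"
    using assms(2) by (intro nn_integral_mono ennreal_leI) (auto intro!: powr_mono)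
  then show ?thesis using assms(1) by (rule le_less_trans)
qed

text \<open>
  The first factor is taken in \<open>L\<^bsup>q/p\<^esup>\<close> and the second one in \<open>L\<^bsup>1/B\<^esup>\<close>. For the kernel near
  the origin one needs \<open>p / q + B\<close> strictly between \<open>1\<close> and \<open>1 + \<alpha> / n\<close>, and \<open>\<gamma> / B \<le> q\<close>
  with \<open>B < 1\<close>; the conditions on \<open>\<gamma>\<close> are what leaves room for such a \<open>B\<close>. Away from the origin
  the first factor is taken in \<open>L\<^sup>a\<close> with \<open>a = 2 n / (n + \<alpha>)\<close>: the lower bound on \<open>p\<close> is
  \<open>2 \<le> a p\<close>.
\<close>

lemma choquard_energy_finite:
  fixes u' :: "real ^ 'n \<Rightarrow> real" and \<alpha> s p q \<gamma> :: real
  defines "n \<equiv> real CARD('n)"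
  assumes [measurable]: "u' \<in> borel_measurable borel"
    and \<alpha>: "0 < \<alpha>" "\<alpha> < n"
    and p: "(n + \<alpha>) / n \<le> p" "p < q"
    and q: "2 * n * p / (n + \<alpha>) \<le> q"
    and \<gamma>: "0 \<le> \<gamma>" "\<gamma> < q" "\<gamma> + p < q * (1 + \<alpha> / n)"
    and L2: "(\<integral>\<^sup>+x. ennreal ((u' x)\<^sup>2) \<partial>lborel) < \<infinity>"
    and Lq: "(\<integral>\<^sup>+x. ennreal (\<bar>u' x\<bar> powr q) \<partial>lborel) < \<infinity>"
  shows "(\<integral>\<^sup>+x. \<integral>\<^sup>+y. ennreal (\<bar>u' y\<bar> powr p * (1 / norm (x - y) powr (n - \<alpha>)) *
        (if \<bar>u' x\<bar> > 1 then \<bar>u' x\<bar> powr \<gamma> else 0)) \<partial>lborel \<partial>lborel) < \<infinity>"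
proof -
  have n: "n > 0" using \<alpha> by linarith
  have p0: "p > 0" using p(1) n \<alpha> by (meson add_pos_pos divide_pos_pos less_le_trans)
  have q0: "q > 0" using p p0 by linarith
  have "max (\<gamma> / q) (1 - p / q) < min 1 (1 + \<alpha> / n - p / q)"
  proof -
    have "\<gamma> / q + p / q < 1 + \<alpha> / n"
      using \<gamma>(3) q0 by (simp add: add_divide_distrib[symmetric] pos_divide_less_eq mult.commute)
    moreover have "\<gamma> / q < 1" using \<gamma>(2) q0 by simp
    ultimately show ?thesis using p0 q0 \<alpha> n by simp
  qed
  then obtain B where B: "max (\<gamma> / q) (1 - p / q) < B" "B < min 1 (1 + \<alpha> / n - p / q)"
    using dense by blast
  have B0: "B > 0" using B(1) \<gamma>(1) q0 by (smt (verit) divide_nonneg_pos max.cobounded1)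
  let ?\<theta> = "(n + \<alpha>) / (2 * n)"
  have \<theta>: "1 - ?\<theta> = (n - \<alpha>) / (2 * n)" using n by (simp add: field_simps)
  show ?thesis
  proof (rule riesz_energy_finite[of _ _ "1 - B" "1 - p / q" "p / q + B - 1" _ ?\<theta>])
    show "(n - \<alpha>) / (1 - B + (1 - p / q)) < real DIM(real ^ 'n)"
    proof -
      have "(n - \<alpha>) / n < 1 - B + (1 - p / q)" using B n by (simp add: diff_divide_distrib)
      moreover have "0 < (n - \<alpha>) / n" using \<alpha> n by simp
      ultimately have "0 < 1 - B + (1 - p / q)" "n - \<alpha> < (1 - B + (1 - p / q)) * n"
        using n by (linarith, simp only: pos_divide_less_eq)
      then have "(n - \<alpha>) / (1 - B + (1 - p / q)) < n"
        by (simp only: pos_divide_less_eq mult.commute)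
      then show ?thesis by (simp add: n_def)
    qed
    show "(\<integral>\<^sup>+x. ennreal ((\<bar>u' x\<bar> powr p) powr (1 / (1 - B + (p / q + B - 1)))) \<partial>lborel) < \<infinity>"
      using Lq p0 q0 by (simp add: powr_powr)
    have "(if \<bar>t\<bar> > 1 then \<bar>t\<bar> powr \<gamma> else 0) powr (1 / B) = (if \<bar>t\<bar> > 1 then \<bar>t\<bar> powr (\<gamma> / B) else 0)" for t :: real
      by (simp add: powr_powr)
    moreover have "\<gamma> / B \<le> q" using B(1) B0 q0 by (simp add: field_simps)
    ultimately show "(\<integral>\<^sup>+x. ennreal ((if \<bar>u' x\<bar> > 1 then \<bar>u' x\<bar> powr \<gamma> else 0) powr (1 / (1 - p / q + (p / q + B - 1)))) \<partial>lborel) < \<infinity>"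
      using nn_integral_superlevel_powr_finite[OF Lq, of "\<gamma> / B"] by simp
    show "real DIM(real ^ 'n) < (n - \<alpha>) / (1 - ?\<theta>)"
      unfolding \<theta> using \<alpha> n by (simp add: n_def[symmetric])
    have "(\<bar>t\<bar> powr p) powr (1 / ?\<theta>) = \<bar>t\<bar> powr (2 * n * p / (n + \<alpha>))" for t :: real
      by (simp add: powr_powr mult_ac)
    moreover have "2 \<le> 2 * n * p / (n + \<alpha>)" using p(1) n \<alpha> by (simp add: field_simps)
    ultimately show "(\<integral>\<^sup>+x. ennreal ((\<bar>u' x\<bar> powr p) powr (1 / ?\<theta>)) \<partial>lborel) < \<infinity>"
      using nn_integral_powr_interpolate[OF _ L2 Lq _ q] by simp
    show "(\<integral>\<^sup>+x. ennreal (if \<bar>u' x\<bar> > 1 then \<bar>u' x\<bar> powr \<gamma> else 0) \<partial>lborel) < \<infinity>"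
      using nn_integral_superlevel_powr_finite[OF Lq, of \<gamma>] \<gamma>(2) by simp
  qed (use B p0 q0 p \<alpha> n in \<open>auto simp: field_simps\<close>)
qed

theorem theorem1p1:
  fixes u :: "real ^ 'n \<Rightarrow> real"
    and \<alpha> s l \<mu> \<tau> p :: real
  assumes "CARD('n) \<ge> 3"
    and "0 < \<alpha>" and "\<alpha> < real CARD('n)"
    and "0 < s" and "s < 1"
    and "l > 0" and "\<mu> > 0" and "\<tau> > 0"
    and "(real CARD('n) + \<alpha>) / real CARD('n) \<le> p"
    and "p \<le> (2 * s + real CARD('n) + \<alpha>) / real CARD('n)"
    and "u \<in> H1"
    and "weak_solution \<alpha> s l \<mu> \<tau> p u"
  shows "\<forall>q::real. 2 \<le> q \<and>
           q < real CARD('n) / \<alpha> * (2 * real CARD('n) / (real CARD('n) - 2)) \<longrightarrow> u \<in> Lp q"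
proof -
  define n where "n = real CARD('n)"
  have n: "n > 0" and \<alpha>: "0 < \<alpha>" "\<alpha> < n" and s: "0 < s" "s < 1" and par: "0 \<le> l" "0 \<le> \<mu>"
    and p: "(n + \<alpha>) / n \<le> p" "p \<le> (2 * s + n + \<alpha>) / n"
    using assms by (auto simp: n_def)
  have uL: "u \<in> Lp 2" "u \<in> borel_measurable lebesgue" using assms(11) by (auto simp: H1_def Lp_def)
  obtain u' where u': "u' \<in> borel_measurable borel" "AE x in lborel. u x = u' x"
    by (rule borel_representative[OF uL(2)])
  obtain g' where g': "\<And>i. weak_dir_deriv (axis i 1) u' (g' i)" "\<And>i. AE x in lborel. weak_grad u x $ i = g' i x"
    by (rule weak_gradient_representative[OF uL(1) u' weak_grad_in[OF assms(11)]]) blast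
  have sq: "square_integrable u'" using weak_dir_derivD(1)[OF g'(1)] .
  have L2: "(\<integral>\<^sup>+x. ennreal ((u' x)\<^sup>2) \<partial>lborel) < \<infinity>" using sq by (simp add: square_integrable_iff)

  \<comment> \<open>The exponent lies strictly between \<open>2 + 4 s / n\<close>, where the conditions imposed by the largest
    \<open>p\<close> are met with room to spare, and \<open>2 + 4 / n\<close>, the limit of the embedding.\<close>
  define r where "r = 2 + 2 * (1 + s) / n"
  have r: "2 \<le> r" "r < 2 + 4 / n"
    using s n by (auto simp: r_def divide_strict_right_mono)
  have rp: "p < r"
  proof -
    have "p \<le> 2 * s / n + 1 + \<alpha> / n" using p(2) n by (simp add: add_divide_distrib)
    moreover have "\<alpha> / n < 1" "2 * s / n < 2 * (1 + s) / n" using \<alpha> n by (auto simp: divide_strict_right_mono)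
    ultimately show ?thesis by (simp add: r_def)
  qed
  have rpp: "2 * p < r * (1 + \<alpha> / n)"
  proof -
    have "2 * p \<le> 4 * s / n + 2 + 2 * (\<alpha> / n)" using p(2) n by (simp add: field_simps)
    also have "\<dots> < 2 * (1 + s) / n + 2 + 2 * (\<alpha> / n)"
      using s n by (simp add: divide_strict_right_mono)
    also have "\<dots> = r + 2 * (\<alpha> / n)" by (simp add: r_def)
    also have "\<dots> \<le> r + r * (\<alpha> / n)"
      using r(1) \<alpha> n by (intro add_left_mono mult_right_mono) auto
    also have "\<dots> = r * (1 + \<alpha> / n)" by (simp add: distrib_left)
    finally show ?thesis .
  qed
  have rf: "2 * n * p / (n + \<alpha>) \<le> r"
  proof -
    have "2 * n * p \<le> 2 * (2 * s + n + \<alpha>)" using p(2) n by (simp add: field_simps)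
    then have "2 * n * p / (n + \<alpha>) \<le> 2 * (2 * s + n + \<alpha>) / (n + \<alpha>)"
      using n \<alpha> by (intro divide_right_mono) auto
    also have "\<dots> = 2 + 4 * s / (n + \<alpha>)" using n \<alpha> by (simp add: field_simps)
    also have "4 * s / (n + \<alpha>) \<le> 4 * s / n" using n \<alpha> s by (intro divide_left_mono) auto
    also have "4 * s / n \<le> 2 * (1 + s) / n" using s n by (intro divide_right_mono) auto
    finally show ?thesis by (simp add: r_def)
  qed

  have base: "(\<integral>\<^sup>+x. ennreal (\<bar>u' x\<bar> powr r) \<partial>lborel) < \<infinity>"
  proof -
    let ?A = "LINT x|lborel. (u' x)\<^sup>2" and ?B = "LINT x|lborel. (\<Sum>i\<in>UNIV. (g' i x)\<^sup>2)"
    define M where "M = sqrt (?A + ?B + 1)"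
    have AB: "0 \<le> ?A" "0 \<le> ?B" by (auto intro!: integral_nonneg_AE sum_nonneg)
    then have "0 < ?A + ?B + 1" by linarith
    then have M: "M > 0" "M\<^sup>2 = ?A + ?B + 1" unfolding M_def by (simp_all only: real_sqrt_gt_zero real_sqrt_pow2 less_imp_le)
    have "r < 2 + 4 / real CARD('n)" using r(2) by (simp add: n_def)
    from higher_integrability_weak_gradient[OF M(1) r(1) this]
    obtain C where C: "\<And>(w :: real ^ 'n \<Rightarrow> real) h. (\<And>i. weak_dir_deriv (axis i 1) w (h i)) \<Longrightarrow>
        (LINT x|lborel. (w x)\<^sup>2) \<le> M\<^sup>2 \<Longrightarrow> (LINT x|lborel. (\<Sum>i\<in>UNIV. (h i x)\<^sup>2)) \<le> M\<^sup>2 \<Longrightarrow>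
        (\<integral>\<^sup>+x. ennreal (\<bar>w x\<bar> powr r) \<partial>lborel) \<le> ennreal C"
      by blast
    have "(\<integral>\<^sup>+x. ennreal (\<bar>u' x\<bar> powr r) \<partial>lborel) \<le> ennreal C"
      using AB M(2) by (intro C[OF g'(1)]) linarith+
    then show ?thesis by (rule le_less_trans) simp
  qed

  \<comment> \<open>Both conditions on the new exponent in a step from \<open>q\<close> to \<open>q + \<eta>\<close> are affine in \<open>q\<close> with
    nonnegative slope, so it is enough to leave room for \<open>\<eta>\<close> at \<open>q = r\<close>.\<close>
  define \<eta> where "\<eta> = min (r * (r - p)) (r * (r * (1 + \<alpha> / n) - 2 * p)) / 4"
  have \<eta>: "0 < \<eta>" "2 * \<eta> / r < r - p" "2 * \<eta> / r < r * (1 + \<alpha> / n) - 2 * p"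
  proof -
    have r0: "r > 0" using r by linarith
    show "0 < \<eta>" unfolding \<eta>_def using rp rpp r0 by simp
    have "4 * \<eta> \<le> r * (r - p)" "4 * \<eta> \<le> r * (r * (1 + \<alpha> / n) - 2 * p)" by (simp_all add: \<eta>_def)
    moreover have "2 * \<eta> < 4 * \<eta>" using \<open>0 < \<eta>\<close> by simp
    ultimately have "2 * \<eta> < (r - p) * r" "2 * \<eta> < (r * (1 + \<alpha> / n) - 2 * p) * r"
      by (simp_all add: mult.commute[of r])
    then show "2 * \<eta> / r < r - p" "2 * \<eta> / r < r * (1 + \<alpha> / n) - 2 * p"
      using r0 by (simp_all only: pos_divide_less_eq)
  qed
  have step: "(\<integral>\<^sup>+x. ennreal (\<bar>u' x\<bar> powr (q + \<eta>)) \<partial>lborel) < \<infinity>"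
    if q: "r \<le> q" and Lq: "(\<integral>\<^sup>+x. ennreal (\<bar>u' x\<bar> powr q) \<partial>lborel) < \<infinity>" for q
  proof -
    have r0: "r > 0" using r by linarith
    define \<beta> where "\<beta> = (q + \<eta>) / r"
    have \<beta>: "1 < \<beta>" using q \<eta>(1) r0 by (simp add: \<beta>_def)
    have \<beta>2: "2 * \<beta> = 2 * q / r + 2 * \<eta> / r" by (simp add: \<beta>_def add_divide_distrib)
    have "1 < (n + \<alpha>) / n" using n \<alpha> by simp
    then have p1: "1 < p" using p(1) by (rule less_le_trans)
    \<comment> \<open>This reduces the conditions on \<open>q\<close> to those at \<open>q = r\<close>.\<close>
    have lin: "r * (c - 2 / r) \<le> q * (c - 2 / r)" if "1 \<le> c" for c
    proof (rule mult_right_mono[OF q])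
      have "2 / r \<le> 1" using r(1) by simp
      then show "0 \<le> c - 2 / r" using that by linarith
    qed
    have g1: "p + 2 * \<beta> - 2 < q"
    proof -
      have "r - 2 \<le> q - 2 * q / r" using lin[of 1] r0 by (simp add: algebra_simps)
      with \<beta>2 \<eta>(2) show ?thesis by linarith
    qed
    have g2: "p + 2 * \<beta> - 2 + p < q * (1 + \<alpha> / n)"
    proof -
      have "r * (1 + \<alpha> / n) - 2 \<le> q * (1 + \<alpha> / n) - 2 * q / r"
        using lin[of "1 + \<alpha> / n"] r0 \<alpha> n by (simp add: right_diff_distrib mult.commute[of q 2])
      with \<beta>2 \<eta>(3) show ?thesis by linarith
    qed
    have "(\<integral>\<^sup>+x. ennreal (\<bar>u' x\<bar> powr (\<beta> * r)) \<partial>lborel) < \<infinity>"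
    proof (rule solution_integrability_gain[OF assms(12) par _ _ u' g' r(1) _ \<beta>])
      show "(\<integral>\<^sup>+x. \<integral>\<^sup>+y. ennreal (\<bar>u' y\<bar> powr p * (1 / norm (x - y) powr (real CARD('n) - \<alpha>)) *
        (if \<bar>u' x\<bar> > 1 then \<bar>u' x\<bar> powr (p + 2 * \<beta> - 2) else 0)) \<partial>lborel \<partial>lborel) < \<infinity>"
        by (rule choquard_energy_finite[where q=q])
          (use u' \<alpha> p rp q rf g1 g2 L2 Lq \<beta> p1 in \<open>auto simp: n_def\<close>)
    qed (use \<alpha> r in \<open>auto simp: n_def\<close>)
    then show ?thesis using r0 by (simp add: \<beta>_def)
  qed
  have iterate: "(\<integral>\<^sup>+x. ennreal (\<bar>u' x\<bar> powr (r + real m * \<eta>)) \<partial>lborel) < \<infinity>" for m :: nat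
  proof (induction m)
    case 0
    then show ?case using base by simp
  next
    case (Suc m)
    have "r \<le> r + real m * \<eta>" using \<eta>(1) by simp
    from step[OF this Suc] show ?case by (simp add: algebra_simps)
  qed
  have "u \<in> Lp q" if "2 \<le> q" for q
  proof -
    obtain m :: nat where "q / \<eta> \<le> real m" using real_arch_simple by blast
    then have "q \<le> real m * \<eta>" using \<eta>(1) by (simp add: pos_divide_le_eq)
    then have "q \<le> r + real m * \<eta>" using r by linarith
    with that have "(\<integral>\<^sup>+x. ennreal (\<bar>u' x\<bar> powr q) \<partial>lborel) < \<infinity>"
      using nn_integral_powr_interpolate[OF _ L2 iterate] u'(1) by simp
    then show ?thesis using Lp_real_iff[OF u'] by simp
  qed
  then show ?thesis by blast
qed

end
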